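(* Let $k$ be a number field containing a primitive cube root of unity $\zeta$, let $F$ be a field extension of $k$, and let $a,b\in F^*$. Then the scheme $X(a,b)$ (defined in the context) has an $F$-point if and only if $\kappa(a)\smile\kappa(b)=0$ in ${\rm H}^2(\operatorname{Spec} F,\mathbb{Z}/3)$.
   Context: $\kappa:F^*\to {\rm H}^1(\operatorname{Spec} F,\mathbb{Z}/3)$ is the Kummer map, i.e. the connecting map obtained by applying ${\rm H}^*(\operatorname{Spec} F,-)$ to $1\to\mu_3\to\mathbb{G}_m\xrightarrow{z\mapsto z^3}\mathbb{G}_m\to 1$, with $\mu_3$ identified with $\mathbb{Z}/3$ via $\zeta$. Let $H$ be the mod 3 Heisenberg group of upper triangular $3\times3$ matrices over $\mathbb{Z}/3$ with all diagonal entries $1$; let $a_{ij}(g)$ denote the $(i,j)$-entry of $g\in H$, and let $E_{12},E_{23},E_{13}\in H$ be the matrices whose only nonzero off-diagonal entry is a $1$ in position $(1,2)$, $(2,3)$, $(1,3)$ respectively. Let $H$ act on $R_F=F[x_1,x_2,x_3,\alpha,\beta]/(\alpha^3-a,\beta^3-b)$ by $F$-algebra automorphisms determined by: $E_{13}$ sends $x_i\mapsto\zeta x_i$ ($i=1,2,3$) and fixes $\alpha,\beta$; $E_{12}$ sends $x_1\mapsto x_2\mapsto x_3\mapsto x_1$, $\alpha\mapsto\zeta\alpha$, $\beta\mapsto\beta$; $E_{23}$ sends $x_1\mapsto x_1$, $x_2\mapsto\zeta^2x_2$, $x_3\mapsto\zeta x_3$, $\alpha\mapsto\alpha$, $\beta\mapsto\zeta\beta$.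 (This is the action induced by the representation $\operatorname{Ind}_N^H\rho\times a_{12}\times a_{23}$, where $N=\ker a_{12}$ and $\rho(g)=\zeta^{a_{13}(g)}$, with $a_{12},a_{23}$ acting on $\alpha,\beta$ by $\zeta^{a_{12}(g)},\zeta^{a_{23}(g)}$.) Let $A_{a,b}=R_F^H$ be the ring of invariants, $Y=\operatorname{Spec} R_F$, and $p:Y\to\operatorname{Spec} A_{a,b}$ the quotient map. Let $S\subset \operatorname{Spec} A_{a,b}$ be the closed subscheme (with reduced structure) given by the image under $p$ of the union of the fixed loci $Y^h$ of the non-identity elements $h\in H$. Define $X(a,b)=\operatorname{Spec} A_{a,b}\setminus S$, an open subscheme of $\operatorname{Spec} A_{a,b}$. (Equivalently, $A_{a,b}$ is obtained from the invariant ring $k[x_1,x_2,x_3,\alpha^{\pm1},\beta^{\pm1}]^H$, viewed as an algebra over $k[s^{\pm1},t^{\pm1}]$ via $s\mapsto\alpha^3,t\mapsto\beta^3$, by base change along $s\mapsto a$, $t\mapsto b$.) *)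

theory Defs
  imports
    "HOL-Analysis.Analysis"
    "HOL-Algebra.Algebra"
    "HOL-Algebra.Algebraic_Closure_Type"
    "HOL-Library.Poly_Mapping"
begin

section \<open>Number fields and roots of unity\<close>

definition number_field :: "'k::field_char_0 itself \<Rightarrow> bool" where
  "number_field _ \<longleftrightarrow>
     (\<exists>B. finite_dimensional_vector_space (\<lambda>(q::rat) (x::'k). of_rat q * x) B)"

definition primitive_cube_root :: "'k::field \<Rightarrow> bool" where
  "primitive_cube_root \<zeta> \<longleftrightarrow> \<zeta> ^ 3 = 1 \<and> \<zeta> \<noteq> 1"

text \<open>
  \<open>\<int>/3\<close> is the library type \<open>3\<close> of integers modulo 3. The function \<open>zpow \<zeta>\<close> is the
  homomorphism \<open>i \<mapsto> \<zeta>\<^sup>i\<close> from \<open>\<int>/3\<close> to \<open>\<mu>\<^sub>3\<close>, for \<open>\<zeta>\<close> with \<open>\<zeta>\<^sup>3 = 1\<close>.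
\<close>

definition zpow :: "'a::monoid_mult \<Rightarrow> 3 \<Rightarrow> 'a" where
  "zpow \<zeta> i = (if i = 0 then 1 else if i = 1 then \<zeta> else \<zeta> ^ 2)"


section \<open>Cohomology of a field with coefficients in \<open>\<int>/3\<close>\<close>

text \<open>
  \<open>H\<^sup>n(Spec F, \<int>/3)\<close> is the continuous cohomology of the absolute Galois group of \<open>F\<close>
  acting trivially on \<open>\<int>/3\<close>, computed by inhomogeneous cochains. The algebraic closure
  serves as separable closure; the two agree in characteristic 0.
\<close>

type_synonym 'f gal = "'f alg_closure \<Rightarrow> 'f alg_closure"

definition abs_gal :: "('f::field) gal monoid" where
  "abs_gal = \<lparr>carrier = {\<sigma>. bij \<sigma> \<and> (\<forall>x y. \<sigma> (x + y) = \<sigma> x + \<sigma> y) \<and>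
                          (\<forall>x y. \<sigma> (x * y) = \<sigma> x * \<sigma> y) \<and> (\<forall>c. \<sigma> (to_ac c) = to_ac c)},
              mult = (\<circ>), one = id\<rparr>"

text \<open>
  The Krull topology is the topology of pointwise convergence with respect to the discrete
  topology on the algebraic closure.
\<close>

definition krull_topology :: "('f::field) gal topology" where
  "krull_topology =
     subtopology (product_topology (\<lambda>_. discrete_topology UNIV) UNIV) (carrier abs_gal)"

definition cochains1 :: "(('f::field) gal \<Rightarrow> 3) set" where
  "cochains1 = {u \<in> extensional (carrier abs_gal).
     continuous_map krull_topology (discrete_topology UNIV) u}"

definition cochains2 :: "(('f::field) gal \<times> 'f gal \<Rightarrow> 3) set" where
  "cochains2 = {c \<in> extensional (carrier abs_gal \<times> carrier abs_gal).
     continuous_map (prod_topology krull_topology krull_topology) (discrete_topology UNIV) c}"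

text \<open>The coboundary maps. Since the action on \<open>\<int>/3\<close> is trivial, \<open>d0 m\<close> vanishes.\<close>

definition d0 :: "3 \<Rightarrow> ('f::field) gal \<Rightarrow> 3" where
  "d0 m = (\<lambda>\<sigma>\<in>carrier abs_gal. m - m)"

definition d1 :: "(('f::field) gal \<Rightarrow> 3) \<Rightarrow> 'f gal \<times> 'f gal \<Rightarrow> 3" where
  "d1 u = (\<lambda>(\<sigma>, \<tau>)\<in>carrier abs_gal \<times> carrier abs_gal. u \<tau> - u (\<sigma> \<circ> \<tau>) + u \<sigma>)"

definition d2 :: "(('f::field) gal \<times> 'f gal \<Rightarrow> 3) \<Rightarrow> 'f gal \<times> 'f gal \<times> 'f gal \<Rightarrow> 3" where
  "d2 c = (\<lambda>(\<sigma>, \<tau>, \<rho>)\<in>carrier abs_gal \<times> carrier abs_gal \<times> carrier abs_gal.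
     c (\<tau>, \<rho>) - c (\<sigma> \<circ> \<tau>, \<rho>) + c (\<sigma>, \<tau> \<circ> \<rho>) - c (\<sigma>, \<tau>))"

definition Z1 :: "(('f::field) gal \<Rightarrow> 3) monoid" where
  "Z1 = \<lparr>carrier = {u \<in> cochains1. \<forall>x\<in>carrier abs_gal \<times> carrier abs_gal. d1 u x = 0},
         mult = (\<lambda>u v. \<lambda>\<sigma>\<in>carrier abs_gal. u \<sigma> + v \<sigma>),
         one = (\<lambda>\<sigma>\<in>carrier abs_gal. 0)\<rparr>"

definition B1 :: "(('f::field) gal \<Rightarrow> 3) set" where
  "B1 = range d0"

definition H1 :: "(('f::field) gal \<Rightarrow> 3) set monoid" where
  "H1 = Z1 Mod B1"

definition Z2 :: "(('f::field) gal \<times> 'f gal \<Rightarrow> 3) monoid" where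
  "Z2 = \<lparr>carrier = {c \<in> cochains2.
            \<forall>x\<in>carrier abs_gal \<times> carrier abs_gal \<times> carrier abs_gal. d2 c x = 0},
         mult = (\<lambda>c e. \<lambda>x\<in>carrier abs_gal \<times> carrier abs_gal. c x + e x),
         one = (\<lambda>x\<in>carrier abs_gal \<times> carrier abs_gal. 0)\<rparr>"

definition B2 :: "(('f::field) gal \<times> 'f gal \<Rightarrow> 3) set" where
  "B2 = d1 ` cochains1"

definition H2 :: "(('f::field) gal \<times> 'f gal \<Rightarrow> 3) set monoid" where
  "H2 = Z2 Mod B2"

definition cup_cochain ::
    "(('f::field) gal \<Rightarrow> 3) \<Rightarrow> ('f gal \<Rightarrow> 3) \<Rightarrow> 'f gal \<times> 'f gal \<Rightarrow> 3" where
  "cup_cochain u v = (\<lambda>(\<sigma>, \<tau>)\<in>carrier abs_gal \<times> carrier abs_gal. u \<sigma> * v \<tau>)"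

text \<open>
  On classes, i.e. cosets: the class of the product of representatives does not depend on
  the representatives, so that the union below is that single class.
\<close>

definition cup ::
    "(('f::field) gal \<Rightarrow> 3) set \<Rightarrow> ('f gal \<Rightarrow> 3) set \<Rightarrow> ('f gal \<times> 'f gal \<Rightarrow> 3) set" where
  "cup C D = (\<Union>u\<in>C. \<Union>v\<in>D. B2 #>\<^bsub>Z2\<^esub> cup_cochain u v)"

text \<open>
  The connecting map of \<open>1 \<rightarrow> \<mu>\<^sub>3 \<rightarrow> G\<^sub>m \<rightarrow> G\<^sub>m \<rightarrow> 1\<close>: lift \<open>a\<close> along the cube map to \<open>c\<close>, take the
  coboundary \<open>\<sigma> \<mapsto> \<sigma>(c)/c\<close>, which has values in \<open>\<mu>\<^sub>3\<close>, and identify \<open>\<mu>\<^sub>3\<close> with \<open>\<int>/3\<close> via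
  \<open>\<zeta>\<close>. The resulting class is the same for each of the lifts \<open>c\<close>.
\<close>

definition kummer_cocycle :: "'f::field \<Rightarrow> 'f alg_closure \<Rightarrow> 'f gal \<Rightarrow> 3" where
  "kummer_cocycle \<zeta> c = (\<lambda>\<sigma>\<in>carrier abs_gal. THE i. zpow (to_ac \<zeta>) i = \<sigma> c / c)"

definition kummer :: "'f::field \<Rightarrow> 'f \<Rightarrow> ('f gal \<Rightarrow> 3) set" where
  "kummer \<zeta> a = (\<Union>c\<in>{c. c ^ 3 = to_ac a}. B1 #>\<^bsub>Z1\<^esub> kummer_cocycle \<zeta> c)"


section \<open>The Heisenberg group\<close>

text \<open>
  The index type of the matrices is again \<open>3\<close>, with elements 1, 2 and \<open>3 = 0\<close>.
\<close>

definition heis :: "(3^3^3) monoid" where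
  "heis = \<lparr>carrier = {g. g$1$1 = 1 \<and> g$2$2 = 1 \<and> g$3$3 = 1 \<and>
                         g$2$1 = 0 \<and> g$3$1 = 0 \<and> g$3$2 = 0},
           mult = (**), one = mat 1\<rparr>"

definition elem_mat :: "3 \<Rightarrow> 3 \<Rightarrow> 3^3^3" where
  "elem_mat p q = (\<chi> i j. if i = j \<or> (i = p \<and> j = q) then 1 else 0)"


section \<open>The ring \<open>R\<^sub>F\<close> with its action\<close>

datatype var = Xv 3 | Alpha | Beta

type_synonym 'f mpol = "(var \<Rightarrow>\<^sub>0 nat) \<Rightarrow>\<^sub>0 'f"

definition pconst :: "'f::field \<Rightarrow> 'f mpol" where
  "pconst c = Poly_Mapping.single 0 c"

definition pvar :: "var \<Rightarrow> ('f::field) mpol" where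
  "pvar v = Poly_Mapping.single (Poly_Mapping.single v 1) 1"

definition psubst :: "(var \<Rightarrow> 'f mpol) \<Rightarrow> ('f::field) mpol \<Rightarrow> 'f mpol" where
  "psubst s f = (\<Sum>m\<in>Poly_Mapping.keys f.
     pconst (Poly_Mapping.lookup f m) * (\<Prod>v\<in>Poly_Mapping.keys m. s v ^ Poly_Mapping.lookup m v))"

lemma sum_single_lookup:
  "(\<Sum>m\<in>Poly_Mapping.keys f. Poly_Mapping.single m (Poly_Mapping.lookup f m)) = f"
  by (rule poly_mapping_eqI) (simp add: lookup_sum lookup_single when_def in_keys_iff)

lemma mpol_induct [case_names zero single add]:
  fixes f :: "'a \<Rightarrow>\<^sub>0 'b::comm_monoid_add"
  assumes "P 0" and "\<And>m c. P (Poly_Mapping.single m c)"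
    and "\<And>f g. P f \<Longrightarrow> P g \<Longrightarrow> P (f + g)"
  shows "P f"
proof -
  have "P (\<Sum>m\<in>K. Poly_Mapping.single m (Poly_Mapping.lookup f m))" if "finite K" for K
    using that by (induction K) (auto intro: assms)
  from this[of "Poly_Mapping.keys f"] show ?thesis
    by (simp add: sum_single_lookup)
qed

lemma zpow_add:
  fixes \<zeta> :: "'a::comm_monoid_mult"
  assumes "\<zeta> ^ 3 = 1"
  shows "zpow \<zeta> (i + j) = zpow \<zeta> i * zpow \<zeta> j"
proof -
  have e: "\<zeta> * (\<zeta> * \<zeta>) = 1" "\<zeta> * \<zeta> * (\<zeta> * \<zeta>) = \<zeta>"
    using assms by (simp_all add: power3_eq_cube mult.assoc)
  have n: "(2::3) \<noteq> 0" "(2::3) \<noteq> 1" "(1::3) \<noteq> 0" "(3::3) = 0" "(4::3) = 1" "(1::3) + 1 = 2"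
    by simp_all
  show ?thesis
    using exhaust_3[of i] exhaust_3[of j] e n
    by (auto simp: zpow_def power2_eq_square mult.assoc)
qed

lemma pconst_0 [simp]: "pconst 0 = 0"
  and pconst_1 [simp]: "pconst 1 = 1"
  and pconst_add: "pconst (c + d) = pconst c + pconst d"
  and pconst_mult: "pconst (c * d) = pconst c * pconst d"
  by (simp_all add: pconst_def single_add mult_single)

lemma pconst_power: "pconst (c ^ n) = pconst c ^ n"
  by (induction n) (simp_all add: pconst_mult)

lemma psubst_over:
  assumes "finite K" "Poly_Mapping.keys f \<subseteq> K"
  shows "psubst s f = (\<Sum>m\<in>K. pconst (Poly_Mapping.lookup f m) * (\<Prod>v\<in>Poly_Mapping.keys m. s v ^ Poly_Mapping.lookup m v))"
  unfolding psubst_def using assms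
  by (intro sum.mono_neutral_left) (auto simp: in_keys_iff)

lemma psubst_add: "psubst s (f + g) = psubst s f + psubst s g"
proof -
  let ?K = "Poly_Mapping.keys f \<union> Poly_Mapping.keys g"
  have "Poly_Mapping.keys (f + g) \<subseteq> ?K" by (rule keys_add)
  then show ?thesis
    by (simp add: psubst_over[of ?K] lookup_add pconst_add distrib_right sum.distrib)
qed

lemma psubst_0 [simp]: "psubst s 0 = 0"
  by (simp add: psubst_def)

lemma psubst_minus: "psubst s (- f) = - psubst s f"
  using psubst_add[of s f "- f"] by (simp add: eq_neg_iff_add_eq_0 add.commute)

lemma psubst_diff: "psubst s (f - g) = psubst s f - psubst s g"
  using psubst_add[of s f "- g"] psubst_minus[of s g] by simp

lemma psubst_single:
  "psubst s (Poly_Mapping.single m c) = pconst c * (\<Prod>v\<in>Poly_Mapping.keys m. s v ^ Poly_Mapping.lookup m v)"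
  by (cases "c = 0") (simp_all add: psubst_def)

lemma monom_eval_over:
  fixes s :: "var \<Rightarrow> ('f::field) mpol"
  assumes "finite K" "Poly_Mapping.keys m \<subseteq> K"
  shows "(\<Prod>v\<in>Poly_Mapping.keys m. s v ^ Poly_Mapping.lookup m v) = (\<Prod>v\<in>K. s v ^ Poly_Mapping.lookup m v)"
  using assms by (intro prod.mono_neutral_left) (auto simp: in_keys_iff)

lemma psubst_single_mult:
  "psubst s (Poly_Mapping.single m c * Poly_Mapping.single n d) =
   psubst s (Poly_Mapping.single m c) * psubst s (Poly_Mapping.single n d)"
proof -
  let ?K = "Poly_Mapping.keys m \<union> Poly_Mapping.keys n"
  have "Poly_Mapping.keys (m + n) \<subseteq> ?K" by (rule keys_add)
  then have "(\<Prod>v\<in>Poly_Mapping.keys (m + n). s v ^ Poly_Mapping.lookup (m + n) v) =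
      (\<Prod>v\<in>?K. s v ^ Poly_Mapping.lookup m v) * (\<Prod>v\<in>?K. s v ^ Poly_Mapping.lookup n v)"
    by (subst monom_eval_over[of ?K]) (simp_all add: lookup_add power_add prod.distrib)
  also have "\<dots> = (\<Prod>v\<in>Poly_Mapping.keys m. s v ^ Poly_Mapping.lookup m v) *
      (\<Prod>v\<in>Poly_Mapping.keys n. s v ^ Poly_Mapping.lookup n v)"
    by (simp add: monom_eval_over[of ?K m] monom_eval_over[of ?K n])
  finally show ?thesis
    by (simp add: mult_single psubst_single pconst_mult mult_ac)
qed

lemma psubst_mult: "psubst s (f * g) = psubst s f * psubst s g"
proof (induction f rule: mpol_induct)
  case (single m c)
  show ?case
    by (induction g rule: mpol_induct)
      (simp_all add: psubst_single_mult psubst_add distrib_left)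
qed (simp_all add: psubst_add distrib_right)

lemma psubst_pconst [simp]: "psubst s (pconst c) = pconst c"
  unfolding pconst_def by (simp add: psubst_single) (simp add: pconst_def)

lemma psubst_pvar [simp]: "psubst s (pvar v) = s v"
  by (simp add: pvar_def psubst_single)

lemma psubst_1 [simp]: "psubst s 1 = 1"
  using psubst_pconst[of s 1] by simp

lemma psubst_power: "psubst s (f ^ n) = psubst s f ^ n"
  by (induction n) (simp_all add: psubst_mult)

lemma psubst_prod: "psubst s (prod h I) = (\<Prod>i\<in>I. psubst s (h i))"
  by (induction I rule: infinite_finite_induct) (simp_all add: psubst_mult)

lemma psubst_psubst: "psubst s (psubst t f) = psubst (\<lambda>v. psubst s (t v)) f"
  by (induction f rule: mpol_induct)
    (simp_all add: psubst_single psubst_mult psubst_prod psubst_power psubst_add)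

lemma pvar_power: "pvar v ^ n = Poly_Mapping.single (Poly_Mapping.single v n) 1"
  by (induction n) (simp_all add: pvar_def mult_single single_add[symmetric])

lemma prod_single_one:
  "(\<Prod>v\<in>K. Poly_Mapping.single (h v) 1) = (Poly_Mapping.single (sum h K) 1 :: ('f::field) mpol)"
  by (induction K rule: infinite_finite_induct) (simp_all add: mult_single)

lemma psubst_pvar_id: "psubst pvar f = f"
  by (induction f rule: mpol_induct)
    (simp_all add: psubst_add psubst_single pconst_def mult_single pvar_power prod_single_one
      sum_single_lookup)

abbreviation P_ring :: "('f::field) mpol ring" where
  "P_ring \<equiv> ring_of_type_algebra"

definition rel_ideal :: "'f::field \<Rightarrow> 'f \<Rightarrow> 'f mpol set" where
  "rel_ideal a b = Idl\<^bsub>P_ring\<^esub> {pvar Alpha ^ 3 - pconst a, pvar Beta ^ 3 - pconst b}"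

definition R_F :: "'f::field \<Rightarrow> 'f \<Rightarrow> 'f mpol set ring" where
  "R_F a b = P_ring Quot rel_ideal a b"

definition scalar :: "'f::field \<Rightarrow> 'f \<Rightarrow> 'f \<Rightarrow> 'f mpol set" where
  "scalar a b c = rel_ideal a b +>\<^bsub>P_ring\<^esub> pconst c"

text \<open>
  Every \<open>g\<close> in the Heisenberg group is \<open>E\<^sub>1\<^sub>3\<^sup>r E\<^sub>2\<^sub>3\<^sup>q E\<^sub>1\<^sub>2\<^sup>p\<close> with
  \<open>p = g\<^sub>1\<^sub>2\<close>, \<open>q = g\<^sub>2\<^sub>3\<close>, \<open>r = g\<^sub>1\<^sub>3\<close>, and \<open>E\<^sub>2\<^sub>3\<close> multiplies \<open>x\<^sub>j\<close> by \<open>\<zeta>\<^bsup>1-j\<^esup>\<close>;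
  indices are read modulo 3. The lemmas following the definitions confirm the prescribed values on
  the three generators and that this is a (left) action.
\<close>

fun heis_var :: "'f::field \<Rightarrow> 3^3^3 \<Rightarrow> var \<Rightarrow> 'f mpol" where
  "heis_var \<zeta> g (Xv i) =
     pconst (zpow \<zeta> (g$1$3 + g$2$3 * (1 - (i + g$1$2)))) * pvar (Xv (i + g$1$2))"
| "heis_var \<zeta> g Alpha = pconst (zpow \<zeta> (g$1$2)) * pvar Alpha"
| "heis_var \<zeta> g Beta = pconst (zpow \<zeta> (g$2$3)) * pvar Beta"

definition heis_subst :: "'f::field \<Rightarrow> 3^3^3 \<Rightarrow> 'f mpol \<Rightarrow> 'f mpol" where
  "heis_subst \<zeta> g = psubst (heis_var \<zeta> g)"

lemma heis_subst_generators:
  fixes \<zeta> :: "'f::field"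
  shows "heis_subst \<zeta> (elem_mat 1 3) (pvar (Xv i)) = pconst \<zeta> * pvar (Xv i)"
    and "heis_subst \<zeta> (elem_mat 1 3) (pvar Alpha) = pvar Alpha"
    and "heis_subst \<zeta> (elem_mat 1 3) (pvar Beta) = pvar Beta"
    and "heis_subst \<zeta> (elem_mat 1 2) (pvar (Xv 1)) = pvar (Xv 2)"
    and "heis_subst \<zeta> (elem_mat 1 2) (pvar (Xv 2)) = pvar (Xv 3)"
    and "heis_subst \<zeta> (elem_mat 1 2) (pvar (Xv 3)) = pvar (Xv 1)"
    and "heis_subst \<zeta> (elem_mat 1 2) (pvar Alpha) = pconst \<zeta> * pvar Alpha"
    and "heis_subst \<zeta> (elem_mat 1 2) (pvar Beta) = pvar Beta"
    and "heis_subst \<zeta> (elem_mat 2 3) (pvar (Xv 1)) = pvar (Xv 1)"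
    and "heis_subst \<zeta> (elem_mat 2 3) (pvar (Xv 2)) = pconst (\<zeta> ^ 2) * pvar (Xv 2)"
    and "heis_subst \<zeta> (elem_mat 2 3) (pvar (Xv 3)) = pconst \<zeta> * pvar (Xv 3)"
    and "heis_subst \<zeta> (elem_mat 2 3) (pvar Alpha) = pvar Alpha"
    and "heis_subst \<zeta> (elem_mat 2 3) (pvar Beta) = pconst \<zeta> * pvar Beta"
proof -
  have "heis_subst \<zeta> (elem_mat 1 2) (pvar (Xv 3)) = pvar (Xv 4)"
    by (simp add: heis_subst_def elem_mat_def zpow_def)
  moreover have "Xv 4 = Xv 1"
    by simp
  ultimately show "heis_subst \<zeta> (elem_mat 1 2) (pvar (Xv 3)) = pvar (Xv 1)"
    by (simp only:)
qed (simp_all add: heis_subst_def elem_mat_def zpow_def)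

lemma heis_mult_entries:
  assumes "g \<in> carrier heis" "h \<in> carrier heis"
  shows "(g ** h)$1$2 = g$1$2 + h$1$2" "(g ** h)$2$3 = g$2$3 + h$2$3"
    "(g ** h)$1$3 = g$1$3 + h$1$3 + g$1$2 * h$2$3"
    "(g ** h)$1$1 = 1" "(g ** h)$2$2 = 1" "(g ** h)$3$3 = 1"
    "(g ** h)$2$1 = 0" "(g ** h)$3$1 = 0" "(g ** h)$3$2 = 0"
  using assms by (simp_all add: heis_def matrix_matrix_mult_def sum_3)

lemma heis_exponents:
  fixes i :: "'a::comm_ring_1"
  shows "r + r' + p * q' + (q + q') * (1 - (i + (p + p'))) =
      (r' + q' * (1 - (i + p'))) + (r + q * (1 - (i + p' + p)))"
proof -
  have "1 - (i + (p + p')) = (1 - (i + p' + p))" "1 - (i + p') = (1 - (i + p' + p)) + p"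
    by simp_all
  then show ?thesis
    by (simp only: distrib_left distrib_right add_ac mult.commute)
qed

lemma heis_subst_mult:
  assumes "\<zeta> ^ 3 = 1" "g \<in> carrier heis" "h \<in> carrier heis"
  shows "heis_subst \<zeta> (g ** h) f = heis_subst \<zeta> g (heis_subst \<zeta> h f)"
proof -
  note entries = heis_mult_entries[OF assms(2,3)]
  have "heis_var \<zeta> (g ** h) v = psubst (heis_var \<zeta> g) (heis_var \<zeta> h v)" for v
  proof (cases v)
    case (Xv i)
    note heis_exponents[of "g$1$3" "h$1$3" "g$1$2" "h$2$3" "g$2$3" i "h$1$2"]
    moreover have "i + (g$1$2 + h$1$2) = i + h$1$2 + g$1$2"
      by (simp only: add_ac)
    ultimately show ?thesis
      unfolding Xv heis_var.simps entries psubst_mult psubst_pconst psubst_pvar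
      by (simp only: zpow_add[OF assms(1)] pconst_mult mult.assoc)
  next
    case Alpha
    show ?thesis
      unfolding Alpha heis_var.simps entries psubst_mult psubst_pconst psubst_pvar
        zpow_add[OF assms(1)] pconst_mult
      by (simp only: mult_ac)
  next
    case Beta
    show ?thesis
      unfolding Beta heis_var.simps entries psubst_mult psubst_pconst psubst_pvar
        zpow_add[OF assms(1)] pconst_mult
      by (simp only: mult_ac)
  qed
  then have "heis_var \<zeta> (g ** h) = (\<lambda>v. psubst (heis_var \<zeta> g) (heis_var \<zeta> h v))"
    by (rule ext)
  then show ?thesis
    by (simp only: heis_subst_def psubst_psubst)
qed

lemma heis_subst_one: "heis_subst \<zeta> (mat 1) f = f"
proof -
  have "heis_var \<zeta> (mat 1) = (pvar :: var \<Rightarrow> _)"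
  proof
    fix v show "heis_var \<zeta> (mat 1) v = pvar v"
      by (cases v) (simp_all add: mat_def zpow_def)
  qed
  then show ?thesis by (simp add: heis_subst_def psubst_pvar_id)
qed

lemma heis_mult_closed:
  assumes "g \<in> carrier heis" "h \<in> carrier heis"
  shows "g ** h \<in> carrier heis"
  using heis_mult_entries[OF assms] by (simp add: heis_def)

lemma three_torsion: "x + (x + x) = 0" for x :: 3
  using exhaust_3[of x] by fastforce

lemma heis_eq_one:
  fixes g :: "3^3^3"
  assumes "g \<in> carrier heis" "g$1$2 = 0" "g$2$3 = 0" "g$1$3 = 0"
  shows "g = mat 1"
  using assms by (simp add: heis_def vec_eq_iff[of g] vec_eq_iff[of "vec_nth g _"] forall_3 mat_def)

lemma heis_exponent_3:
  assumes g: "g \<in> carrier heis"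
  shows "g ** (g ** g) = mat 1"
proof (rule heis_eq_one)
  note e = heis_mult_entries[OF g heis_mult_closed[OF g g]] heis_mult_entries[OF g g]
  show "g ** (g ** g) \<in> carrier heis"
    by (intro heis_mult_closed g)
  show "(g ** (g ** g))$1$2 = 0" "(g ** (g ** g))$2$3 = 0"
    unfolding e by (rule three_torsion)+
  have "x + (x + x + y) + (y + y) = (x + (x + x)) + (y + (y + y))" for x y :: 3
    by (simp only: add_ac)
  then show "(g ** (g ** g))$1$3 = 0"
    unfolding e distrib_left three_torsion by simp
qed

lemma P_ring_sel [simp]:
  "carrier P_ring = UNIV" "f \<otimes>\<^bsub>P_ring\<^esub> g = f * g" "f \<oplus>\<^bsub>P_ring\<^esub> g = f + g"
  "\<one>\<^bsub>P_ring\<^esub> = 1" "\<zero>\<^bsub>P_ring\<^esub> = 0"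
  by (simp_all add: ring_of_type_algebra_def)

lemma rel_ideal_ideal: "ideal (rel_ideal a b) P_ring"
  unfolding rel_ideal_def by (rule ring.genideal_ideal[OF ring_from_type_algebra]) simp

lemma zpow_cube:
  fixes \<zeta> :: "'a::comm_monoid_mult"
  assumes "\<zeta> ^ 3 = 1"
  shows "zpow \<zeta> i ^ 3 = 1"
proof -
  have "(\<zeta> ^ 2) ^ 3 = (\<zeta> ^ 3) ^ 2"
    by (simp only: power_mult[symmetric] mult.commute)
  with assms show ?thesis
    by (simp add: zpow_def)
qed

lemma heis_subst_rel_ideal_le:
  assumes "\<zeta> ^ 3 = 1"
  shows "heis_subst \<zeta> g ` rel_ideal a b \<subseteq> rel_ideal a b"
proof -
  have "ring_hom_ring P_ring P_ring (heis_subst \<zeta> g)"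
    by (rule ring_hom_ringI2[OF ring_from_type_algebra ring_from_type_algebra])
      (auto simp: ring_hom_def heis_subst_def psubst_add psubst_mult)
  then have J: "ideal {f \<in> carrier P_ring. heis_subst \<zeta> g f \<in> rel_ideal a b} P_ring"
    by (rule ring_hom_ring.ideal_vimage) (rule rel_ideal_ideal)
  have "(pconst (zpow \<zeta> i) * f) ^ 3 = f ^ 3" for i f
    by (simp only: power_mult_distrib pconst_power[symmetric] zpow_cube[OF assms] pconst_1 mult_1)
  then have "heis_subst \<zeta> g (pvar Alpha ^ 3 - pconst a) = pvar Alpha ^ 3 - pconst a"
    and "heis_subst \<zeta> g (pvar Beta ^ 3 - pconst b) = pvar Beta ^ 3 - pconst b"
    by (simp_all add: heis_subst_def psubst_diff psubst_power)
  moreover have "{pvar Alpha ^ 3 - pconst a, pvar Beta ^ 3 - pconst b} \<subseteq> rel_ideal a b"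
    unfolding rel_ideal_def by (rule ring.genideal_self[OF ring_from_type_algebra]) simp
  ultimately have "rel_ideal a b \<subseteq> {f \<in> carrier P_ring. heis_subst \<zeta> g f \<in> rel_ideal a b}"
    by (subst rel_ideal_def)
      (intro ring.genideal_minimal[OF ring_from_type_algebra J], simp)
  then show ?thesis by auto
qed

lemma heis_subst_rel_ideal:
  assumes "\<zeta> ^ 3 = 1" "g \<in> carrier heis"
  shows "heis_subst \<zeta> g ` rel_ideal a b = rel_ideal a b"
proof
  show "rel_ideal a b \<subseteq> heis_subst \<zeta> g ` rel_ideal a b"
  proof
    fix f assume f: "f \<in> rel_ideal a b"
    have "heis_subst \<zeta> g (heis_subst \<zeta> (g ** g) f) = f"
      by (simp only: heis_subst_mult[OF assms heis_mult_closed[OF assms(2,2)], symmetric]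
          heis_exponent_3[OF assms(2)] heis_subst_one)
    moreover have "heis_subst \<zeta> (g ** g) f \<in> rel_ideal a b"
      using heis_subst_rel_ideal_le[OF assms(1), of "g ** g" a b] f by blast
    ultimately show "f \<in> heis_subst \<zeta> g ` rel_ideal a b"
      by (metis imageI)
  qed
qed (rule heis_subst_rel_ideal_le[OF assms(1)])


text \<open>
  Elements of \<open>R_F a b\<close> are cosets of \<open>rel_ideal a b\<close>, which is stable under the substitutions;
  the induced automorphism is the image map on cosets.
\<close>

definition act :: "'f::field \<Rightarrow> 3^3^3 \<Rightarrow> 'f mpol set \<Rightarrow> 'f mpol set" where
  "act \<zeta> g C = heis_subst \<zeta> g ` C"

lemma act_coset:
  assumes "\<zeta> ^ 3 = 1" "g \<in> carrier heis"
  shows "act \<zeta> g (rel_ideal a b +>\<^bsub>P_ring\<^esub> f) = rel_ideal a b +>\<^bsub>P_ring\<^esub> heis_subst \<zeta> g f"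
proof -
  have coset: "rel_ideal a b +>\<^bsub>P_ring\<^esub> f = (\<lambda>h. h + f) ` rel_ideal a b" for f
    by (auto simp: a_r_coset_def')
  have "heis_subst \<zeta> g (h + f) = heis_subst \<zeta> g h + heis_subst \<zeta> g f" for h
    by (simp add: heis_subst_def psubst_add)
  then have "act \<zeta> g (rel_ideal a b +>\<^bsub>P_ring\<^esub> f) =
      (\<lambda>h. h + heis_subst \<zeta> g f) ` heis_subst \<zeta> g ` rel_ideal a b"
    by (simp add: coset act_def image_image)
  then show ?thesis
    by (simp only: coset heis_subst_rel_ideal[OF assms])
qed

lemma act_mult:
  assumes "\<zeta> ^ 3 = 1" "g \<in> carrier heis" "h \<in> carrier heis"
  shows "act \<zeta> (g \<otimes>\<^bsub>heis\<^esub> h) C = act \<zeta> g (act \<zeta> h C)"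
  using heis_subst_mult[OF assms] by (simp add: act_def heis_def image_image)

lemma act_one: "act \<zeta> \<one>\<^bsub>heis\<^esub> C = C"
  by (simp add: act_def heis_def heis_subst_one)


section \<open>The scheme \<open>X(a,b)\<close> and its points\<close>

definition Spec :: "('r, 'm) ring_scheme \<Rightarrow> 'r set set" where
  "Spec R = {P. primeideal P R}"

definition vanishing :: "('r, 'm) ring_scheme \<Rightarrow> 'r set \<Rightarrow> 'r set set" where
  "vanishing R I = {P \<in> Spec R. I \<subseteq> P}"

definition A_ab :: "'f::field \<Rightarrow> 'f \<Rightarrow> 'f \<Rightarrow> 'f mpol set ring" where
  "A_ab \<zeta> a b = (R_F a b)
     \<lparr>carrier := {f \<in> carrier (R_F a b). \<forall>g\<in>carrier heis. act \<zeta> g f = f}\<rparr>"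

definition quotient_map :: "'f::field \<Rightarrow> 'f \<Rightarrow> 'f \<Rightarrow> 'f mpol set set \<Rightarrow> 'f mpol set set" where
  "quotient_map \<zeta> a b P = P \<inter> carrier (A_ab \<zeta> a b)"

text \<open>
  The fixed locus \<open>Y\<^sup>h\<close>, the equalizer of \<open>h\<close> and the identity on \<open>Y = Spec R_F\<close>, is the closed
  subscheme defined by the ideal generated by all \<open>h f - f\<close>. This differs from the set of prime
  ideals \<open>P\<close> with \<open>h P = P\<close>.
\<close>

definition fixed_ideal :: "'f::field \<Rightarrow> 'f \<Rightarrow> 'f \<Rightarrow> 3^3^3 \<Rightarrow> 'f mpol set set" where
  "fixed_ideal \<zeta> a b h =
     Idl\<^bsub>R_F a b\<^esub> {act \<zeta> h f \<ominus>\<^bsub>R_F a b\<^esub> f | f. f \<in> carrier (R_F a b)}"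

definition fixed_locus :: "'f::field \<Rightarrow> 'f \<Rightarrow> 'f \<Rightarrow> 3^3^3 \<Rightarrow> 'f mpol set set set" where
  "fixed_locus \<zeta> a b h = vanishing (R_F a b) (fixed_ideal \<zeta> a b h)"

definition S_locus :: "'f::field \<Rightarrow> 'f \<Rightarrow> 'f \<Rightarrow> 'f mpol set set set" where
  "S_locus \<zeta> a b = quotient_map \<zeta> a b ` (\<Union>h\<in>carrier heis - {\<one>\<^bsub>heis\<^esub>}. fixed_locus \<zeta> a b h)"

definition X_space :: "'f::field \<Rightarrow> 'f \<Rightarrow> 'f \<Rightarrow> 'f mpol set set set" where
  "X_space \<zeta> a b = Spec (A_ab \<zeta> a b) - S_locus \<zeta> a b"

text \<open>
  \<open>F\<close>-points of the open subscheme \<open>X_space\<close> of \<open>Spec A\<close>: the \<open>F\<close>-morphisms \<open>Spec F \<rightarrow> Spec A\<close>,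
  i.e. \<open>F\<close>-algebra homomorphisms \<open>A \<rightarrow> F\<close>, that send the point of \<open>Spec F\<close> into \<open>X_space\<close>.
\<close>

definition affine_points :: "'f::field \<Rightarrow> 'f \<Rightarrow> 'f \<Rightarrow> ('f mpol set \<Rightarrow> 'f) set" where
  "affine_points \<zeta> a b =
     {\<phi> \<in> extensional (carrier (A_ab \<zeta> a b)) \<inter> ring_hom (A_ab \<zeta> a b) ring_of_type_algebra.
        \<forall>c. \<phi> (scalar a b c) = c}"

definition X_points :: "'f::field \<Rightarrow> 'f \<Rightarrow> 'f \<Rightarrow> ('f mpol set \<Rightarrow> 'f) set" where
  "X_points \<zeta> a b =
     {\<phi> \<in> affine_points \<zeta> a b.
        a_kernel (A_ab \<zeta> a b) ring_of_type_algebra \<phi> \<in> X_space \<zeta> a b}"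

end

theory Submission
  imports Defs
begin

text \<open>
  An \<open>F\<close>-point of \<open>X(a,b)\<close> is an orbit of geometric points \<open>t = (x,\<alpha>,\<beta>)\<close> of \<open>Y\<close> with trivial
  stabilizers that is stable under the absolute Galois group. Then \<open>\<sigma>(t) = \<rho>(\<sigma>) t\<close> for a continuous
  homomorphism \<open>\<rho>\<close> to the Heisenberg group, whose entries (1,2) and (2,3) are the Kummer cocycles of
  \<open>a\<close> and \<open>b\<close>, and whose entry (1,3) is, up to sign, a cochain with coboundary their cup product.
  Conversely, such a cochain gives \<open>\<rho>\<close>, and the vector \<open>x\<close> exists by Hilbert's Theorem 90 for the
  representation of the Heisenberg group on the linear forms in the \<open>x\<^sub>i\<close>.
\<close>

hide_const (open) up_ring.coeff up_ring.monom module.smult Polynomials.degree Poly_Mapping.degree Polynomials.lead_coeff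

section \<open>Fixed field of the absolute Galois group\<close>

text \<open>Three obstacles shape the proof. Automorphisms of the closure are bare functions, so
  that their common fixed elements are those of \<open>F\<close> must be earned by extending
  embeddings. An \<open>F\<close>-point of the quotient knows only the values of invariants, so a
  geometric point above it has to be constructed: the cubes of the x_i are permuted cyclically,
  hence satisfy the cubic of their symmetric functions, and this integrality replaces a general
  Nullstellensatz. Finally, S is an image, so a prime of a fixed locus over an
  \<open>F\<close>-point need not be the kernel of evaluation at the chosen geometric point; only
  invariants can be compared. Characteristic 0 enters through separability, the trace of 1 and the
  order of a stabilizer. That \<rho> is a homomorphism and not an antihomomorphism comes from the
  group acting on points from the right, in an action that commutes with Galois because \<zeta> lies
  in \<open>F\<close>. The (1,3) entry of a product is r + r' + p q', so it is -r that has
  coboundary p q'.\<close>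

lemma poly_root_degree_nonzero:
  assumes "p \<noteq> 0" "poly p x = 0"
  shows "degree p \<noteq> 0"
proof
  assume "degree p = 0"
  then obtain c where "p = [:c:]" by (rule degree_eq_zeroE)
  with assms show False by simp
qed

text \<open>From c + x p(x) = 0 with c nonzero the inverse is -p(x)/c; if c = 0, the factor x
  cancels and the induction goes on with p.\<close>

lemma alg_closure_inverse_poly:
  fixes x :: "'f::field alg_closure"
  assumes "x \<noteq> 0"
  obtains q :: "'f poly" where "inverse x = poly (map_poly to_ac q) x"
proof -
  obtain p :: "'f poly" where "p \<noteq> 0" "poly (map_poly to_ac p) x = 0"
    using alg_closure_algebraic .
  then have "\<exists>q :: 'f poly. inverse x = poly (map_poly to_ac q) x"
  proof (induction p)
    case (pCons c p)
    have eq: "to_ac c + x * poly (map_poly to_ac p) x = 0"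
      using pCons.prems by (simp add: map_poly_pCons)
    show ?case
    proof (cases "c = 0")
      case True
      with pCons eq assms show ?thesis by auto
    next
      case False
      have "poly (map_poly to_ac (smult (- 1 / c) p)) x = to_ac (- 1 / c) * poly (map_poly to_ac p) x"
        by (subst map_poly_smult) auto
      also have "\<dots> = inverse x"
        using eq False assms
          by (simp add: field_simps) (metis add.commute add_eq_0_iff2)
      finally show ?thesis by metis
    qed
  qed simp
  with that show ?thesis by blast
qed

text \<open>
  Embeddings of intermediate fields into the algebraic closure, given by their graphs. Closure
  under inverses need not be required, since the inverse of an algebraic element is a polynomial in it.
\<close>

definition partial_emb :: "('f::field alg_closure \<times> 'f alg_closure) set \<Rightarrow> bool" where
  "partial_emb \<Gamma> \<longleftrightarrow> (\<forall>c. (to_ac c, to_ac c) \<in> \<Gamma>) \<and>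
     (\<forall>x y x' y'. (x, y) \<in> \<Gamma> \<longrightarrow> (x', y') \<in> \<Gamma> \<longrightarrow> (x + x', y + y') \<in> \<Gamma> \<and> (x * x', y * y') \<in> \<Gamma>) \<and>
     (\<forall>y. (0, y) \<in> \<Gamma> \<longrightarrow> y = 0)"

lemma partial_embD:
  assumes "partial_emb \<Gamma>"
  shows "(to_ac c, to_ac c) \<in> \<Gamma>"
    and "(x, y) \<in> \<Gamma> \<Longrightarrow> (x', y') \<in> \<Gamma> \<Longrightarrow> (x + x', y + y') \<in> \<Gamma>"
    and "(x, y) \<in> \<Gamma> \<Longrightarrow> (x', y') \<in> \<Gamma> \<Longrightarrow> (x * x', y * y') \<in> \<Gamma>"
    and "(0, y) \<in> \<Gamma> \<Longrightarrow> y = 0"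
  using assms by (simp_all add: partial_emb_def)

lemma partial_emb_diff:
  assumes "partial_emb \<Gamma>" "(x, y) \<in> \<Gamma>" "(x', y') \<in> \<Gamma>"
  shows "(x - x', y - y') \<in> \<Gamma>"
  using partial_embD(2)[OF assms(1,2) partial_embD(3)[OF assms(1) partial_embD(1)[OF assms(1), of "-1"] assms(3)]]
  by simp

lemma partial_emb_unique:
  assumes "partial_emb \<Gamma>" "(x, y) \<in> \<Gamma>" "(x, y') \<in> \<Gamma>"
  shows "y = y'"
  using partial_embD(4)[OF assms(1), of "y - y'"] partial_emb_diff[OF assms] by simp

lemma partial_emb_sum:
  assumes "partial_emb \<Gamma>" "\<And>i. i \<in> I \<Longrightarrow> (f i, g i) \<in> \<Gamma>"
  shows "(sum f I, sum g I) \<in> \<Gamma>"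
  using assms(2) partial_embD(1)[OF assms(1), of 0]
  by (induction I rule: infinite_finite_induct) (auto intro: partial_embD(2,3)[OF assms(1)])

lemma partial_emb_power:
  assumes "partial_emb \<Gamma>" "(x, y) \<in> \<Gamma>"
  shows "(x ^ n, y ^ n) \<in> \<Gamma>"
  using assms(2) partial_embD(1)[OF assms(1), of 1]
  by (induction n) (auto intro: partial_embD(2,3)[OF assms(1)])

text \<open>With q(x) the inverse of x, the pair (1, y q(y)) lies in the graph, so y q(y) = 1. This
  gives injectivity although the graph is only closed under ring operations.\<close>

lemma partial_emb_nonzero:
  assumes \<Gamma>: "partial_emb \<Gamma>" "(x, y) \<in> \<Gamma>" "x \<noteq> 0"
  shows "y \<noteq> 0"
proof
  assume [simp]: "y = 0"
  obtain q where q: "inverse x = poly (map_poly to_ac q) x"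
    using alg_closure_inverse_poly[OF \<open>x \<noteq> 0\<close>] .
  have "(poly (map_poly to_ac q) x, poly (map_poly to_ac q) y) \<in> \<Gamma>" for q
    unfolding poly_altdef
    by (subst (2) degree_map_poly, simp, subst degree_map_poly, simp)
      (intro partial_emb_sum partial_emb_power partial_embD(3)[OF \<Gamma>(1)] \<Gamma>,
        simp add: coeff_map_poly partial_embD(1)[OF \<Gamma>(1)])
  from partial_embD(3)[OF \<Gamma>(1,2) this[of q]] have "(1, 0) \<in> \<Gamma>"
    using \<open>x \<noteq> 0\<close> by (simp flip: q)
  with partial_embD(1)[OF \<Gamma>(1), of 1] partial_emb_unique[OF \<Gamma>(1)] show False
    by (metis to_ac_1 zero_neq_one)
qed

section \<open>Extending an embedding by one algebraic element\<close>

definition graph_polys :: "('a::zero \<times> 'b::zero) set \<Rightarrow> ('a poly \<times> 'b poly) set" where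
  "graph_polys \<Gamma> = {(p, q). \<forall>i. (coeff p i, coeff q i) \<in> \<Gamma>}"

lemma graph_polysI: "(\<And>i. (coeff p i, coeff q i) \<in> \<Gamma>) \<Longrightarrow> (p, q) \<in> graph_polys \<Gamma>"
  and graph_polysD: "(p, q) \<in> graph_polys \<Gamma> \<Longrightarrow> (coeff p i, coeff q i) \<in> \<Gamma>"
  by (auto simp: graph_polys_def)

lemma graph_polys_add:
  assumes "partial_emb \<Gamma>" "(p, q) \<in> graph_polys \<Gamma>" "(p', q') \<in> graph_polys \<Gamma>"
  shows "(p + p', q + q') \<in> graph_polys \<Gamma>"
  using assms by (auto intro!: graph_polysI partial_embD(2) dest: graph_polysD)

lemma graph_polys_diff:
  assumes "partial_emb \<Gamma>" "(p, q) \<in> graph_polys \<Gamma>" "(p', q') \<in> graph_polys \<Gamma>"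
  shows "(p - p', q - q') \<in> graph_polys \<Gamma>"
  using assms by (auto intro!: graph_polysI partial_emb_diff dest: graph_polysD)

lemma graph_polys_mult:
  assumes "partial_emb \<Gamma>" "(p, q) \<in> graph_polys \<Gamma>" "(p', q') \<in> graph_polys \<Gamma>"
  shows "(p * p', q * q') \<in> graph_polys \<Gamma>"
  using assms
  by (auto intro!: graph_polysI partial_emb_sum partial_embD(3) dest: graph_polysD simp: coeff_mult)

lemma graph_polys_const:
  assumes "partial_emb \<Gamma>" "(x, y) \<in> \<Gamma>"
  shows "([:x:], [:y:]) \<in> graph_polys \<Gamma>"
  using assms partial_embD(1)[OF assms(1), of 0]
  by (auto intro!: graph_polysI simp: coeff_pCons split: nat.split)

lemma graph_polys_monom:
  assumes "partial_emb \<Gamma>" "(x, y) \<in> \<Gamma>"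
  shows "(monom x n, monom y n) \<in> graph_polys \<Gamma>"
  using assms partial_embD(1)[OF assms(1), of 0] by (auto intro!: graph_polysI)

text \<open>Division by \<open>m\<close>, performed in parallel on \<open>p\<close> and on its
  transport \<open>q\<close>: the remainder has root \<open>z\<close> and degree below that of
  \<open>m\<close>, so it vanishes, and \<open>q\<close> is a multiple of \<open>m'\<close> up to a
  nonzero factor.\<close>

lemma graph_polys_root:
  assumes \<Gamma>: "partial_emb \<Gamma>"
    and m: "(m, m') \<in> graph_polys \<Gamma>" "m \<noteq> 0" "poly m z = 0" "poly m' z' = 0"
    and minimal: "\<And>p q. (p, q) \<in> graph_polys \<Gamma> \<Longrightarrow> p \<noteq> 0 \<Longrightarrow> poly p z = 0 \<Longrightarrow> degree m \<le> degree p"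
    and p: "(p, q) \<in> graph_polys \<Gamma>" "poly p z = 0"
  shows "poly q z' = 0"
proof -
  \<comment> \<open>\<open>n\<close> is a strict bound on the support rather than the degree, so
    that the base case is p = 0.\<close>
  have "\<forall>i\<ge>n. coeff p i = 0 \<Longrightarrow> (p, q) \<in> graph_polys \<Gamma> \<Longrightarrow> poly p z = 0 \<Longrightarrow> poly q z' = 0" for n
  proof (induction n arbitrary: p q)
    case 0
    then have "coeff q i = 0" for i
      using partial_embD(4)[OF \<Gamma>] graph_polysD[of p q \<Gamma> i] by simp
    then have "q = 0" by (simp add: poly_eq_iff)
    then show ?case by simp
  next
    case (Suc n)
    show ?case
    proof (cases "coeff p n = 0")
      case True
      with Suc.prems(1) have "\<forall>i\<ge>n. coeff p i = 0"
        by (metis Suc_leI le_neq_implies_less)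
      with Suc.IH Suc.prems show ?thesis by blast
    next
      case False
      define d where "d = degree m"
      have "degree p \<le> n"
        using Suc.prems(1) by (intro degree_le) auto
      moreover have "d \<le> degree p"
        unfolding d_def using Suc.prems(3) False by (intro minimal[OF Suc.prems(2)]) auto
      ultimately have dn: "d \<le> n" by simp
      \<comment> \<open>Multiplying across by the leading coefficient of \<open>m\<close> avoids
        division; the matching factor \<open>coeff m' d\<close> is nonzero and is cancelled at the
        end.\<close>
      let ?p = "[:coeff m d:] * p - monom (coeff p n) (n - d) * m"
      let ?q = "[:coeff m' d:] * q - monom (coeff q n) (n - d) * m'"
      have pq: "(?p, ?q) \<in> graph_polys \<Gamma>"
        by (intro graph_polys_diff graph_polys_mult graph_polys_monom graph_polys_const
            graph_polysD m Suc.prems \<Gamma>)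
      have "coeff ?p i = 0" if "i \<ge> n" for i
      proof (cases "i = n")
        case True
        with dn show ?thesis by (simp add: coeff_monom_mult)
      next
        case False
        with that dn have "i - (n - d) > degree m" by (simp add: d_def)
        then have "coeff m (i - (n - d)) = 0" by (rule coeff_eq_0)
        moreover have "coeff p i = 0" using Suc.prems(1) False that by simp
        ultimately show ?thesis by (simp add: coeff_monom_mult)
      qed
      then have "poly ?q z' = 0"
        using Suc.prems m by (intro Suc.IH[OF _ pq]) auto
      moreover have "coeff m' d \<noteq> 0"
        using partial_emb_nonzero[OF \<Gamma> graph_polysD[OF m(1), of d]] m(2) by (simp add: d_def)
      ultimately show ?thesis
        using m by simp
    qed
  qed
  from this[of "Suc (degree p)"] p show ?thesis
    by (simp add: coeff_eq_0)
qed

text \<open>The new graph consists of the pairs (p(z), q(z')); \<open>graph_polys_root\<close> says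
  that it sends 0 only to 0, hence is single-valued.\<close>

lemma partial_emb_adjoin:
  assumes \<Gamma>: "partial_emb \<Gamma>"
    and m: "(m, m') \<in> graph_polys \<Gamma>" "m \<noteq> 0" "poly m z = 0" "poly m' z' = 0"
    and minimal: "\<And>p q. (p, q) \<in> graph_polys \<Gamma> \<Longrightarrow> p \<noteq> 0 \<Longrightarrow> poly p z = 0 \<Longrightarrow> degree m \<le> degree p"
  obtains \<Gamma>' where "partial_emb \<Gamma>'" "\<Gamma> \<subseteq> \<Gamma>'" "(z, z') \<in> \<Gamma>'"
proof
  let ?\<Gamma> = "(\<lambda>(p, q). (poly p z, poly q z')) ` graph_polys \<Gamma>"
  have I: "(poly p z, poly q z') \<in> ?\<Gamma>" if "(p, q) \<in> graph_polys \<Gamma>" for p q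
    using that by force
  have const: "(x, y) \<in> ?\<Gamma>" if "(x, y) \<in> \<Gamma>" for x y
    using I[OF graph_polys_const[OF \<Gamma> that]] by simp
  then show "\<Gamma> \<subseteq> ?\<Gamma>" by auto
  show "(z, z') \<in> ?\<Gamma>"
    using I[OF graph_polys_monom[OF \<Gamma> partial_embD(1)[OF \<Gamma>, of 1], of 1]] by (simp add: poly_monom)
  show "partial_emb ?\<Gamma>"
    unfolding partial_emb_def
  proof (intro conjI allI impI)
    fix x y x' y' assume "(x, y) \<in> ?\<Gamma>" "(x', y') \<in> ?\<Gamma>"
    then obtain p q p' q' where *: "(p, q) \<in> graph_polys \<Gamma>" "x = poly p z" "y = poly q z'"
      "(p', q') \<in> graph_polys \<Gamma>" "x' = poly p' z" "y' = poly q' z'"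
      by auto
    show "(x + x', y + y') \<in> ?\<Gamma>"
      using I[OF graph_polys_add[OF \<Gamma> *(1,4)]] by (simp add: *)
    show "(x * x', y * y') \<in> ?\<Gamma>"
      using I[OF graph_polys_mult[OF \<Gamma> *(1,4)]] by (simp add: *)
  next
    fix y assume "(0, y) \<in> ?\<Gamma>"
    then obtain p q where "(p, q) \<in> graph_polys \<Gamma>" "poly p z = 0" "y = poly q z'"
      by force
    with graph_polys_root[OF \<Gamma> m] minimal show "y = 0" by blast
  next
    fix c show "(to_ac c, to_ac c) \<in> ?\<Gamma>"
      by (intro const partial_embD(1) \<Gamma>)
  qed
qed

text \<open>A minimal relation for \<open>z\<close> exists since \<open>z\<close> is algebraic over
  the base; its transport keeps a nonzero coefficient in that degree, so it is not constant and has
  a root \<open>z'\<close>.\<close>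

lemma partial_emb_adjoin_any:
  assumes \<Gamma>: "partial_emb \<Gamma>"
  obtains \<Gamma>' z' where "partial_emb \<Gamma>'" "\<Gamma> \<subseteq> \<Gamma>'" "(z, z') \<in> \<Gamma>'"
proof -
  define P where "P = (\<lambda>(p, q). (p, q) \<in> graph_polys \<Gamma> \<and> p \<noteq> 0 \<and> poly p z = 0)"
  obtain p where p: "p \<noteq> 0" "poly (map_poly to_ac p) z = 0"
    using alg_closure_algebraic .
  have "P (map_poly to_ac p, map_poly to_ac p)"
    using p by (auto simp: P_def graph_polys_def coeff_map_poly partial_embD(1)[OF \<Gamma>] map_poly_eq_0_iff)
  then obtain m m' where m: "P (m, m')" "\<And>p q. P (p, q) \<Longrightarrow> degree m \<le> degree p"
    using ex_has_least_nat[of P _ "\<lambda>(p, q). degree p"] by fastforce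
  then have "degree m \<noteq> 0"
    using poly_root_degree_nonzero[of m z] by (simp add: P_def)
  moreover have "(coeff m (degree m), coeff m' (degree m)) \<in> \<Gamma>"
    using m(1) by (auto simp: P_def graph_polys_def)
  then have "coeff m' (degree m) \<noteq> 0"
    using partial_emb_nonzero[OF \<Gamma>] m(1) by (auto simp: P_def)
  then have "degree m \<le> degree m'" by (rule le_degree)
  ultimately have "degree m' > 0" by simp
  then obtain z' where "poly m' z' = 0"
    using alg_closed_imp_poly_has_root by blast
  then show ?thesis
  proof (rule partial_emb_adjoin[OF \<Gamma>, of m m' z z', rotated 3])
    show "degree m \<le> degree p" if "(p, q) \<in> graph_polys \<Gamma>" "p \<noteq> 0" "poly p z = 0" for p q
      using m(2)[of p q] that by (simp add: P_def)
  qed (use m(1) in \<open>simp_all add: P_def that\<close>)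
qed

section \<open>Automorphisms of the algebraic closure by Zorn's lemma\<close>

lemma partial_emb_Union:
  assumes "C \<noteq> {}" "\<And>\<Gamma>. \<Gamma> \<in> C \<Longrightarrow> partial_emb \<Gamma>"
    and chain: "\<And>\<Gamma> \<Gamma>'. \<Gamma> \<in> C \<Longrightarrow> \<Gamma>' \<in> C \<Longrightarrow> \<Gamma> \<subseteq> \<Gamma>' \<or> \<Gamma>' \<subseteq> \<Gamma>"
  shows "partial_emb (\<Union>C)"
  unfolding partial_emb_def
proof (intro conjI allI impI)
  fix x y x' y' assume "(x, y) \<in> \<Union>C" "(x', y') \<in> \<Union>C"
  then obtain \<Gamma> where \<Gamma>: "\<Gamma> \<in> C" "(x, y) \<in> \<Gamma>" "(x', y') \<in> \<Gamma>"
    using chain by blast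
  with partial_embD(2,3)[OF assms(2)]
  show "(x + x', y + y') \<in> \<Union>C" "(x * x', y * y') \<in> \<Union>C"
    by blast+
next
  fix c show "(to_ac c, to_ac c) \<in> \<Union>C"
    using assms(1) partial_embD(1)[OF assms(2)] by blast
next
  fix y assume "(0, y) \<in> \<Union>C"
  with partial_embD(4)[OF assms(2)] show "y = 0" by blast
qed

text \<open>Each y is a root of a polynomial over the base, whose finite root set is mapped
  injectively into itself, hence onto itself.\<close>

lemma embedding_bij:
  fixes \<sigma> :: "'f::field alg_closure \<Rightarrow> 'f alg_closure"
  assumes add: "\<And>x y. \<sigma> (x + y) = \<sigma> x + \<sigma> y" and mult: "\<And>x y. \<sigma> (x * y) = \<sigma> x * \<sigma> y"
    and fix_base: "\<And>c. \<sigma> (to_ac c) = to_ac c" and inj: "inj \<sigma>"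
  shows "bij \<sigma>"
proof -
  have poly: "\<sigma> (poly (map_poly to_ac p) x) = poly (map_poly to_ac p) (\<sigma> x)" for p x
    by (induction p) (simp_all add: map_poly_pCons add mult fix_base fix_base[of 0, simplified])
  have "y \<in> range \<sigma>" for y
  proof -
    obtain p where p: "p \<noteq> 0" "poly (map_poly to_ac p) y = 0"
      using alg_closure_algebraic .
    let ?R = "{x. poly (map_poly to_ac p) x = 0}"
    have "finite ?R"
      using p by (intro poly_roots_finite) (simp add: map_poly_eq_0_iff)
    moreover have "\<sigma> ` ?R \<subseteq> ?R"
      using poly[of p] fix_base[of 0] by (auto simp flip: poly)
    moreover have "inj_on \<sigma> ?R" using inj by (rule inj_on_subset) simp
    ultimately have "\<sigma> ` ?R = ?R" by (intro endo_inj_surj)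
    with p show ?thesis by blast
  qed
  with inj show ?thesis by (auto simp: bij_def)
qed

text \<open>A maximal graph has full domain, since otherwise \<open>partial_emb_adjoin_any\<close>
  would enlarge it; \<open>embedding_bij\<close> makes the resulting function an
  automorphism.\<close>

lemma partial_emb_extend:
  assumes \<Gamma>: "partial_emb \<Gamma>"
  shows "\<exists>\<sigma>\<in>carrier abs_gal. \<forall>x y. (x, y) \<in> \<Gamma> \<longrightarrow> \<sigma> x = y"
proof -
  define A where "A = {T. partial_emb T \<and> \<Gamma> \<subseteq> T}"
  have "\<exists>M\<in>A. \<forall>T\<in>A. M \<subseteq> T \<longrightarrow> T = M"
  proof (rule subset_Zorn_nonempty)
    fix C assume C: "C \<noteq> {}" "subset.chain A C"
    then have "partial_emb (\<Union>C)"
      by (intro partial_emb_Union) (auto simp: A_def subset_chain_def)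
    moreover have "\<Gamma> \<subseteq> \<Union>C"
      using C unfolding A_def subset_chain_def by blast
    ultimately show "\<Union>C \<in> A" unfolding A_def by blast
  next
    show "A \<noteq> {}" using \<Gamma> unfolding A_def by blast
  qed
  then obtain M where "M \<in> A" and maximal: "\<forall>T\<in>A. M \<subseteq> T \<longrightarrow> T = M" ..
  then have M: "partial_emb M" "\<Gamma> \<subseteq> M"
    by (simp_all add: A_def)
  have max: "T = M" if "partial_emb T" "M \<subseteq> T" for T
    using maximal that order.trans[OF M(2) that(2)] by (simp add: A_def)
  have "\<exists>y. (x, y) \<in> M" for x
  proof -
    obtain M' y where "partial_emb M'" "M \<subseteq> M'" "(x, y) \<in> M'"
      using partial_emb_adjoin_any[OF M(1)] .
    with max[of M'] show ?thesis by auto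
  qed
  then obtain \<sigma> where \<sigma>: "\<And>x. (x, \<sigma> x) \<in> M" by metis
  have eq: "\<sigma> x = y" if "(x, y) \<in> M" for x y
    using partial_emb_unique[OF M(1) \<sigma> that] .
  have hom: "\<sigma> (x + y) = \<sigma> x + \<sigma> y" "\<sigma> (x * y) = \<sigma> x * \<sigma> y" "\<sigma> (to_ac c) = to_ac c" for x y c
    by (rule eq, rule partial_embD(1-3)[OF M(1)], ((rule \<sigma>)+)?)+
  have "inj \<sigma>"
  proof (rule injI)
    fix x y assume "\<sigma> x = \<sigma> y"
    then have "(x - y, 0) \<in> M"
      using partial_emb_diff[OF M(1) \<sigma> \<sigma>, of x y] by simp
    then show "x = y"
      using partial_emb_nonzero[OF M(1)] by fastforce
  qed
  with embedding_bij[OF hom] hom have "\<sigma> \<in> carrier abs_gal"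
    by (simp add: abs_gal_def)
  moreover have "\<sigma> x = y" if "(x, y) \<in> \<Gamma>" for x y
    using eq[OF subsetD[OF M(2) that]] .
  ultimately show ?thesis by blast
qed

text \<open>Outside the base field, the minimal polynomial of \<open>y\<close> has a second root y'
  by separability; the embedding that sends y to y' extends to an automorphism moving
  \<open>y\<close>.\<close>

lemma abs_gal_fixed:
  fixes y :: "'f::field alg_closure"
  assumes char0: "\<And>n. n > 0 \<Longrightarrow> of_nat n \<noteq> (0::'f)"
    and fixed: "\<And>\<sigma>. \<sigma> \<in> carrier abs_gal \<Longrightarrow> \<sigma> y = y"
  shows "y \<in> range to_ac"
proof (rule ccontr)
  assume y: "y \<notin> range to_ac"
  define P where "P = (\<lambda>p :: 'f poly. p \<noteq> 0 \<and> poly (map_poly to_ac p) y = 0)"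
  obtain p where "P p"
    unfolding P_def using alg_closure_algebraic by blast
  then obtain p where p: "P p" and min: "\<And>q. P q \<Longrightarrow> degree p \<le> degree q"
    using ex_has_least_nat[of P _ degree] by blast
  define m where "m = map_poly to_ac p"
  have m: "m \<noteq> 0" "poly m y = 0" and deg: "degree m = degree p"
    using p by (auto simp: P_def m_def map_poly_eq_0_iff degree_map_poly)
  then have "[:- y, 1:] dvd m" by (simp add: poly_eq_0_iff_dvd)
  then obtain m1 where m1: "m = [:- y, 1:] * m1" by (rule dvdE)
  have deg0: "degree p \<noteq> 0"
    using poly_root_degree_nonzero[OF m] deg by simp
  \<comment> \<open>\<open>y\<close> is a simple root: otherwise the derivative would be a nonzero
    polynomial of smaller degree with root \<open>y\<close>.\<close>
  have "poly m1 y \<noteq> 0"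
  proof
    assume "poly m1 y = 0"
    then have "poly (pderiv m) y = 0"
      by (simp only: m1 pderiv_mult poly_add poly_mult) (simp add: pderiv_pCons)
    moreover have "pderiv m = map_poly to_ac (pderiv p)"
      by (intro poly_eqI) (simp add: m_def coeff_map_poly coeff_pderiv del: of_nat_Suc)
    moreover have "coeff (pderiv p) (degree p - 1) \<noteq> 0"
      using deg0 char0[of "degree p"] p by (simp add: P_def coeff_pderiv del: of_nat_Suc)
    then have "pderiv p \<noteq> 0" by auto
    ultimately have "degree p \<le> degree (pderiv p)"
      by (intro min) (simp add: P_def)
    moreover have "degree (pderiv p) \<le> degree p - 1"
      by (intro degree_le) (simp add: coeff_pderiv coeff_eq_0 del: of_nat_Suc)
    ultimately show False using deg0 by linarith
  qed
  \<comment> \<open>A linear minimal polynomial would already put \<open>y\<close> in the base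
    field.\<close>
  have "degree m1 > 0"
  proof (rule ccontr)
    assume "\<not> degree m1 > 0"
    then have "degree m1 = 0" by simp
    then obtain c where "m1 = [:c:]" by (rule degree_eq_zeroE)
    with m1 have "coeff m 0 = - y * c" "coeff m 1 = c" "c \<noteq> 0"
      using m(1) by auto
    then have "y = to_ac (- coeff p 0 / coeff p 1)"
      by (simp add: m_def coeff_map_poly field_simps)
    with y show False by blast
  qed
  then obtain y' where y': "poly m1 y' = 0"
    using alg_closed_imp_poly_has_root by blast
  let ?\<Gamma> = "range (\<lambda>c :: 'f. (to_ac c, to_ac c))"
  have \<Gamma>: "partial_emb ?\<Gamma>"
    unfolding partial_emb_def
    by (auto simp: image_iff simp flip: to_ac_add to_ac_mult)
  have mm: "(m, m) \<in> graph_polys ?\<Gamma>"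
    by (auto simp: graph_polys_def m_def coeff_map_poly)
  have my': "poly m y' = 0" by (simp add: m1 y')
  have minimal: "degree m \<le> degree q" if q: "(q, r) \<in> graph_polys ?\<Gamma>" "q \<noteq> 0" "poly q y = 0" for q r
  proof -
    have "coeff q i \<in> range to_ac" for i
      using graph_polysD[OF q(1), of i] by auto
    then have eq: "q = map_poly to_ac (map_poly of_ac q)"
      by (intro poly_eqI) (simp add: coeff_map_poly to_ac_of_ac)
    with q have "P (map_poly of_ac q)"
      by (metis P_def map_poly_0)
    then have "degree p \<le> degree (map_poly of_ac q)" by (rule min)
    also have "\<dots> = degree q"
      by (subst eq) (simp add: degree_map_poly)
    finally show ?thesis by (simp add: deg)
  qed
  obtain \<Gamma>' where \<Gamma>': "partial_emb \<Gamma>'" "(y, y') \<in> \<Gamma>'"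
    by (rule partial_emb_adjoin[OF \<Gamma> mm m my'], rule minimal)
  obtain \<sigma> where \<sigma>: "\<sigma> \<in> carrier abs_gal" "\<forall>x y. (x, y) \<in> \<Gamma>' \<longrightarrow> \<sigma> x = y"
    using partial_emb_extend[OF \<Gamma>'(1)] ..
  from \<sigma>(2) \<Gamma>'(2) fixed[OF \<sigma>(1)] have "y = y'" by simp
  with \<open>poly m1 y \<noteq> 0\<close> y' show False by simp
qed


section \<open>Cochains and the Kummer map\<close>

lemma galD:
  assumes "\<sigma> \<in> carrier abs_gal"
  shows "bij \<sigma>" "\<sigma> (x + y) = \<sigma> x + \<sigma> y" "\<sigma> (x * y) = \<sigma> x * \<sigma> y" "\<sigma> (to_ac c) = to_ac c"
  using assms by (simp_all add: abs_gal_def)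

lemma gal_hom:
  assumes "\<sigma> \<in> carrier abs_gal"
  shows "\<sigma> 0 = 0" "\<sigma> 1 = 1" "\<sigma> (x ^ n) = \<sigma> x ^ n" "\<sigma> x = 0 \<longleftrightarrow> x = 0" "\<sigma> x = \<sigma> y \<longleftrightarrow> x = y"
    "\<sigma> (sum f I) = (\<Sum>i\<in>I. \<sigma> (f i))" "\<sigma> (prod f I) = (\<Prod>i\<in>I. \<sigma> (f i))"
proof -
  note hom = galD(2-4)[OF assms]
  show z: "\<sigma> 0 = 0" and o: "\<sigma> 1 = 1"
    using hom(3)[of 0] hom(3)[of 1] by simp_all
  show "\<sigma> (x ^ n) = \<sigma> x ^ n"
    by (induction n) (simp_all add: o hom)
  show inj: "\<sigma> x = \<sigma> y \<longleftrightarrow> x = y" for x y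
    using galD(1)[OF assms] by (simp add: bij_def inj_eq)
  show "\<sigma> x = 0 \<longleftrightarrow> x = 0"
    using inj[of x 0] z by simp
  show "\<sigma> (sum f I) = (\<Sum>i\<in>I. \<sigma> (f i))" "\<sigma> (prod f I) = (\<Prod>i\<in>I. \<sigma> (f i))"
    by (induction I rule: infinite_finite_induct) (simp_all add: z o hom)
qed

lemma gal_id: "id \<in> carrier abs_gal"
  and gal_comp: "\<sigma> \<in> carrier abs_gal \<Longrightarrow> \<tau> \<in> carrier abs_gal \<Longrightarrow> \<sigma> \<circ> \<tau> \<in> carrier abs_gal"
  by (auto simp: abs_gal_def intro: bij_comp)

lemma gal_inv:
  assumes "\<sigma> \<in> carrier abs_gal"
  shows "inv_into UNIV \<sigma> \<in> carrier abs_gal" "inv_into UNIV \<sigma> (\<sigma> x) = x" "\<sigma> (inv_into UNIV \<sigma> x) = x"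
proof -
  let ?i = "inv_into UNIV \<sigma>"
  note bij = galD(1)[OF assms]
  show l: "?i (\<sigma> x) = x" for x
    using bij by (simp add: bij_def)
  show r: "\<sigma> (?i x) = x" for x
    using bij by (simp add: bij_def surj_f_inv_f)
  have "?i (x + y) = ?i x + ?i y" "?i (x * y) = ?i x * ?i y" "?i (to_ac c) = to_ac c" for x y c
    using l[of "?i x + ?i y"] l[of "?i x * ?i y"] l[of "to_ac c"] by (simp_all add: galD[OF assms] r)
  then show "?i \<in> carrier abs_gal"
    using bij by (simp add: abs_gal_def bij_imp_bij_inv)
qed

section \<open>Continuity of cochains for the Krull topology\<close>

lemma topspace_krull: "topspace krull_topology = carrier abs_gal"
  by (simp add: krull_topology_def)

text \<open>Continuity into a discrete space is local constancy, and basic neighbourhoods for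
  pointwise convergence prescribe the values at finitely many elements.\<close>

lemma continuous_map_krull_iff:
  "continuous_map krull_topology (discrete_topology UNIV) u \<longleftrightarrow>
   (\<forall>\<sigma>\<in>carrier abs_gal. \<exists>S. finite S \<and>
      (\<forall>\<tau>\<in>carrier abs_gal. (\<forall>s\<in>S. \<tau> s = \<sigma> s) \<longrightarrow> u \<tau> = u \<sigma>))"
  (is "?L \<longleftrightarrow> ?R")
proof
  assume L: ?L
  show ?R
  proof
    fix \<sigma> :: "'a gal" assume \<sigma>: "\<sigma> \<in> carrier abs_gal"
    have "openin krull_topology {\<tau> \<in> carrier abs_gal. u \<tau> \<in> {u \<sigma>}}"
      using openin_continuous_map_preimage[OF L, of "{u \<sigma>}"] by (simp add: topspace_krull)
    then obtain W where W: "openin (product_topology (\<lambda>_. discrete_topology UNIV) UNIV) W"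
      "{\<tau> \<in> carrier abs_gal. u \<tau> \<in> {u \<sigma>}} = W \<inter> carrier abs_gal"
      unfolding krull_topology_def openin_subtopology by blast
    with \<sigma> have "\<sigma> \<in> W" by blast
    with W(1) obtain U where U: "finite {i. U i \<noteq> UNIV}" "\<sigma> \<in> Pi\<^sub>E UNIV U" "Pi\<^sub>E UNIV U \<subseteq> W"
      unfolding openin_product_topology_alt by auto
    have "u \<tau> = u \<sigma>" if "\<tau> \<in> carrier abs_gal" "\<forall>s\<in>{i. U i \<noteq> UNIV}. \<tau> s = \<sigma> s" for \<tau>
    proof -
      have "\<tau> i \<in> U i" for i
        using that(2) U(2) by (cases "U i = UNIV") (auto simp: PiE_iff)
      then have "\<tau> \<in> W" using U(3) by (auto simp: PiE_iff)
      with W(2) that(1) show ?thesis by blast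
    qed
    with U(1) show "\<exists>S. finite S \<and>
      (\<forall>\<tau>\<in>carrier abs_gal. (\<forall>s\<in>S. \<tau> s = \<sigma> s) \<longrightarrow> u \<tau> = u \<sigma>)"
      by blast
  qed
next
  assume R: ?R
  have "openin krull_topology {\<sigma> \<in> carrier abs_gal. u \<sigma> \<in> U}" for U
  proof (subst openin_subopen, intro ballI)
    fix \<sigma> assume \<sigma>: "\<sigma> \<in> {\<sigma> \<in> carrier abs_gal. u \<sigma> \<in> U}"
    with R obtain S where S: "finite S"
      "\<forall>\<tau>\<in>carrier abs_gal. (\<forall>s\<in>S. \<tau> s = \<sigma> s) \<longrightarrow> u \<tau> = u \<sigma>"
      by blast
    let ?V = "\<lambda>s. if s \<in> S then {\<sigma> s} else UNIV"
    have "{s. ?V s \<noteq> UNIV} \<subseteq> S" by auto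
    then have "finite {s. ?V s \<noteq> UNIV}" using S(1) by (rule finite_subset)
    then have "openin (product_topology (\<lambda>_. discrete_topology UNIV) UNIV) (Pi\<^sub>E UNIV ?V)"
      by (intro product_topology_basis) simp_all
    then have "openin krull_topology (Pi\<^sub>E UNIV ?V \<inter> carrier abs_gal)"
      unfolding krull_topology_def openin_subtopology by blast
    moreover have "\<sigma> \<in> Pi\<^sub>E UNIV ?V \<inter> carrier abs_gal"
      using \<sigma> by (simp add: PiE_iff)
    moreover have "Pi\<^sub>E UNIV ?V \<inter> carrier abs_gal \<subseteq> {\<sigma> \<in> carrier abs_gal. u \<sigma> \<in> U}"
    proof
      fix \<tau> assume \<tau>: "\<tau> \<in> Pi\<^sub>E UNIV ?V \<inter> carrier abs_gal"
      have "\<tau> s = \<sigma> s" if "s \<in> S" for s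
        using \<tau> that PiE_mem[of \<tau> UNIV ?V s] by simp
      moreover have "\<tau> \<in> carrier abs_gal" using \<tau> by blast
      ultimately have "u \<tau> = u \<sigma>" "\<tau> \<in> carrier abs_gal" using S(2) by blast+
      then show "\<tau> \<in> {\<sigma> \<in> carrier abs_gal. u \<sigma> \<in> U}" using \<sigma> by simp
    qed
    ultimately show "\<exists>T. openin krull_topology T \<and> \<sigma> \<in> T \<and>
        T \<subseteq> {\<sigma> \<in> carrier abs_gal. u \<sigma> \<in> U}"
      by blast
  qed
  then show ?L
    by (simp add: continuous_map_def topspace_krull)
qed

lemma cochains1I:
  assumes "u \<in> extensional (carrier abs_gal)" "finite S"
    and "\<And>\<sigma> \<tau>. \<sigma> \<in> carrier abs_gal \<Longrightarrow> \<tau> \<in> carrier abs_gal \<Longrightarrow> (\<And>s. s \<in> S \<Longrightarrow> \<tau> s = \<sigma> s) \<Longrightarrow> u \<tau> = u \<sigma>"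
  shows "u \<in> cochains1"
  using assms unfolding cochains1_def continuous_map_krull_iff by blast

lemma cochains1D:
  assumes "u \<in> cochains1" "\<sigma> \<in> carrier abs_gal"
  shows "\<exists>S. finite S \<and> (\<forall>\<tau>\<in>carrier abs_gal. (\<forall>s\<in>S. \<tau> s = \<sigma> s) \<longrightarrow> u \<tau> = u \<sigma>)"
  using assms unfolding cochains1_def continuous_map_krull_iff by blast

lemma cochains1_finite_at_id:
  assumes "u \<in> cochains1"
  obtains S where "finite S"
    "\<And>\<tau>. \<tau> \<in> carrier abs_gal \<Longrightarrow> (\<And>s. s \<in> S \<Longrightarrow> \<tau> s = s) \<Longrightarrow> u \<tau> = u id"
proof -
  obtain S where "finite S" "\<forall>\<tau>\<in>carrier abs_gal. (\<forall>s\<in>S. \<tau> s = id s) \<longrightarrow> u \<tau> = u id"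
    using cochains1D[OF assms gal_id] by blast
  with that show ?thesis by simp
qed

lemma cochains1_lift:
  assumes "u \<in> cochains1" "v \<in> cochains1"
  shows "(\<lambda>\<sigma>\<in>carrier abs_gal. F (u \<sigma>) (v \<sigma>)) \<in> cochains1"
  unfolding cochains1_def mem_Collect_eq continuous_map_krull_iff
proof (intro conjI restrict_extensional ballI)
  fix \<sigma> :: "'a gal" assume \<sigma>: "\<sigma> \<in> carrier abs_gal"
  obtain S where S: "finite S" "\<forall>\<tau>\<in>carrier abs_gal. (\<forall>s\<in>S. \<tau> s = \<sigma> s) \<longrightarrow> u \<tau> = u \<sigma>"
    using cochains1D[OF assms(1) \<sigma>] by blast
  obtain T where T: "finite T" "\<forall>\<tau>\<in>carrier abs_gal. (\<forall>s\<in>T. \<tau> s = \<sigma> s) \<longrightarrow> v \<tau> = v \<sigma>"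
    using cochains1D[OF assms(2) \<sigma>] by blast
  show "\<exists>S. finite S \<and> (\<forall>\<tau>\<in>carrier abs_gal. (\<forall>s\<in>S. \<tau> s = \<sigma> s) \<longrightarrow>
      (\<lambda>\<sigma>\<in>carrier abs_gal. F (u \<sigma>) (v \<sigma>)) \<tau> = (\<lambda>\<sigma>\<in>carrier abs_gal. F (u \<sigma>) (v \<sigma>)) \<sigma>)"
  proof (intro exI[of _ "S \<union> T"] conjI ballI impI)
    fix \<tau> assume \<tau>: "\<tau> \<in> carrier abs_gal" "\<forall>s\<in>S \<union> T. \<tau> s = \<sigma> s"
    with S(2) T(2) have "u \<tau> = u \<sigma>" "v \<tau> = v \<sigma>" by blast+
    with \<sigma> \<tau>(1) show "(\<lambda>\<sigma>\<in>carrier abs_gal. F (u \<sigma>) (v \<sigma>)) \<tau> =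
        (\<lambda>\<sigma>\<in>carrier abs_gal. F (u \<sigma>) (v \<sigma>)) \<sigma>"
      by simp
  qed (use S T in simp)
qed

lemma zero_cochains1: "(\<lambda>\<sigma>\<in>carrier abs_gal. 0) \<in> cochains1"
  by (rule cochains1I[of _ "{}"]) simp_all

section \<open>Coboundaries and triviality of cup products\<close>

lemma d1_combine:
  assumes "\<And>x y x' y'. F (x + y) (x' + y') = F x x' + F y y'"
    and "\<And>x y x' y'. F (x - y) (x' - y') = F x x' - F y y'"
  shows "d1 (\<lambda>\<sigma>\<in>carrier abs_gal. F (u \<sigma>) (v \<sigma>)) =
    (\<lambda>x\<in>carrier abs_gal \<times> carrier abs_gal. F (d1 u x) (d1 v x))"
  by (rule ext) (auto simp: d1_def gal_comp assms restrict_def split: prod.splits)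

text \<open>The subgroup properties of \<open>B2\<close> behind this come from
  \<open>zero_cochains1\<close> and from \<open>d1_combine\<close> for sums and differences.\<close>

lemma B2_coset_eq_iff:
  assumes e: "e \<in> extensional (carrier abs_gal \<times> carrier abs_gal)"
  shows "B2 #>\<^bsub>Z2\<^esub> e = B2 \<longleftrightarrow> e \<in> B2"
proof -
  have coset: "B2 #>\<^bsub>Z2\<^esub> e = (\<lambda>c. \<lambda>x\<in>carrier abs_gal \<times> carrier abs_gal. c x + e x) ` B2"
    by (auto simp: r_coset_def Z2_def)
  have zero: "d1 (\<lambda>\<sigma>\<in>carrier abs_gal. 0) = (\<lambda>x\<in>carrier abs_gal \<times> carrier abs_gal. 0)"
    by (rule ext) (auto simp: d1_def gal_comp)
  show ?thesis
  proof
    assume "B2 #>\<^bsub>Z2\<^esub> e = B2"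
    moreover have "(\<lambda>x\<in>carrier abs_gal \<times> carrier abs_gal. 0) \<in> B2"
      unfolding B2_def zero[symmetric] by (intro imageI zero_cochains1)
    then have "(\<lambda>x\<in>carrier abs_gal \<times> carrier abs_gal.
        (\<lambda>x\<in>carrier abs_gal \<times> carrier abs_gal. 0) x + e x) \<in> B2 #>\<^bsub>Z2\<^esub> e"
      unfolding coset by (rule imageI)
    moreover have "(\<lambda>x\<in>carrier abs_gal \<times> carrier abs_gal.
        (\<lambda>x\<in>carrier abs_gal \<times> carrier abs_gal. 0) x + e x) = e"
      using e by (intro extensionalityI[OF restrict_extensional e]) simp
    ultimately show "e \<in> B2" by simp
  next
    assume "e \<in> B2"
    then obtain u where u: "u \<in> cochains1" "e = d1 u" by (auto simp: B2_def)
    have ext: "d1 w \<in> extensional (carrier abs_gal \<times> carrier abs_gal)" for w :: "'a gal \<Rightarrow> 3"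
      by (simp add: d1_def)
    show "B2 #>\<^bsub>Z2\<^esub> e = B2"
    proof
      show "B2 #>\<^bsub>Z2\<^esub> e \<subseteq> B2"
        unfolding coset
      proof (safe)
        fix c assume "c \<in> (B2 :: ('a gal \<times> 'a gal \<Rightarrow> 3) set)"
        then obtain w where w: "w \<in> cochains1" "c = d1 w" by (auto simp: B2_def)
        have "(\<lambda>x\<in>carrier abs_gal \<times> carrier abs_gal. c x + e x) =
            d1 (\<lambda>\<sigma>\<in>carrier abs_gal. w \<sigma> + u \<sigma>)"
          unfolding w u by (rule d1_combine[symmetric]) (simp_all add: algebra_simps)
        then show "(\<lambda>x\<in>carrier abs_gal \<times> carrier abs_gal. c x + e x) \<in> B2"
          unfolding B2_def using cochains1_lift[OF w(1) u(1)] by simp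
      qed
      show "B2 \<subseteq> B2 #>\<^bsub>Z2\<^esub> e"
      proof
        fix c assume "c \<in> (B2 :: ('a gal \<times> 'a gal \<Rightarrow> 3) set)"
        then obtain w where w: "w \<in> cochains1" "c = d1 w" by (auto simp: B2_def)
        let ?c' = "d1 (\<lambda>\<sigma>\<in>carrier abs_gal. w \<sigma> - u \<sigma>)"
        have "?c' = (\<lambda>x\<in>carrier abs_gal \<times> carrier abs_gal. d1 w x - d1 u x)"
          by (rule d1_combine) (simp_all add: algebra_simps)
        then have eq: "(\<lambda>x\<in>carrier abs_gal \<times> carrier abs_gal. ?c' x + e x) = c"
          unfolding w u by (intro extensionalityI[OF restrict_extensional ext]) simp
        have "?c' \<in> B2"
          unfolding B2_def by (intro imageI cochains1_lift w u)
        then have "(\<lambda>x\<in>carrier abs_gal \<times> carrier abs_gal. ?c' x + e x) \<in> B2 #>\<^bsub>Z2\<^esub> e"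
          unfolding coset by (rule imageI)
        then show "c \<in> B2 #>\<^bsub>Z2\<^esub> e" unfolding eq .
      qed
    qed
  qed
qed

lemma cup_singletons_eq_one_iff:
  "cup {u} {v} = \<one>\<^bsub>H2\<^esub> \<longleftrightarrow> cup_cochain u v \<in> B2"
proof -
  have "cup_cochain u v \<in> extensional (carrier abs_gal \<times> carrier abs_gal)"
    by (simp add: cup_cochain_def)
  then show ?thesis
    by (simp add: cup_def H2_def FactGroup_def B2_coset_eq_iff)
qed

lemma cup_cochain_coboundary_iff:
  "cup_cochain u v \<in> B2 \<longleftrightarrow> (\<exists>w\<in>cochains1. \<forall>\<sigma>\<in>carrier abs_gal. \<forall>\<tau>\<in>carrier abs_gal.
     w \<tau> - w (\<sigma> \<circ> \<tau>) + w \<sigma> = u \<sigma> * v \<tau>)"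
proof -
  have "cup_cochain u v = d1 w \<longleftrightarrow> (\<forall>\<sigma>\<in>carrier abs_gal. \<forall>\<tau>\<in>carrier abs_gal.
     w \<tau> - w (\<sigma> \<circ> \<tau>) + w \<sigma> = u \<sigma> * v \<tau>)" for w
    by (auto simp: cup_cochain_def d1_def fun_eq_iff restrict_def)
  then show ?thesis by (auto simp: B2_def)
qed

section \<open>Cube roots of unity as powers indexed by residues modulo 3\<close>

context
  fixes z :: "'a::field"
  assumes z: "z ^ 3 = 1" "z \<noteq> 1"
begin

lemma cube_root_relation: "1 + z + z ^ 2 = 0"
proof -
  have "(z - 1) * (1 + z + z ^ 2) = z ^ 3 - 1"
    by (simp add: algebra_simps power2_eq_square power3_eq_cube)
  with z show ?thesis by simp
qed

lemma zpow_nonzero: "zpow z i \<noteq> 0"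
  using z by (auto simp: zpow_def)

lemma zpow_eq_1_iff: "zpow z i = 1 \<longleftrightarrow> i = 0"
proof -
  have "z ^ 2 \<noteq> 1"
  proof
    assume "z ^ 2 = 1"
    then have "z ^ 3 = z" by (simp add: power3_eq_cube power2_eq_square)
    with z show False by simp
  qed
  with z(2) show ?thesis by (auto simp: zpow_def)
qed

lemma zpow_eq_iff: "zpow z i = zpow z j \<longleftrightarrow> i = j"
proof
  assume eq: "zpow z i = zpow z j"
  have "zpow z i = zpow z (i - j) * zpow z j"
    using zpow_add[OF z(1), of "i - j" j] by simp
  with eq zpow_nonzero[of j] have "zpow z (i - j) = 1" by simp
  then show "i = j" using zpow_eq_1_iff by simp
qed simp

lemma cube_root_of_one_is_zpow:
  assumes "y ^ 3 = 1"
  shows "\<exists>i. y = zpow z i"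
proof -
  have "z ^ 2 = - 1 - z"
    using cube_root_relation by (simp add: eq_neg_iff_add_eq_0 algebra_simps)
  \<comment> \<open>Factorization of y^3 - 1 over the cube roots of unity, with z^2 written as
    \<open>- 1 - z\<close>; the correction term vanishes by
    \<open>cube_root_relation\<close>.\<close>
  moreover have "(y - 1) * ((y - z) * (y - (- 1 - z))) = y ^ 3 - 1 + (1 - y) * (1 + z + z ^ 2)"
    by (simp add: algebra_simps power2_eq_square power3_eq_cube)
  ultimately have "y = 1 \<or> y = z \<or> y = z ^ 2"
    using assms cube_root_relation by simp
  then have "y = zpow z 0 \<or> y = zpow z 1 \<or> y = zpow z 2"
    by (simp add: zpow_def)
  then show ?thesis by blast
qed

end

lemma to_ac_zpow: "to_ac (zpow z i) = zpow (to_ac z) i"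
  by (simp add: zpow_def)

text \<open>The ratio \<sigma>(c)/c is a cube root of unity, hence a unique power of
  \<open>z\<close>; this replaces the definite description by an equation in the closure.\<close>

lemma kummer_cocycle_eq_iff:
  assumes z: "z ^ 3 = 1" "z \<noteq> 1" and c: "c ^ 3 = to_ac a" "a \<noteq> 0"
    and \<sigma>: "\<sigma> \<in> carrier abs_gal"
  shows "kummer_cocycle z c \<sigma> = i \<longleftrightarrow> \<sigma> c = zpow (to_ac z) i * c"
proof -
  let ?z = "to_ac z"
  have z': "?z ^ 3 = 1" "?z \<noteq> 1"
    using z by (simp_all flip: to_ac_power)
  have c0: "c \<noteq> 0" using c by auto
  have "\<sigma> c ^ 3 = c ^ 3"
    using gal_hom(3)[OF \<sigma>, of c 3] galD(4)[OF \<sigma>] c(1) by simp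
  then have "(\<sigma> c / c) ^ 3 = 1" using c0 by (simp add: power_divide)
  then obtain j where j: "\<sigma> c / c = zpow ?z j"
    using cube_root_of_one_is_zpow[OF z'] by blast
  have "kummer_cocycle z c \<sigma> = j"
    using \<sigma> by (simp add: kummer_cocycle_def j zpow_eq_iff[OF z'])
  moreover have "\<sigma> c = zpow ?z i * c \<longleftrightarrow> j = i"
    using j c0 zpow_eq_iff[OF z', of j i] by (simp add: field_simps)
  ultimately show ?thesis by simp
qed

text \<open>\<open>B1\<close> is zero, and another cube root differs from \<open>c\<close> by a
  power of \<open>z\<close>, which lies in \<open>F\<close> and is fixed by Galois; so the union
  defining the class collapses.\<close>

lemma kummer_singleton:
  assumes z: "z ^ 3 = 1" "z \<noteq> 1" and c: "c ^ 3 = to_ac a" "a \<noteq> 0"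
  shows "kummer z a = {kummer_cocycle z c}"
proof -
  let ?z = "to_ac z"
  have z': "?z ^ 3 = 1" "?z \<noteq> 1"
    using z by (simp_all flip: to_ac_power)
  have c0: "c \<noteq> 0" using c by auto
  have ext: "kummer_cocycle z c' \<in> extensional (carrier abs_gal)" for c'
    by (simp add: kummer_cocycle_def)
  have "B1 #>\<^bsub>Z1\<^esub> kummer_cocycle z c' = {kummer_cocycle z c}" if c': "c' ^ 3 = to_ac a" for c'
  proof -
    have "(c' / c) ^ 3 = 1" using c c' by (simp add: power_divide)
    then obtain j where "c' / c = zpow ?z j"
      using cube_root_of_one_is_zpow[OF z'] by blast
    then have j: "c' = to_ac (zpow z j) * c"
      using c0 by (simp add: field_simps to_ac_zpow)
    have "kummer_cocycle z c' \<sigma> = kummer_cocycle z c \<sigma>" if \<sigma>: "\<sigma> \<in> carrier abs_gal" for \<sigma>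
    proof -
      have "\<sigma> c = zpow ?z (kummer_cocycle z c \<sigma>) * c"
        by (rule iffD1[OF kummer_cocycle_eq_iff[OF z c \<sigma>] refl])
      then have "\<sigma> c' = zpow ?z (kummer_cocycle z c \<sigma>) * c'"
        unfolding j galD(3,4)[OF \<sigma>] by simp
      then show ?thesis
        by (rule iffD2[OF kummer_cocycle_eq_iff[OF z c' c(2) \<sigma>]])
    qed
    then have eq: "kummer_cocycle z c' = kummer_cocycle z c"
      by (intro extensionalityI[OF ext ext])
    have B1: "(B1 :: ('a gal \<Rightarrow> 3) set) = {\<lambda>\<sigma>\<in>carrier abs_gal. 0}"
      by (auto simp: B1_def d0_def)
    have "(\<lambda>\<sigma>\<in>carrier abs_gal. (\<lambda>\<sigma>\<in>carrier abs_gal. 0) \<sigma> + kummer_cocycle z c \<sigma>) = kummer_cocycle z c"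
      by (intro extensionalityI[OF restrict_extensional ext]) simp
    then show ?thesis
      by (simp add: eq B1 r_coset_def Z1_def)
  qed
  with c(1) show ?thesis unfolding kummer_def by auto
qed

lemma cup_kummer_eq_one_iff:
  assumes z: "z ^ 3 = 1" "z \<noteq> 1"
    and "c ^ 3 = to_ac a" "a \<noteq> 0" "d ^ 3 = to_ac b" "b \<noteq> 0"
  shows "cup (kummer z a) (kummer z b) = \<one>\<^bsub>H2\<^esub> \<longleftrightarrow>
    (\<exists>w\<in>cochains1. \<forall>\<sigma>\<in>carrier abs_gal. \<forall>\<tau>\<in>carrier abs_gal.
      w \<tau> - w (\<sigma> \<circ> \<tau>) + w \<sigma> = kummer_cocycle z c \<sigma> * kummer_cocycle z d \<tau>)"
  using assms by (simp add: kummer_singleton cup_singletons_eq_one_iff cup_cochain_coboundary_iff)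


section \<open>Evaluation of polynomials at geometric points\<close>

text \<open>Induction along ring generators, so that identities between ring homomorphisms need
  checking only on constants and variables.\<close>

lemma mpol_ring_induct [case_names const var add mult]:
  fixes f :: "'f::field mpol"
  assumes const: "\<And>c. P (pconst c)" and var: "\<And>v. P (pvar v)"
    and add: "\<And>f g. P f \<Longrightarrow> P g \<Longrightarrow> P (f + g)" and mult: "\<And>f g. P f \<Longrightarrow> P g \<Longrightarrow> P (f * g)"
  shows "P f"
proof (induction f rule: mpol_induct)
  case zero
  show ?case using const[of 0] by simp
next
  case (single m c)
  have one: "P 1" using const[of 1] by simp
  have pow: "P (pvar v ^ n)" for v n
    by (induction n) (simp_all add: one mult var)
  have prod: "P (\<Prod>v\<in>K. pvar v ^ Poly_Mapping.lookup m v)" for K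
    by (induction K rule: infinite_finite_induct) (simp_all add: one mult pow)
  show ?case
    using mult[OF const prod, of c "Poly_Mapping.keys m"] psubst_pvar_id[of "Poly_Mapping.single m c"]
    by (simp add: psubst_single)
next
  case (add f g)
  then show ?case by (rule assms(3))
qed

lemma pconst_eq_iff: "pconst c = pconst d \<longleftrightarrow> c = d"
  by (simp add: pconst_def inj_eq[OF inj_single])

text \<open>Substituting constants and then reading off the constant term lets evaluation inherit
  additivity and multiplicativity from \<open>psubst\<close>.\<close>

definition peval :: "(var \<Rightarrow> 'e) \<Rightarrow> 'e::field mpol \<Rightarrow> 'e" where
  "peval t f = Poly_Mapping.lookup (psubst (\<lambda>v. pconst (t v)) f) 0"

lemma pconst_peval: "pconst (peval t f) = psubst (\<lambda>v. pconst (t v)) f"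
proof -
  have "\<exists>c. psubst (\<lambda>v. pconst (t v)) f = pconst c"
  proof (induction f rule: mpol_ring_induct)
    case (const c)
    show ?case by auto
  next
    case (var v)
    show ?case by auto
  next
    case (add f g)
    then obtain c d where "psubst (\<lambda>v. pconst (t v)) f = pconst c" "psubst (\<lambda>v. pconst (t v)) g = pconst d"
      by blast
    then show ?case by (auto simp: psubst_add simp flip: pconst_add)
  next
    case (mult f g)
    then obtain c d where "psubst (\<lambda>v. pconst (t v)) f = pconst c" "psubst (\<lambda>v. pconst (t v)) g = pconst d"
      by blast
    then show ?case by (auto simp: psubst_mult simp flip: pconst_mult)
  qed
  then obtain c where "psubst (\<lambda>v. pconst (t v)) f = pconst c" by blast
  then show ?thesis by (simp add: peval_def) (simp add: pconst_def)
qed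

lemma peval_simps:
  "peval t (pconst c) = c" "peval t (pvar v) = t v" "peval t (f + g) = peval t f + peval t g"
  "peval t (f * g) = peval t f * peval t g"
  by (simp_all add: pconst_peval psubst_add psubst_mult pconst_add pconst_mult flip: pconst_eq_iff)

lemma peval_hom:
  "peval t 0 = 0" "peval t 1 = 1" "peval t (f - g) = peval t f - peval t g"
  "peval t (prod h I) = (\<Prod>i\<in>I. peval t (h i))"
proof -
  show z: "peval t 0 = 0" "peval t 1 = 1"
    using peval_simps(1)[of t 0] peval_simps(1)[of t 1] by simp_all
  show "peval t (f - g) = peval t f - peval t g"
    using peval_simps(3)[of t "f - g" g] by simp
  show "peval t (prod h I) = (\<Prod>i\<in>I. peval t (h i))"
    by (induction I rule: infinite_finite_induct) (simp_all add: z peval_simps)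
qed

section \<open>Base change of polynomials to the algebraic closure\<close>

definition emb :: "'f::field mpol \<Rightarrow> 'f alg_closure mpol" where
  "emb f = Poly_Mapping.map to_ac f"

lemma lookup_emb: "Poly_Mapping.lookup (emb f) m = to_ac (Poly_Mapping.lookup f m)"
  by (simp add: emb_def map.rep_eq when_def)

lemma emb_single: "emb (Poly_Mapping.single m c) = Poly_Mapping.single m (to_ac c)"
  by (rule poly_mapping_eqI) (simp add: lookup_emb lookup_single when_def)

lemma emb_add: "emb (f + g) = emb f + emb g"
  by (rule poly_mapping_eqI) (simp add: lookup_emb lookup_add)

lemma emb_zero: "emb 0 = 0"
  by (rule poly_mapping_eqI) (simp add: lookup_emb)

lemma emb_mult: "emb (f * g) = emb f * emb g"
proof (induction f rule: mpol_induct)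
  case zero
  show ?case by (simp add: emb_zero)
next
  case (single m c)
  show ?case
    by (induction g rule: mpol_induct)
      (simp_all add: emb_zero emb_add distrib_left mult_single emb_single)
next
  case (add f g)
  then show ?case by (simp add: emb_add distrib_right)
qed

lemma emb_gens: "emb (pconst c) = pconst (to_ac c)" "emb (pvar v) = pvar v"
  by (simp_all add: pconst_def pvar_def emb_single)

definition ev :: "(var \<Rightarrow> 'f alg_closure) \<Rightarrow> 'f::field mpol \<Rightarrow> 'f alg_closure" where
  "ev t f = peval t (emb f)"

lemma ev_simps:
  "ev t (pconst c) = to_ac c" "ev t (pvar v) = t v" "ev t (f + g) = ev t f + ev t g"
  "ev t (f * g) = ev t f * ev t g"
  by (simp_all add: ev_def emb_gens emb_add emb_mult peval_simps)

lemma ev_hom: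
  "ev t 0 = 0" "ev t 1 = 1" "ev t (f - g) = ev t f - ev t g" "ev t (f ^ n) = ev t f ^ n"
  "ev t (sum h I) = (\<Sum>i\<in>I. ev t (h i))"
proof -
  show z: "ev t 0 = 0" "ev t 1 = 1"
    using ev_simps(1)[of t 0] ev_simps(1)[of t 1] by simp_all
  show "ev t (f - g) = ev t f - ev t g"
    using ev_simps(3)[of t "f - g" g] by simp
  show "ev t (f ^ n) = ev t f ^ n"
    by (induction n) (simp_all add: z ev_simps)
  show "ev t (sum h I) = (\<Sum>i\<in>I. ev t (h i))"
    by (induction I rule: infinite_finite_induct) (simp_all add: z ev_simps)
qed

lemma gal_ev:
  assumes "\<sigma> \<in> carrier abs_gal"
  shows "\<sigma> (ev t f) = ev (\<sigma> \<circ> t) f"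
  by (induction f rule: mpol_ring_induct) (simp_all add: ev_simps galD[OF assms])


section \<open>The action of the Heisenberg group on geometric points\<close>

lemma one_in_heis: "mat 1 \<in> carrier heis"
  by (simp add: heis_def mat_def)

lemma finite_heis: "finite (carrier heis)"
  by (rule finite_subset[OF subset_UNIV]) simp

text \<open>The inverse is left multiplication by \<open>g ** g\<close>, since the group has
  exponent 3.\<close>

lemma heis_left_bij:
  assumes g: "g \<in> carrier heis"
  shows "bij_betw (\<lambda>h. g ** h) (carrier heis) (carrier heis)"
proof -
  have "(g ** g) ** (g ** h) = h" for h
    using heis_exponent_3[OF g] by (simp add: matrix_mul_assoc)
  then have inj: "inj_on (\<lambda>h. g ** h) (carrier heis)"
    by (intro inj_on_inverseI[of _ "\<lambda>h. (g ** g) ** h"])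
  moreover have "(\<lambda>h. g ** h) ` carrier heis \<subseteq> carrier heis"
    using heis_mult_closed[OF g] by blast
  ultimately show ?thesis
    unfolding bij_betw_def using endo_inj_surj[OF finite_heis] by blast
qed

lemma sum_heis_left:
  assumes "g \<in> carrier heis"
  shows "(\<Sum>h\<in>carrier heis. F (g ** h)) = (\<Sum>h\<in>carrier heis. F h)"
  by (rule sum.reindex_bij_betw[OF heis_left_bij[OF assms]])

lemma heis_eqI:
  fixes g h :: "3^3^3"
  assumes "g \<in> carrier heis" "h \<in> carrier heis"
    "g$1$2 = h$1$2" "g$2$3 = h$2$3" "g$1$3 = h$1$3"
  shows "g = h"
  using assms
  by (simp add: heis_def vec_eq_iff[of g] vec_eq_iff[of "vec_nth g _"] forall_3)

definition heis_of :: "3 \<Rightarrow> 3 \<Rightarrow> 3 \<Rightarrow> 3^3^3" where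
  "heis_of p q r = (\<chi> i j. if i = j then 1 else if i = 1 \<and> j = 2 then p
     else if i = 2 \<and> j = 3 then q else if i = 1 \<and> j = 3 then r else 0)"

lemma heis_of_entries:
  "heis_of p q r $ 1 $ 2 = p" "heis_of p q r $ 2 $ 3 = q" "heis_of p q r $ 1 $ 3 = r"
  "heis_of p q r \<in> carrier heis"
  by (simp_all add: heis_of_def heis_def)

definition pact :: "'f::field \<Rightarrow> 3^3^3 \<Rightarrow> (var \<Rightarrow> 'f alg_closure) \<Rightarrow> var \<Rightarrow> 'f alg_closure" where
  "pact z g t v = ev t (heis_var z g v)"

lemma pact_simps:
  "pact z g t (Xv i) = zpow (to_ac z) (g$1$3 + g$2$3 * (1 - (i + g$1$2))) * t (Xv (i + g$1$2))"
  "pact z g t Alpha = zpow (to_ac z) (g$1$2) * t Alpha"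
  "pact z g t Beta = zpow (to_ac z) (g$2$3) * t Beta"
  by (simp_all add: pact_def ev_simps to_ac_zpow)

lemma ev_heis_subst: "ev t (heis_subst z g f) = ev (pact z g t) f"
  unfolding heis_subst_def
  by (induction f rule: mpol_ring_induct) (simp_all add: ev_simps psubst_add psubst_mult pact_def)

text \<open>The factors are reversed: substitutions act on functions from the left, hence on points
  from the right.\<close>

lemma pact_mult:
  assumes "z ^ 3 = 1" "g \<in> carrier heis" "h \<in> carrier heis"
  shows "pact z (g ** h) t = pact z h (pact z g t)"
proof
  fix v
  have "ev t (heis_subst z (g ** h) (pvar v)) = ev t (heis_subst z g (heis_subst z h (pvar v)))"
    by (simp only: heis_subst_mult[OF assms])
  then show "pact z (g ** h) t v = pact z h (pact z g t) v"
    by (simp add: ev_heis_subst ev_simps)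
qed

lemma pact_one: "pact z (mat 1) t = t"
proof
  fix v
  have "ev t (heis_subst z (mat 1) (pvar v)) = ev t (pvar v)"
    by (simp only: heis_subst_one)
  then show "pact z (mat 1) t v = t v"
    by (simp add: ev_heis_subst ev_simps)
qed

text \<open>The action is given by polynomials over \<open>F\<close>, the powers of \<open>z\<close>
  included.\<close>

lemma gal_pact:
  assumes "\<sigma> \<in> carrier abs_gal"
  shows "\<sigma> \<circ> pact z g t = pact z g (\<sigma> \<circ> t)"
  by (rule ext) (simp add: pact_def gal_ev[OF assms])

text \<open>
  For \<open>a\<close> and \<open>b\<close> nonzero only central elements fix points of \<open>Y\<close>, and they fix exactly those where
  all \<open>x\<^sub>i\<close> vanish. So these are the geometric points of \<open>Y\<close> off the fixed loci.
\<close>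

definition good_point :: "'f::field \<Rightarrow> 'f \<Rightarrow> (var \<Rightarrow> 'f alg_closure) \<Rightarrow> bool" where
  "good_point a b t \<longleftrightarrow> t Alpha ^ 3 = to_ac a \<and> t Beta ^ 3 = to_ac b \<and> (\<exists>i. t (Xv i) \<noteq> 0)"

text \<open>The nonzero coordinates \<alpha> and \<beta> detect the entries (1,2) and (2,3); once
  these agree, a nonvanishing x_i detects the entry (1,3).\<close>

lemma pact_inj:
  assumes z: "z ^ 3 = 1" "z \<noteq> 1" and t: "good_point a b t" "a \<noteq> 0" "b \<noteq> 0"
    and g: "g \<in> carrier heis" "h \<in> carrier heis" and eq: "pact z g t = pact z h t"
  shows "g = h"
proof -
  let ?z = "to_ac z"
  have z': "?z ^ 3 = 1" "?z \<noteq> 1"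
    using z by (simp_all flip: to_ac_power)
  have nz: "t Alpha \<noteq> 0" "t Beta \<noteq> 0"
    using t by (auto simp: good_point_def)
  have p: "g$1$2 = h$1$2"
    using fun_cong[OF eq, of Alpha] nz by (simp add: pact_simps zpow_eq_iff[OF z'])
  have q: "g$2$3 = h$2$3"
    using fun_cong[OF eq, of Beta] nz by (simp add: pact_simps zpow_eq_iff[OF z'])
  obtain i where i: "t (Xv i) \<noteq> 0" using t by (auto simp: good_point_def)
  \<comment> \<open>The index \<open>i - h$1$2\<close> is chosen so that the shift by the common
    (1,2) entry lands on the nonvanishing coordinate \<open>i\<close>.\<close>
  have "g$1$3 = h$1$3"
    using fun_cong[OF eq, of "Xv (i - h$1$2)"] i by (simp add: pact_simps p q zpow_eq_iff[OF z'])
  with p q g show ?thesis by (intro heis_eqI)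
qed


section \<open>The rings \<open>R\<^sub>F\<close> and \<open>A\<^sub>a\<^sub>,\<^sub>b\<close>\<close>

definition cls :: "'f::field \<Rightarrow> 'f \<Rightarrow> 'f mpol \<Rightarrow> 'f mpol set" where
  "cls a b f = rel_ideal a b +>\<^bsub>P_ring\<^esub> f"

lemma cls_eq_iff: "cls a b f = cls a b g \<longleftrightarrow> f - g \<in> rel_ideal a b"
proof -
  interpret I: ideal "rel_ideal a b" P_ring by (rule rel_ideal_ideal)
  have cls: "cls a b f = (\<lambda>h. h + f) ` rel_ideal a b" for f
    by (auto simp: cls_def a_r_coset_def')
  have add: "x + y \<in> rel_ideal a b" if "x \<in> rel_ideal a b" "y \<in> rel_ideal a b" for x y
    using additive_subgroup.a_closed[OF I.is_additive_subgroup that] by simp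
  have mult: "x * y \<in> rel_ideal a b" if "y \<in> rel_ideal a b" for x y
    using I.I_l_closed[OF that, of x] by simp
  show ?thesis
  proof
    assume eq: "cls a b f = cls a b g"
    have "0 \<in> rel_ideal a b" using additive_subgroup.zero_closed[OF I.is_additive_subgroup] by simp
    then have "0 + f \<in> cls a b f" unfolding cls by (rule imageI)
    then have "f \<in> cls a b g" by (simp add: eq)
    then show "f - g \<in> rel_ideal a b" unfolding cls by auto
  next
    assume d: "f - g \<in> rel_ideal a b"
    have "h + f \<in> (\<lambda>h. h + g) ` rel_ideal a b" if "h \<in> rel_ideal a b" for h
      using add[OF that d] by (intro image_eqI[of _ _ "h + (f - g)"]) simp_all
    moreover have "h + g \<in> (\<lambda>h. h + f) ` rel_ideal a b" if "h \<in> rel_ideal a b" for h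
      using add[OF that mult[OF d, of "-1"]]
      by (intro image_eqI[of _ _ "h + (- 1) * (f - g)"]) simp_all
    ultimately show "cls a b f = cls a b g" unfolding cls by blast
  qed
qed

lemma rel_ideal_gens: "pvar Alpha ^ 3 - pconst a \<in> rel_ideal a b" "pvar Beta ^ 3 - pconst b \<in> rel_ideal a b"
proof -
  have "{pvar Alpha ^ 3 - pconst a, pvar Beta ^ 3 - pconst b} \<subseteq> rel_ideal a b"
    unfolding rel_ideal_def by (rule ring.genideal_self[OF ring_from_type_algebra]) simp
  then show "pvar Alpha ^ 3 - pconst a \<in> rel_ideal a b" "pvar Beta ^ 3 - pconst b \<in> rel_ideal a b"
    by simp_all
qed

lemma type_ring_sel:
  "carrier ring_of_type_algebra = UNIV" "x \<otimes>\<^bsub>ring_of_type_algebra\<^esub> y = x * y"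
  "x \<oplus>\<^bsub>ring_of_type_algebra\<^esub> y = x + y" "\<one>\<^bsub>ring_of_type_algebra\<^esub> = 1"
  "\<zero>\<^bsub>ring_of_type_algebra\<^esub> = 0"
  by (simp_all add: ring_of_type_algebra_def)

lemma ev_rel_ideal:
  assumes "t Alpha ^ 3 = to_ac a" "t Beta ^ 3 = to_ac b" "f \<in> rel_ideal a b"
  shows "ev t f = 0"
proof -
  have "ev t \<in> ring_hom P_ring ring_of_type_algebra"
    by (simp add: ring_hom_def type_ring_sel ev_simps ev_hom)
  then have hom: "ring_hom_ring P_ring ring_of_type_algebra (ev t)"
    by (intro ring_hom_ringI2 ring_from_type_algebra)
  have ker: "a_kernel P_ring ring_of_type_algebra (ev t) = {f. ev t f = 0}"
    unfolding a_kernel_def' type_ring_sel by simp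
  have "{pvar Alpha ^ 3 - pconst a, pvar Beta ^ 3 - pconst b} \<subseteq> {f. ev t f = 0}"
    using assms by (simp add: ev_hom ev_simps)
  then have "rel_ideal a b \<subseteq> {f. ev t f = 0}"
    unfolding rel_ideal_def ker[symmetric]
    by (rule ring.genideal_minimal[OF ring_from_type_algebra ring_hom_ring.kernel_is_ideal[OF hom]])
  with assms(3) show ?thesis by blast
qed

lemma R_F_cring: "cring (R_F a b)"
  unfolding R_F_def by (intro ideal.quotient_is_cring rel_ideal_ideal cring_from_type_algebra)

lemma cls_ring_hom: "cls a b \<in> ring_hom P_ring (R_F a b)"
  using ideal.rcos_ring_hom[OF rel_ideal_ideal[of a b]] by (simp add: R_F_def cls_def[abs_def])

lemma carrier_R_F: "carrier (R_F a b) = range (cls a b)"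
  by (auto simp: R_F_def FactRing_def A_RCOSETS_def' cls_def)

lemma R_F_ops:
  "cls a b f \<otimes>\<^bsub>R_F a b\<^esub> cls a b g = cls a b (f * g)"
  "cls a b f \<oplus>\<^bsub>R_F a b\<^esub> cls a b g = cls a b (f + g)"
  "\<one>\<^bsub>R_F a b\<^esub> = cls a b 1" "\<zero>\<^bsub>R_F a b\<^esub> = cls a b 0"
  "\<ominus>\<^bsub>R_F a b\<^esub> cls a b f = cls a b (- f)"
  "cls a b f \<ominus>\<^bsub>R_F a b\<^esub> cls a b g = cls a b (f - g)"
proof -
  interpret R: cring "R_F a b" by (rule R_F_cring)
  interpret P: ring "P_ring :: 'a mpol ring" by (rule ring_from_type_algebra)
  show "cls a b f \<otimes>\<^bsub>R_F a b\<^esub> cls a b g = cls a b (f * g)" for f g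
    using ring_hom_mult[OF cls_ring_hom, of f g] by simp
  show add: "cls a b f \<oplus>\<^bsub>R_F a b\<^esub> cls a b g = cls a b (f + g)" for f g
    using ring_hom_add[OF cls_ring_hom, of f g] by simp
  show "\<one>\<^bsub>R_F a b\<^esub> = cls a b 1"
    using ring_hom_one[OF cls_ring_hom, of a b] by simp
  show zero: "\<zero>\<^bsub>R_F a b\<^esub> = cls a b 0"
    using ring_hom_zero[OF cls_ring_hom P.ring_axioms R.ring_axioms] by simp
  have carr: "cls a b f \<in> carrier (R_F a b)" for f by (simp add: carrier_R_F)
  show minus: "\<ominus>\<^bsub>R_F a b\<^esub> cls a b f = cls a b (- f)" for f
    by (rule R.minus_equality) (simp_all add: add zero carr)
  show "cls a b f \<ominus>\<^bsub>R_F a b\<^esub> cls a b g = cls a b (f - g)"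
    by (simp add: a_minus_def minus add)
qed

definition invariant :: "'f::field \<Rightarrow> 'f \<Rightarrow> 'f \<Rightarrow> 'f mpol \<Rightarrow> bool" where
  "invariant z a b f \<longleftrightarrow> (\<forall>g\<in>carrier heis. cls a b (heis_subst z g f) = cls a b f)"

lemma act_cls:
  assumes "z ^ 3 = 1" "g \<in> carrier heis"
  shows "act z g (cls a b f) = cls a b (heis_subst z g f)"
  using act_coset[OF assms] by (simp add: cls_def)

lemma carrier_A_ab:
  assumes "z ^ 3 = 1"
  shows "carrier (A_ab z a b) = cls a b ` {f. invariant z a b f}"
  by (auto simp: A_ab_def carrier_R_F invariant_def act_cls[OF assms])

lemma A_ab_ops:
  "mult (A_ab z a b) = mult (R_F a b)" "add (A_ab z a b) = add (R_F a b)"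
  "\<one>\<^bsub>A_ab z a b\<^esub> = \<one>\<^bsub>R_F a b\<^esub>" "\<zero>\<^bsub>A_ab z a b\<^esub> = \<zero>\<^bsub>R_F a b\<^esub>"
  by (simp_all add: A_ab_def)

lemma cls_add_cong:
  "cls a b f = cls a b f' \<Longrightarrow> cls a b g = cls a b g' \<Longrightarrow> cls a b (f + g) = cls a b (f' + g')"
  and cls_mult_cong:
  "cls a b f = cls a b f' \<Longrightarrow> cls a b g = cls a b g' \<Longrightarrow> cls a b (f * g) = cls a b (f' * g')"
  by (simp_all add: R_F_ops(1,2)[symmetric])

lemma invariant_add: "invariant z a b f \<Longrightarrow> invariant z a b g \<Longrightarrow> invariant z a b (f + g)"
  and invariant_mult: "invariant z a b f \<Longrightarrow> invariant z a b g \<Longrightarrow> invariant z a b (f * g)"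
  and invariant_pconst: "invariant z a b (pconst c)"
  unfolding invariant_def heis_subst_def psubst_add psubst_mult psubst_pconst
  by (auto intro!: cls_add_cong cls_mult_cong)

lemma A_ab_cring:
  assumes z: "z ^ 3 = 1"
  shows "cring (A_ab z a b)"
proof -
  interpret R: cring "R_F a b" by (rule R_F_cring)
  let ?H = "cls a b ` {f. invariant z a b f}"
  have sub: "?H \<subseteq> carrier (R_F a b)" by (auto simp: carrier_R_F)
  have "subring ?H (R_F a b)"
  proof (rule R.subringI[OF sub])
    show "\<one>\<^bsub>R_F a b\<^esub> \<in> ?H"
      using invariant_pconst[of z a b 1] by (simp add: R_F_ops)
    fix h1 assume "h1 \<in> ?H"
    then obtain f where f: "h1 = cls a b f" "invariant z a b f" by blast
    have "invariant z a b (pconst (-1) * f)"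
      by (intro invariant_mult invariant_pconst f)
    moreover have "pconst (-1) * f = - f"
      by (simp add: pconst_def single_uminus)
    ultimately show "\<ominus>\<^bsub>R_F a b\<^esub> h1 \<in> ?H"
      by (simp add: f R_F_ops)
    fix h2 assume "h2 \<in> ?H"
    then obtain g where g: "h2 = cls a b g" "invariant z a b g" by blast
    show "h1 \<otimes>\<^bsub>R_F a b\<^esub> h2 \<in> ?H" "h1 \<oplus>\<^bsub>R_F a b\<^esub> h2 \<in> ?H"
      using f g by (simp_all add: R_F_ops invariant_add invariant_mult)
  qed
  then have "subcring ?H (R_F a b)" by (rule R.subcringI')
  then have "cring (R_F a b \<lparr>carrier := ?H\<rparr>)"
    using R.subcring_iff[OF sub] by simp
  moreover have "A_ab z a b = R_F a b \<lparr>carrier := ?H\<rparr>"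
    using carrier_A_ab[OF z, of a b] by (simp add: A_ab_def)
  ultimately show ?thesis by simp
qed


section \<open>From a twisted geometric point to a rational point of \<open>X(a,b)\<close>\<close>

lemma sum_shift_3: "(\<Sum>i\<in>UNIV. F (i + p)) = (\<Sum>i\<in>UNIV. F i)" for p :: 3
  by (rule sum.reindex_bij_betw) (auto intro!: bij_betw_byWitness[of _ "\<lambda>i. i - p"])

lemma prod_shift_3: "(\<Prod>i\<in>UNIV. F (i + p)) = (\<Prod>i\<in>UNIV. F i)" for p :: 3
  by (rule prod.reindex_bij_betw) (auto intro!: bij_betw_byWitness[of _ "\<lambda>i. i - p"])

section \<open>Symmetric functions of the cubes of the x_i\<close>

definition esym1 :: "(3 \<Rightarrow> 'a::comm_ring_1) \<Rightarrow> 'a" where "esym1 y = (\<Sum>j\<in>UNIV. y j)"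
text \<open>With three indices the cyclic neighbours are all the pairs, so this is the second
  elementary symmetric function, in a form adapted to index shifts.\<close>

definition esym2 :: "(3 \<Rightarrow> 'a::comm_ring_1) \<Rightarrow> 'a" where "esym2 y = (\<Sum>j\<in>UNIV. y j * y (j + 1))"
definition esym3 :: "(3 \<Rightarrow> 'a::comm_ring_1) \<Rightarrow> 'a" where "esym3 y = (\<Prod>j\<in>UNIV. y j)"

lemma esym_shift:
  "esym1 (\<lambda>i. y (i + p)) = esym1 y" "esym2 (\<lambda>i. y (i + p)) = esym2 y" "esym3 (\<lambda>i. y (i + p)) = esym3 y"
proof -
  show "esym1 (\<lambda>i. y (i + p)) = esym1 y" "esym3 (\<lambda>i. y (i + p)) = esym3 y"
    unfolding esym1_def esym3_def by (rule sum_shift_3, rule prod_shift_3)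
  have "esym2 (\<lambda>i. y (i + p)) = (\<Sum>j\<in>UNIV. y (j + p) * y ((j + p) + 1))"
    by (simp add: esym2_def ac_simps)
  also have "\<dots> = esym2 y"
    unfolding esym2_def by (rule sum_shift_3[of "\<lambda>j. y j * y (j + 1)"])
  finally show "esym2 (\<lambda>i. y (i + p)) = esym2 y" .
qed

text \<open>Each \<open>y i\<close> is a root of the cubic with roots \<open>y 1\<close>,
  \<open>y 2\<close>, \<open>y 3\<close>. Applied to \<open>cube_var\<close>, this makes the x_i
  integral over the invariants.\<close>

lemma esym_relation: "y i ^ 3 - esym1 y * y i ^ 2 + esym2 y * y i - esym3 y = 0"
proof -
  have "(1::3) + 1 = 2" "(2::3) + 1 = 3" "(3::3) + 1 = 1" by simp_all
  then have e2: "esym2 y = y 1 * y 2 + y 2 * y 3 + y 3 * y 1"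
    unfolding esym2_def sum_3 by (simp only:)
  have e3: "esym3 y = y 1 * y 2 * y 3"
    unfolding esym3_def UNIV_3 by (simp add: mult.assoc)
  have e1: "esym1 y = y 1 + y 2 + y 3"
    unfolding esym1_def sum_3 ..
  show ?thesis
    using exhaust_3[of i] unfolding e1 e2 e3
    by (elim disjE) (simp_all add: power2_eq_square power3_eq_cube algebra_simps)
qed

text \<open>Cubing removes the powers of \<zeta> from the action and leaves only the cyclic shift of
  the indices.\<close>

definition cube_var :: "3 \<Rightarrow> 'f::field mpol" where
  "cube_var i = pvar (Xv i) ^ 3"

lemma heis_subst_cube_var:
  assumes "z ^ 3 = 1"
  shows "heis_subst z g (cube_var i) = cube_var (i + g$1$2)"
  by (simp add: heis_subst_def cube_var_def psubst_power power_mult_distrib zpow_cube[OF assms]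
      flip: pconst_power)

lemma psubst_sum: "psubst s (sum h I) = (\<Sum>i\<in>I. psubst s (h i))"
  by (induction I rule: infinite_finite_induct) (simp_all add: psubst_add)

lemma invariant_esym:
  assumes z: "z ^ 3 = 1"
  shows "invariant z a b (esym1 cube_var)" "invariant z a b (esym2 cube_var)" "invariant z a b (esym3 cube_var)"
proof -
  have "heis_subst z g (esym1 cube_var) = esym1 (\<lambda>i. cube_var (i + g$1$2))"
    "heis_subst z g (esym2 cube_var) = esym2 (\<lambda>i. cube_var (i + g$1$2))"
    "heis_subst z g (esym3 cube_var) = esym3 (\<lambda>i. cube_var (i + g$1$2))" for g
    unfolding esym1_def esym2_def esym3_def heis_subst_def psubst_sum psubst_prod psubst_mult
    unfolding heis_subst_def[symmetric] heis_subst_cube_var[OF z] by (simp_all add: ac_simps)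
  then show "invariant z a b (esym1 cube_var)" "invariant z a b (esym2 cube_var)" "invariant z a b (esym3 cube_var)"
    by (simp_all add: invariant_def esym_shift)
qed

lemma ev_cls_cong:
  assumes "t Alpha ^ 3 = to_ac a" "t Beta ^ 3 = to_ac b" "cls a b f = cls a b g"
  shows "ev t f = ev t g"
  using ev_rel_ideal[OF assms(1,2), of "f - g"] assms(3) by (simp add: cls_eq_iff ev_hom)

text \<open>Galois moves \<open>t\<close> inside its orbit, where an invariant takes a single value;
  that value is fixed by all automorphisms.\<close>

lemma invariant_ev_rational:
  fixes a :: "'f::field"
  assumes char0: "\<And>n. n > 0 \<Longrightarrow> of_nat n \<noteq> (0::'f)"
    and t: "good_point a b t"
    and orbit: "\<And>\<sigma>. \<sigma> \<in> carrier abs_gal \<Longrightarrow> \<exists>g\<in>carrier heis. \<sigma> \<circ> t = pact z g t"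
    and f: "invariant z a b f"
  shows "ev t f \<in> range to_ac"
proof (rule abs_gal_fixed[OF char0])
  fix \<sigma> :: "'f gal" assume \<sigma>: "\<sigma> \<in> carrier abs_gal"
  then obtain g where g: "g \<in> carrier heis" "\<sigma> \<circ> t = pact z g t"
    using orbit by blast
  have "\<sigma> (ev t f) = ev t (heis_subst z g f)"
    by (simp add: gal_ev[OF \<sigma>] g(2) ev_heis_subst)
  also have "\<dots> = ev t f"
    using f g(1) t by (intro ev_cls_cong[of t a b]) (simp_all add: invariant_def good_point_def)
  finally show "\<sigma> (ev t f) = ev t f" .
qed

lemma fixed_ideal_mem:
  assumes "z ^ 3 = 1" "h \<in> carrier heis"
  shows "cls a b (heis_subst z h f - f) \<in> fixed_ideal z a b h"
proof -
  interpret R: cring "R_F a b" by (rule R_F_cring)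
  have eq: "act z h (cls a b f) \<ominus>\<^bsub>R_F a b\<^esub> cls a b f = cls a b (heis_subst z h f - f)" for f
    unfolding act_cls[OF assms] by (rule R_F_ops)
  have "{act z h C \<ominus>\<^bsub>R_F a b\<^esub> C | C. C \<in> carrier (R_F a b)} \<subseteq> carrier (R_F a b)"
    using eq by (auto simp: carrier_R_F)
  from R.genideal_self[OF this] eq[of f, symmetric] show ?thesis
    unfolding fixed_ideal_def carrier_R_F by blast
qed

text \<open>If \<open>h\<close> scaled \<alpha> or \<beta> nontrivially, the prime would contain
  that variable, hence its cube, the unit \<open>a\<close> or \<open>b\<close>. So \<open>h\<close>
  is central and scales every x_i by a nontrivial root of unity, which forces x_i into the
  prime.\<close>

lemma fixed_ideal_prime_over_kernel:
  assumes z: "z ^ 3 = 1" "z \<noteq> 1" and ab: "a \<noteq> 0" "b \<noteq> 0"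
    and h: "h \<in> carrier heis" "h \<noteq> mat 1"
    and Q: "primeideal Q (R_F a b)" "fixed_ideal z a b h \<subseteq> Q"
  shows "cls a b (cube_var i) \<in> Q"
proof -
  interpret Q: primeideal Q "R_F a b" by (rule Q(1))
  have mult: "cls a b (g * f) \<in> Q" if "cls a b f \<in> Q" for f g
    using Q.I_l_closed[OF that, of "cls a b g"] by (simp add: R_F_ops carrier_R_F)
  have one: "cls a b 1 \<notin> Q"
    using Q.one_imp_carrier Q.I_notcarr by (auto simp: R_F_ops)
  have unit: "cls a b (pconst c) \<notin> Q" if "c \<noteq> 0" for c
    using mult[of "pconst c" "pconst (1 / c)"] one that by (auto simp flip: pconst_mult)
  have scaled: "cls a b f \<in> Q" if "cls a b (pconst c * f) \<in> Q" "c \<noteq> 0" for c f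
    using mult[OF that(1), of "pconst (1 / c)"] that(2)
    by (simp add: mult.assoc[symmetric] flip: pconst_mult)
  have mem: "cls a b (heis_subst z h f - f) \<in> Q" for f
    using fixed_ideal_mem[OF z(1) h(1)] Q(2) by blast
  \<comment> \<open>On an eigenvector, \<open>h\<close> minus the identity is multiplication by
    \<open>zpow z k - 1\<close>, a nonzero scalar that can be divided out.\<close>
  have eigen: "cls a b (pvar v) \<in> Q" if "heis_subst z h (pvar v) = pconst (zpow z k) * pvar v" "k \<noteq> 0" for v k
  proof (rule scaled)
    show "zpow z k - 1 \<noteq> 0" using that(2) zpow_eq_1_iff[OF z] by simp
    have "pconst (zpow z k - 1) * pvar v = heis_subst z h (pvar v) - pvar v"
      unfolding that(1) by (simp add: pconst_def single_diff algebra_simps)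
    with mem[of "pvar v"] show "cls a b (pconst (zpow z k - 1) * pvar v) \<in> Q" by simp
  qed
  have cube: "cls a b (f ^ 3) \<in> Q" if "cls a b f \<in> Q" for f
    using mult[OF that, of "f * f"] by (simp add: power3_eq_cube)
  have "h$1$2 = 0"
  proof (rule ccontr)
    assume "h$1$2 \<noteq> 0"
    then have "cls a b (pvar Alpha) \<in> Q"
      by (intro eigen) (simp_all add: heis_subst_def)
    then have "cls a b (pvar Alpha ^ 3) \<in> Q" by (rule cube)
    moreover have "cls a b (pvar Alpha ^ 3) = cls a b (pconst a)"
      by (simp add: cls_eq_iff rel_ideal_gens)
    ultimately show False using unit[OF ab(1)] by simp
  qed
  moreover have "h$2$3 = 0"
  proof (rule ccontr)
    assume "h$2$3 \<noteq> 0"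
    then have "cls a b (pvar Beta) \<in> Q"
      by (intro eigen) (simp_all add: heis_subst_def)
    then have "cls a b (pvar Beta ^ 3) \<in> Q" by (rule cube)
    moreover have "cls a b (pvar Beta ^ 3) = cls a b (pconst b)"
      by (simp add: cls_eq_iff rel_ideal_gens)
    ultimately show False using unit[OF ab(2)] by simp
  qed
  moreover from calculation have "h$1$3 \<noteq> 0"
    using heis_eq_one[OF h(1)] h(2) by blast
  ultimately have "cls a b (pvar (Xv i)) \<in> Q"
    by (intro eigen[of "Xv i" "h$1$3"]) (simp_all add: heis_subst_def)
  then show ?thesis unfolding cube_var_def by (rule cube)
qed

lemma cube_vars_in_prime:
  fixes a b :: "'f::field"
  assumes Q: "primeideal Q (R_F a b)" and mem: "\<And>i. cls a b (cube_var i) \<in> Q"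
  shows "cls a b (esym1 cube_var) \<in> Q" "cls a b (esym2 cube_var) \<in> Q" "cls a b (esym3 cube_var) \<in> Q"
proof -
  interpret Q: primeideal Q "R_F a b" by (rule Q(1))
  have mult: "cls a b (g * f) \<in> Q" if "cls a b f \<in> Q" for f g
    using Q.I_l_closed[OF that, of "cls a b g"] by (simp add: R_F_ops carrier_R_F)
  have add: "cls a b (f + g) \<in> Q" if "cls a b f \<in> Q" "cls a b g \<in> Q" for f g
    using additive_subgroup.a_closed[OF Q.is_additive_subgroup that] by (simp add: R_F_ops)
  show "cls a b (esym1 cube_var) \<in> Q" "cls a b (esym2 cube_var) \<in> Q"
    unfolding esym1_def esym2_def sum_3 by (intro add mult mem)+
  have "(esym3 cube_var :: 'f mpol) = cube_var 1 * cube_var 2 * cube_var 3"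
    unfolding esym3_def UNIV_3 by (simp add: mult.assoc)
  then show "cls a b (esym3 cube_var) \<in> Q" by (simp only: mult[OF mem])
qed

text \<open>The rational point is evaluation at \<open>t\<close>, restricted to the invariants,
  where its values lie in \<open>F\<close>.\<close>

lemma good_point_imp_X_point:
  fixes a b z :: "'f::field"
  assumes z: "z ^ 3 = 1" "z \<noteq> 1" and ab: "a \<noteq> 0" "b \<noteq> 0"
    and char0: "\<And>n. n > 0 \<Longrightarrow> of_nat n \<noteq> (0::'f)"
    and t: "good_point a b t"
    and orbit: "\<And>\<sigma>. \<sigma> \<in> carrier abs_gal \<Longrightarrow> \<exists>g\<in>carrier heis. \<sigma> \<circ> t = pact z g t"
  shows "X_points z a b \<noteq> {}"
proof -
  let ?A = "A_ab z a b"
  let ?F = "ring_of_type_algebra :: 'f ring"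
  \<comment> \<open>Any representative may be chosen, since \<open>ev t\<close> depends only on the
    class.\<close>
  define \<phi> where "\<phi> = (\<lambda>C\<in>carrier ?A. of_ac (ev t (SOME f. cls a b f = C)))"
  have t': "t Alpha ^ 3 = to_ac a" "t Beta ^ 3 = to_ac b"
    using t by (simp_all add: good_point_def)
  have carr: "cls a b f \<in> carrier ?A" if "invariant z a b f" for f
    using that by (simp add: carrier_A_ab[OF z(1)])
  have carrE: "\<exists>f. C = cls a b f \<and> invariant z a b f" if "C \<in> carrier ?A" for C
    using that by (auto simp: carrier_A_ab[OF z(1)])
  have \<phi>: "to_ac (\<phi> (cls a b f)) = ev t f" if f: "invariant z a b f" for f
  proof -
    have "cls a b (SOME g. cls a b g = cls a b f) = cls a b f"
      by (rule someI) (rule refl)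
    then have "ev t (SOME g. cls a b g = cls a b f) = ev t f"
      by (rule ev_cls_cong[OF t'])
    then have "\<phi> (cls a b f) = of_ac (ev t f)"
      unfolding \<phi>_def restrict_apply'[OF carr[OF f]] by (rule arg_cong)
    then have "to_ac (\<phi> (cls a b f)) = to_ac (of_ac (ev t f))" by simp
    also have "\<dots> = ev t f"
      by (rule to_ac_of_ac, rule invariant_ev_rational[OF char0 t orbit f])
    finally show ?thesis .
  qed
  have const: "\<phi> (cls a b (pconst c)) = c" for c
    using \<phi>[OF invariant_pconst, of c] by (simp add: ev_simps)
  have hom: "\<phi> \<in> ring_hom ?A ?F"
  proof (rule ring_hom_memI)
    fix x y assume "x \<in> carrier ?A" "y \<in> carrier ?A"
    then obtain f g where f: "x = cls a b f" "invariant z a b f" and g: "y = cls a b g" "invariant z a b g"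
      using carrE by blast
    have "to_ac (\<phi> (cls a b (f * g))) = to_ac (\<phi> x * \<phi> y)"
      unfolding to_ac_mult f(1) g(1) \<phi>[OF f(2)] \<phi>[OF g(2)] \<phi>[OF invariant_mult[OF f(2) g(2)]]
      by (rule ev_simps)
    then have "\<phi> (cls a b (f * g)) = \<phi> x * \<phi> y" unfolding to_ac_eq_iff .
    then show "\<phi> (x \<otimes>\<^bsub>?A\<^esub> y) = \<phi> x \<otimes>\<^bsub>?F\<^esub> \<phi> y"
      by (simp add: f(1) g(1) A_ab_ops R_F_ops type_ring_sel)
    have "to_ac (\<phi> (cls a b (f + g))) = to_ac (\<phi> x + \<phi> y)"
      unfolding to_ac_add f(1) g(1) \<phi>[OF f(2)] \<phi>[OF g(2)] \<phi>[OF invariant_add[OF f(2) g(2)]]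
      by (rule ev_simps)
    then have "\<phi> (cls a b (f + g)) = \<phi> x + \<phi> y" unfolding to_ac_eq_iff .
    then show "\<phi> (x \<oplus>\<^bsub>?A\<^esub> y) = \<phi> x \<oplus>\<^bsub>?F\<^esub> \<phi> y"
      by (simp add: f(1) g(1) A_ab_ops R_F_ops type_ring_sel)
  next
    show "\<phi> \<one>\<^bsub>?A\<^esub> = \<one>\<^bsub>?F\<^esub>"
      using const[of 1] by (simp add: A_ab_ops R_F_ops type_ring_sel)
  qed (simp add: type_ring_sel)
  have affine: "\<phi> \<in> affine_points z a b"
    unfolding affine_points_def
    using hom const by (simp add: \<phi>_def scalar_def cls_def[symmetric])
  interpret A: cring ?A by (rule A_ab_cring[OF z(1)])
  have "ring_hom_ring ?A ?F \<phi>"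
    by (rule ring_hom_ringI2[OF A.ring_axioms ring_from_type_algebra hom])
  moreover have "primeideal {0} ?F"
    using domain.zeroprimeideal[of ?F] field_from_type_algebra[where 'a = 'f]
    unfolding type_ring_sel by (simp add: field.axioms(1))
  ultimately have "primeideal {C \<in> carrier ?A. \<phi> C \<in> {0}} ?A"
    using ring_hom_ring.primeideal_vimage A.cring_axioms by blast
  moreover have ker: "a_kernel ?A ?F \<phi> = {C \<in> carrier ?A. \<phi> C = 0}"
    unfolding a_kernel_def' type_ring_sel ..
  ultimately have spec: "a_kernel ?A ?F \<phi> \<in> Spec ?A"
    by (simp add: Spec_def)
  have "a_kernel ?A ?F \<phi> \<notin> S_locus z a b"
  proof
    assume "a_kernel ?A ?F \<phi> \<in> S_locus z a b"
    then obtain h Q where h: "h \<in> carrier heis" "h \<noteq> \<one>\<^bsub>heis\<^esub>"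
      and Q: "Q \<in> fixed_locus z a b h" and eq: "a_kernel ?A ?F \<phi> = quotient_map z a b Q"
      unfolding S_locus_def by blast
    have h1: "h \<noteq> mat 1" using h(2) by (simp add: heis_def)
    have Q': "primeideal Q (R_F a b)" "fixed_ideal z a b h \<subseteq> Q"
      using Q by (simp_all add: fixed_locus_def vanishing_def Spec_def)
    \<comment> \<open>\<open>Q\<close> is related to \<open>t\<close> only through its invariant
      elements, so vanishing at \<open>t\<close> is obtained for the symmetric functions first and
      for the coordinates afterwards.\<close>
    note esymQ = cube_vars_in_prime[OF Q'(1) fixed_ideal_prime_over_kernel[OF z ab h(1) h1 Q']]
    have vanish: "ev t f = 0" if "invariant z a b f" "cls a b f \<in> Q" for f
    proof -
      have "cls a b f \<in> a_kernel ?A ?F \<phi>"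
        unfolding eq quotient_map_def using that carr by blast
      then show ?thesis using \<phi>[OF that(1)] by (simp add: ker)
    qed
    have esym0: "ev t (esym1 cube_var) = 0" "ev t (esym2 cube_var) = 0" "ev t (esym3 cube_var) = 0"
      by (intro vanish invariant_esym z esymQ)+
    have "t (Xv i) = 0" for i
    proof -
      \<comment> \<open>With its lower coefficients zero at \<open>t\<close>, the cubic leaves only
        the ninth power of the coordinate.\<close>
      have "cube_var i ^ 3 = esym1 cube_var * cube_var i ^ 2 - esym2 cube_var * cube_var i + (esym3 cube_var :: 'f mpol)"
        using esym_relation[of cube_var i] by (simp add: algebra_simps)
      then have "ev t (cube_var i ^ 3) = 0"
        by (simp add: ev_simps ev_hom esym0)
      then show ?thesis by (simp add: cube_var_def ev_simps ev_hom)
    qed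
    with t show False by (simp add: good_point_def)
  qed
  with spec affine have "\<phi> \<in> X_points z a b"
    by (simp add: X_points_def X_space_def)
  then show ?thesis by blast
qed


section \<open>From a cochain to a twisted geometric point\<close>

text \<open>Dedekind's elimination: replacing x by x y and subtracting f0(y) times the relation
  removes \<open>f0\<close>, where y separates \<open>f0\<close> from a given g. Extensionality
  makes distinct members differ at a point of \<open>L\<close>.\<close>

lemma dedekind_independence:
  fixes c :: "('m::monoid_mult \<Rightarrow> 'e::idom) \<Rightarrow> 'e"
  assumes "finite \<Gamma>" and L: "1 \<in> L" "\<And>x y. x \<in> L \<Longrightarrow> y \<in> L \<Longrightarrow> x * y \<in> L"
    and "\<Gamma> \<subseteq> extensional L"
    and "\<And>f. f \<in> \<Gamma> \<Longrightarrow> f 1 = 1"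
    and "\<And>f x y. f \<in> \<Gamma> \<Longrightarrow> x \<in> L \<Longrightarrow> y \<in> L \<Longrightarrow> f (x * y) = f x * f y"
    and "\<And>x. x \<in> L \<Longrightarrow> (\<Sum>f\<in>\<Gamma>. c f * f x) = 0"
  shows "\<forall>f\<in>\<Gamma>. c f = 0"
  using assms(1,4-)
proof (induction \<Gamma> arbitrary: c rule: finite_induct)
  case (insert f0 \<Gamma>)
  have hom: "f (x * y) = f x * f y" if "f \<in> insert f0 \<Gamma>" "x \<in> L" "y \<in> L" for f x y
    using insert.prems(3) that by blast
  have zero: "c g = 0" if g: "g \<in> \<Gamma>" for g
  proof -
    have "g \<noteq> f0" using insert.hyps(2) g by blast
    moreover have "g \<in> extensional L" "f0 \<in> extensional L" using insert.prems(1) g by auto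
    ultimately obtain y where y: "y \<in> L" "g y \<noteq> f0 y"
      using extensionalityI by metis
    have "(\<Sum>f\<in>\<Gamma>. (c f * (f y - f0 y)) * f x) = 0" if x: "x \<in> L" for x
    proof -
      have "0 = (\<Sum>f\<in>insert f0 \<Gamma>. c f * f (x * y)) - f0 y * (\<Sum>f\<in>insert f0 \<Gamma>. c f * f x)"
        using insert.prems(4) L(2)[OF x y(1)] x by simp
      also have "\<dots> = (\<Sum>f\<in>insert f0 \<Gamma>. c f * f (x * y) - f0 y * (c f * f x))"
        by (simp add: sum_subtractf sum_distrib_left)
      also have "\<dots> = (\<Sum>f\<in>insert f0 \<Gamma>. (c f * (f y - f0 y)) * f x)"
        by (rule sum.cong) (simp_all add: hom x y algebra_simps)
      also have "\<dots> = (\<Sum>f\<in>\<Gamma>. (c f * (f y - f0 y)) * f x)"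
        using insert.hyps by simp
      finally show ?thesis by simp
    qed
    then have "\<forall>f\<in>\<Gamma>. c f * (f y - f0 y) = 0"
      using insert.prems by (intro insert.IH) auto
    with g y(2) show ?thesis by auto
  qed
  \<comment> \<open>All other coefficients are zero by now, so the relation at 1 leaves only
    \<open>c f0\<close>.\<close>
  have "(\<Sum>f\<in>insert f0 \<Gamma>. c f * f 1) = 0"
    by (rule insert.prems(4)[OF L(1)])
  then have "c f0 = 0"
    using insert.hyps insert.prems(2)[of f0] zero by simp
  with zero show ?case by simp
qed simp

text \<open>All conjugates are roots of one nonzero polynomial over the base.\<close>

lemma gal_orbit_finite: "finite ((\<lambda>\<sigma>. \<sigma> x) ` carrier abs_gal)"
proof -
  obtain p where p: "p \<noteq> 0" "poly (map_poly to_ac p) x = 0"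
    using alg_closure_algebraic .
  have "poly (map_poly to_ac p) (\<sigma> x) = 0" if \<sigma>: "\<sigma> \<in> carrier abs_gal" for \<sigma>
  proof -
    have "\<sigma> (poly (map_poly to_ac q) x) = poly (map_poly to_ac q) (\<sigma> x)" for q
      by (induction q) (simp_all add: map_poly_pCons galD[OF \<sigma>] gal_hom[OF \<sigma>])
    with p(2) gal_hom(1)[OF \<sigma>] show ?thesis by metis
  qed
  then have "(\<lambda>\<sigma>. \<sigma> x) ` carrier abs_gal \<subseteq> {y. poly (map_poly to_ac p) y = 0}"
    by blast
  moreover have "finite {y. poly (map_poly to_ac p) y = 0}"
    using p(1) by (intro poly_roots_finite) (simp add: map_poly_eq_0_iff)
  ultimately show ?thesis by (rule finite_subset)
qed

text \<open>
  Speiser's form of Hilbert's Theorem 90 for the monomial representation underlying the action: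
  the twisted trace of \<open>\<theta>\<close> times a basis vector is a twisted vector, and by independence of
  characters it is nonzero for some \<open>\<theta>\<close>. The sum runs over the finite quotient through which the
  cocycle factors, realised as the restrictions of automorphisms to the fixed field \<open>L\<close> of its kernel.
\<close>

lemma twisted_vector_exists:
  fixes z :: "'f::field" and P Q R :: "'f gal \<Rightarrow> 3"
  assumes z: "z ^ 3 = 1"
    and P: "\<And>\<sigma> \<tau>. \<sigma> \<in> carrier abs_gal \<Longrightarrow> \<tau> \<in> carrier abs_gal \<Longrightarrow> P (\<sigma> \<circ> \<tau>) = P \<sigma> + P \<tau>"
    and Q: "\<And>\<sigma> \<tau>. \<sigma> \<in> carrier abs_gal \<Longrightarrow> \<tau> \<in> carrier abs_gal \<Longrightarrow> Q (\<sigma> \<circ> \<tau>) = Q \<sigma> + Q \<tau>"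
    and R: "\<And>\<sigma> \<tau>. \<sigma> \<in> carrier abs_gal \<Longrightarrow> \<tau> \<in> carrier abs_gal \<Longrightarrow>
      R (\<sigma> \<circ> \<tau>) = R \<sigma> + R \<tau> + P \<sigma> * Q \<tau>"
    and S0: "finite S0" "\<And>\<sigma>. \<sigma> \<in> carrier abs_gal \<Longrightarrow> (\<And>s. s \<in> S0 \<Longrightarrow> \<sigma> s = s) \<Longrightarrow>
      P \<sigma> = 0 \<and> Q \<sigma> = 0 \<and> R \<sigma> = 0"
  shows "\<exists>x :: 3 \<Rightarrow> 'f alg_closure. x 1 \<noteq> 0 \<and> (\<forall>\<sigma>\<in>carrier abs_gal. \<forall>i.
    \<sigma> (x i) = zpow (to_ac z) (R \<sigma> + Q \<sigma> * (1 - (i + P \<sigma>))) * x (i + P \<sigma>))"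
proof -
  let ?G = "carrier abs_gal :: 'f gal set"
  have z': "to_ac z ^ 3 = 1" using z by (simp flip: to_ac_power)
  \<comment> \<open>The Galois-stable closure of \<open>S0\<close>, still finite; automorphisms map
    it into itself, so only finitely many restrictions to it occur.\<close>
  define S where "S = (\<Union>s\<in>S0. (\<lambda>\<sigma>. \<sigma> s) ` ?G)"
  have "finite S"
    unfolding S_def using S0(1) gal_orbit_finite by (rule finite_UN_I)
  have "S0 \<subseteq> S"
  proof
    fix s assume "s \<in> S0"
    then show "s \<in> S"
      unfolding S_def using gal_id by (intro UN_I[of s] image_eqI[of _ _ id]) simp_all
  qed
  have stable: "\<sigma> s \<in> S" if st: "\<sigma> \<in> ?G" "s \<in> S" for \<sigma> s
  proof -
    obtain s0 \<tau> where "s0 \<in> S0" "\<tau> \<in> ?G" "s = \<tau> s0"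
      using st(2) unfolding S_def by blast
    then have "s0 \<in> S0" "\<sigma> \<circ> \<tau> \<in> ?G" "\<sigma> s = (\<sigma> \<circ> \<tau>) s0"
      using gal_comp[OF st(1)] by simp_all
    then show ?thesis unfolding S_def by blast
  qed
  define L where "L = {x. \<forall>\<sigma>\<in>?G. (\<forall>s\<in>S. \<sigma> s = s) \<longrightarrow> \<sigma> x = x}"
  have "S \<subseteq> L" by (auto simp: L_def)
  have L1: "1 \<in> L" by (simp add: L_def gal_hom)
  have Lmult: "x * y \<in> L" if "x \<in> L" "y \<in> L" for x y
    unfolding L_def mem_Collect_eq
  proof (intro ballI impI)
    fix \<sigma> assume \<sigma>: "\<sigma> \<in> ?G" "\<forall>s\<in>S. \<sigma> s = s"
    with that have "\<sigma> x = x" "\<sigma> y = y" unfolding L_def by blast+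
    then show "\<sigma> (x * y) = x * y" by (simp add: galD(3)[OF \<sigma>(1)])
  qed
  define r where "r = (\<lambda>\<sigma> :: 'f gal. restrict \<sigma> L)"
  define \<Gamma> where "\<Gamma> = r ` ?G"
  \<comment> \<open>Automorphisms that agree on \<open>S\<close> differ by one that fixes
    \<open>S\<close>; such a one fixes \<open>L\<close> and is killed by \<open>P\<close>,
    \<open>Q\<close> and \<open>R\<close>. So all data descend to restrictions.\<close>
  have quot: "\<exists>\<delta>\<in>?G. \<sigma> = \<tau> \<circ> \<delta> \<and> (\<forall>s\<in>S. \<delta> s = s)"
    if \<sigma>\<tau>: "\<sigma> \<in> ?G" "\<tau> \<in> ?G" "\<And>s. s \<in> S \<Longrightarrow> \<sigma> s = \<tau> s" for \<sigma> \<tau>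
  proof (intro bexI conjI ballI)
    let ?\<delta> = "inv_into UNIV \<tau> \<circ> \<sigma>"
    show "?\<delta> \<in> ?G" by (intro gal_comp gal_inv \<sigma>\<tau>)
    show "\<sigma> = \<tau> \<circ> ?\<delta>" by (rule ext) (simp add: gal_inv(3)[OF \<sigma>\<tau>(2)])
    show "?\<delta> s = s" if "s \<in> S" for s
      using \<sigma>\<tau>(3)[OF that] by (simp add: gal_inv(2)[OF \<sigma>\<tau>(2)])
  qed
  have r_eqD: "P \<sigma> = P \<tau>" "Q \<sigma> = Q \<tau>" "R \<sigma> = R \<tau>" if \<sigma>\<tau>: "\<sigma> \<in> ?G" "\<tau> \<in> ?G" "r \<sigma> = r \<tau>" for \<sigma> \<tau>
  proof -
    have "\<sigma> s = \<tau> s" if "s \<in> S" for s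
      using fun_cong[OF \<sigma>\<tau>(3), of s] that \<open>S \<subseteq> L\<close> by (auto simp: r_def)
    then obtain \<delta> where \<delta>: "\<delta> \<in> ?G" "\<sigma> = \<tau> \<circ> \<delta>" "\<forall>s\<in>S. \<delta> s = s"
      using quot[OF \<sigma>\<tau>(1,2)] by blast
    then have "P \<delta> = 0" "Q \<delta> = 0" "R \<delta> = 0"
      using S0(2)[OF \<delta>(1)] \<open>S0 \<subseteq> S\<close> by blast+
    then show "P \<sigma> = P \<tau>" "Q \<sigma> = Q \<tau>" "R \<sigma> = R \<tau>"
      unfolding \<delta>(2) P[OF \<sigma>\<tau>(2) \<delta>(1)] Q[OF \<sigma>\<tau>(2) \<delta>(1)] R[OF \<sigma>\<tau>(2) \<delta>(1)] by simp_all
  qed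
  have r_eqI: "r \<sigma> = r \<tau>" if \<sigma>\<tau>: "\<sigma> \<in> ?G" "\<tau> \<in> ?G" "restrict \<sigma> S = restrict \<tau> S" for \<sigma> \<tau>
  proof -
    have "\<sigma> s = \<tau> s" if "s \<in> S" for s
      using fun_cong[OF \<sigma>\<tau>(3), of s] that by simp
    then obtain \<delta> where \<delta>: "\<delta> \<in> ?G" "\<sigma> = \<tau> \<circ> \<delta>" "\<forall>s\<in>S. \<delta> s = s"
      using quot[OF \<sigma>\<tau>(1,2)] by blast
    have "\<sigma> x = \<tau> x" if "x \<in> L" for x
    proof -
      have "\<delta> x = x" using that \<delta>(1,3) unfolding L_def by blast
      then show ?thesis by (simp add: \<delta>(2))
    qed
    then show ?thesis unfolding r_def by (intro restrict_ext)
  qed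
  have "finite \<Gamma>"
  proof -
    have "(\<lambda>\<sigma>. restrict \<sigma> S) ` ?G \<subseteq> S \<rightarrow>\<^sub>E S"
      using stable by (auto simp: PiE_iff)
    then have fin: "finite ((\<lambda>\<sigma>. restrict \<sigma> S) ` ?G)"
      by (rule finite_subset) (intro finite_PiE \<open>finite S\<close>)
    have "\<Gamma> \<subseteq> (\<lambda>f. r (SOME \<sigma>. \<sigma> \<in> ?G \<and> restrict \<sigma> S = f)) ` ((\<lambda>\<sigma>. restrict \<sigma> S) ` ?G)"
    proof
      fix f assume "f \<in> \<Gamma>"
      then obtain \<sigma> where \<sigma>: "\<sigma> \<in> ?G" "f = r \<sigma>" by (auto simp: \<Gamma>_def)
      let ?\<tau> = "SOME \<tau>. \<tau> \<in> ?G \<and> restrict \<tau> S = restrict \<sigma> S"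
      have "?\<tau> \<in> ?G \<and> restrict ?\<tau> S = restrict \<sigma> S"
        by (rule someI[of _ \<sigma>]) (simp add: \<sigma>)
      then have "f = r ?\<tau>" using r_eqI[OF \<sigma>(1), of ?\<tau>] \<sigma>(2) by simp
      then show "f \<in> (\<lambda>f. r (SOME \<sigma>. \<sigma> \<in> ?G \<and> restrict \<sigma> S = f)) ` ((\<lambda>\<sigma>. restrict \<sigma> S) ` ?G)"
        using \<sigma>(1) by blast
    qed
    then show ?thesis by (rule finite_surj[OF fin])
  qed
  \<comment> \<open>A lift of each restriction; by \<open>r_eqD\<close> the values of
    \<open>P\<close>, \<open>Q\<close>, \<open>R\<close> do not depend on it.\<close>
  define pick where "pick f = (SOME \<sigma>. \<sigma> \<in> ?G \<and> r \<sigma> = f)" for f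
  have pick: "pick (r \<sigma>) \<in> ?G \<and> r (pick (r \<sigma>)) = r \<sigma>" if "\<sigma> \<in> ?G" for \<sigma>
    unfolding pick_def by (rule someI[of _ \<sigma>]) (simp add: that)
  \<comment> \<open>The summand of \<sigma> is the inverse group element applied to
    \<sigma>(\<theta>) in position 1. It sits at index 1 + P(\<sigma>), and its exponent P Q - R is
    opposite to the exponent R + Q (1 - (1 + P)) prescribed at i = 1.\<close>
  define coef where "coef i f = (let \<sigma> = pick f in
      if P \<sigma> = i - 1 then zpow (to_ac z) (P \<sigma> * Q \<sigma> - R \<sigma>) else 0)" for i f
  have coef: "coef i (r \<sigma>) = (if P \<sigma> = i - 1 then zpow (to_ac z) (P \<sigma> * Q \<sigma> - R \<sigma>) else 0)"
    if "\<sigma> \<in> ?G" for i \<sigma>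
  proof -
    have "P (pick (r \<sigma>)) = P \<sigma>" "Q (pick (r \<sigma>)) = Q \<sigma>" "R (pick (r \<sigma>)) = R \<sigma>"
      using pick[OF that] by (intro r_eqD that; simp)+
    then show ?thesis by (simp add: coef_def)
  qed
  have "P id = 0" "R id = 0" "Q id = 0"
    using S0(2)[OF gal_id] by simp_all
  \<comment> \<open>At the identity the coefficient is 1, so independence of characters yields a
    \<theta> at which the combination is nonzero.\<close>
  then have "coef 1 (r id) \<noteq> 0"
    using coef[OF gal_id, of 1] by (simp add: zpow_def)
  moreover have "r id \<in> \<Gamma>"
    unfolding \<Gamma>_def by (rule imageI[OF gal_id])
  ultimately have "\<not> (\<forall>f\<in>\<Gamma>. coef 1 f = 0)" by blast
  moreover have "\<forall>f\<in>\<Gamma>. coef 1 f = 0" if "\<And>x. x \<in> L \<Longrightarrow> (\<Sum>f\<in>\<Gamma>. coef 1 f * f x) = 0"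
  proof (rule dedekind_independence[OF \<open>finite \<Gamma>\<close> L1 Lmult _ _ _ that])
    show "\<Gamma> \<subseteq> extensional L" by (auto simp: \<Gamma>_def r_def)
    show "f 1 = 1" if "f \<in> \<Gamma>" for f
      using that L1 by (auto simp: \<Gamma>_def r_def gal_hom)
    show "f (x * y) = f x * f y" if "f \<in> \<Gamma>" "x \<in> L" "y \<in> L" for f x y
      using that Lmult by (auto simp: \<Gamma>_def r_def galD)
  qed
  ultimately obtain \<theta> where \<theta>: "\<theta> \<in> L" "(\<Sum>f\<in>\<Gamma>. coef 1 f * f \<theta>) \<noteq> 0" by blast
  define x where "x i = (\<Sum>f\<in>\<Gamma>. coef i f * f \<theta>)" for i
  have "x 1 \<noteq> 0" using \<theta>(2) by (simp add: x_def)
  moreover have "\<tau> (x i) = zpow (to_ac z) (R \<tau> + Q \<tau> * (1 - (i + P \<tau>))) * x (i + P \<tau>)"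
    if \<tau>: "\<tau> \<in> ?G" for \<tau> i
  proof -
    let ?k = "zpow (to_ac z) (R \<tau> + Q \<tau> * (1 - (i + P \<tau>)))"
    \<comment> \<open>Left composition with \<tau> permutes the restrictions, which reindexes the
      trace.\<close>
    let ?m = "\<lambda>f. restrict (\<tau> \<circ> f) L"
    have m: "?m (r \<sigma>) = r (\<tau> \<circ> \<sigma>)" for \<sigma>
      by (auto simp: r_def fun_eq_iff)
    have inj: "inj_on ?m \<Gamma>"
    proof (rule inj_onI)
      fix f g assume fg: "f \<in> \<Gamma>" "g \<in> \<Gamma>" "?m f = ?m g"
      have "f x = g x" if "x \<in> L" for x
        using fun_cong[OF fg(3), of x] that by (simp add: gal_hom(5)[OF \<tau>])
      moreover have "f \<in> extensional L" "g \<in> extensional L"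
        using fg by (auto simp: \<Gamma>_def r_def)
      ultimately show "f = g" by (intro extensionalityI)
    qed
    have "?m ` \<Gamma> \<subseteq> \<Gamma>"
      unfolding \<Gamma>_def using m gal_comp[OF \<tau>] by auto
    then have bij: "bij_betw ?m \<Gamma> \<Gamma>"
      unfolding bij_betw_def using inj endo_inj_surj[OF \<open>finite \<Gamma>\<close>] by blast
    have step: "\<tau> (coef i f * f \<theta>) = ?k * (coef (i + P \<tau>) (?m f) * ?m f \<theta>)" if f: "f \<in> \<Gamma>" for f
    proof -
      obtain \<sigma> where \<sigma>: "\<sigma> \<in> ?G" "f = r \<sigma>" using f by (auto simp: \<Gamma>_def)
      have coef': "coef (i + P \<tau>) (?m f) =
          (if P \<sigma> = i - 1 then zpow (to_ac z) ((P \<tau> + P \<sigma>) * (Q \<tau> + Q \<sigma>) - (R \<tau> + R \<sigma> + P \<tau> * Q \<sigma>)) else 0)"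
        unfolding \<sigma>(2) m coef[OF gal_comp[OF \<tau> \<sigma>(1)]] P[OF \<tau> \<sigma>(1)] Q[OF \<tau> \<sigma>(1)] R[OF \<tau> \<sigma>(1)]
        by (simp add: algebra_simps)
      \<comment> \<open>The cocycle rule of \<open>R\<close> supplies the term that cancels
        P(\<tau>) Q(\<sigma>); the remaining terms in \<tau> cancel once P(\<sigma>) is
        \<open>i - 1\<close>.\<close>
      have exponent: "R \<tau> + Q \<tau> * (1 - (i + P \<tau>)) + ((P \<tau> + P \<sigma>) * (Q \<tau> + Q \<sigma>) - (R \<tau> + R \<sigma> + P \<tau> * Q \<sigma>))
          = P \<sigma> * Q \<sigma> - R \<sigma>" if "P \<sigma> = i - 1"
        unfolding that by (simp add: algebra_simps)
      have "?k * coef (i + P \<tau>) (?m f) = coef i f"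
      proof (cases "P \<sigma> = i - 1")
        case True
        show ?thesis
          unfolding coef' unfolding \<sigma>(2) coef[OF \<sigma>(1)] if_P[OF True]
            zpow_add[OF z', symmetric] exponent[OF True] ..
      next
        case False
        then show ?thesis unfolding coef' unfolding \<sigma>(2) coef[OF \<sigma>(1)] by simp
      qed
      moreover have "\<tau> (coef i f) = coef i f"
        unfolding \<sigma>(2) coef[OF \<sigma>(1)]
        by (simp add: galD(4)[OF \<tau>] gal_hom(1)[OF \<tau>] flip: to_ac_zpow)
      moreover have "?m f \<theta> = \<tau> (f \<theta>)" using \<theta>(1) by simp
      ultimately show ?thesis by (simp add: galD(3)[OF \<tau>] mult.assoc[symmetric])
    qed
    have "\<tau> (x i) = (\<Sum>f\<in>\<Gamma>. ?k * (coef (i + P \<tau>) (?m f) * ?m f \<theta>))"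
      unfolding x_def gal_hom(6)[OF \<tau>] by (rule sum.cong[OF refl step])
    also have "\<dots> = ?k * (\<Sum>f\<in>\<Gamma>. coef (i + P \<tau>) (?m f) * ?m f \<theta>)"
      by (rule sum_distrib_left[symmetric])
    also have "(\<Sum>f\<in>\<Gamma>. coef (i + P \<tau>) (?m f) * ?m f \<theta>) = x (i + P \<tau>)"
      unfolding x_def by (rule sum.reindex_bij_betw[OF bij])
    finally show ?thesis .
  qed
  ultimately show ?thesis by blast
qed

lemma kummer_cocycle_comp:
  assumes z: "z ^ 3 = 1" "z \<noteq> 1" and c: "c ^ 3 = to_ac a" "a \<noteq> 0"
    and \<sigma>: "\<sigma> \<in> carrier abs_gal" and \<tau>: "\<tau> \<in> carrier abs_gal"
  shows "kummer_cocycle z c (\<sigma> \<circ> \<tau>) = kummer_cocycle z c \<sigma> + kummer_cocycle z c \<tau>"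
proof (rule iffD2[OF kummer_cocycle_eq_iff[OF z c gal_comp[OF \<sigma> \<tau>]]])
  have z': "to_ac z ^ 3 = 1" using z by (simp flip: to_ac_power)
  have s: "\<sigma> c = zpow (to_ac z) (kummer_cocycle z c \<sigma>) * c"
    by (rule iffD1[OF kummer_cocycle_eq_iff[OF z c \<sigma>] refl])
  have t: "\<tau> c = to_ac (zpow z (kummer_cocycle z c \<tau>)) * c"
    unfolding to_ac_zpow by (rule iffD1[OF kummer_cocycle_eq_iff[OF z c \<tau>] refl])
  have "\<sigma> (\<tau> c) = to_ac (zpow z (kummer_cocycle z c \<tau>)) * \<sigma> c"
    unfolding t galD(3,4)[OF \<sigma>] ..
  then show "(\<sigma> \<circ> \<tau>) c = zpow (to_ac z) (kummer_cocycle z c \<sigma> + kummer_cocycle z c \<tau>) * c"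
    unfolding s zpow_add[OF z'] to_ac_zpow o_apply by (simp only: ac_simps)
qed

lemma coboundary_imp_good_point:
  fixes a b z :: "'f::field"
  assumes z: "z ^ 3 = 1" "z \<noteq> 1" and c: "c ^ 3 = to_ac a" "a \<noteq> 0" and d: "d ^ 3 = to_ac b" "b \<noteq> 0"
    and w: "w \<in> cochains1" "\<And>\<sigma> \<tau>. \<sigma> \<in> carrier abs_gal \<Longrightarrow> \<tau> \<in> carrier abs_gal \<Longrightarrow>
      w \<tau> - w (\<sigma> \<circ> \<tau>) + w \<sigma> = kummer_cocycle z c \<sigma> * kummer_cocycle z d \<tau>"
  shows "\<exists>t. good_point a b t \<and>
    (\<forall>\<sigma>\<in>carrier abs_gal. \<exists>g\<in>carrier heis. \<sigma> \<circ> t = pact z g t)"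
proof -
  \<comment> \<open>The coboundary equation gives w(\<sigma>\<tau>) = w(\<sigma>) + w(\<tau>) - p
    q', whereas the group law adds p q'; hence the sign in \<open>?R\<close>.\<close>
  let ?P = "kummer_cocycle z c" and ?Q = "kummer_cocycle z d" and ?R = "\<lambda>\<sigma>. - w \<sigma>"
  note P = kummer_cocycle_eq_iff[OF z c] and Q = kummer_cocycle_eq_iff[OF z d]
  obtain S where S: "finite S"
    "\<And>\<tau>. \<tau> \<in> carrier abs_gal \<Longrightarrow> (\<And>s. s \<in> S \<Longrightarrow> \<tau> s = s) \<Longrightarrow> w \<tau> = w id"
    using cochains1_finite_at_id[OF w(1)] by blast
  have zpow0: "zpow (to_ac z) 0 = 1" by (simp add: zpow_def)
  have P0: "?P \<sigma> = 0" if "\<sigma> \<in> carrier abs_gal" "\<sigma> c = c" for \<sigma>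
    using P[OF that(1), of 0] that(2) zpow0 by simp
  have Q0: "?Q \<sigma> = 0" if "\<sigma> \<in> carrier abs_gal" "\<sigma> d = d" for \<sigma>
    using Q[OF that(1), of 0] that(2) zpow0 by simp
  \<comment> \<open>The equation at (id, id), where the cocycle of \<open>c\<close> vanishes; so
    \<open>w\<close> is zero, and not just constant, near the identity.\<close>
  have "w id = 0"
    using w(2)[OF gal_id gal_id] P0[OF gal_id] by simp
  then have trivial: "?P \<sigma> = 0 \<and> ?Q \<sigma> = 0 \<and> ?R \<sigma> = 0"
    if "\<sigma> \<in> carrier abs_gal" "\<And>s. s \<in> insert c (insert d S) \<Longrightarrow> \<sigma> s = s" for \<sigma>
    using S(2)[OF that(1)] P0[OF that(1)] Q0[OF that(1)] that(2) by simp
  have R: "?R (\<sigma> \<circ> \<tau>) = ?R \<sigma> + ?R \<tau> + ?P \<sigma> * ?Q \<tau>"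
    if "\<sigma> \<in> carrier abs_gal" "\<tau> \<in> carrier abs_gal" for \<sigma> \<tau>
    unfolding w(2)[OF that, symmetric] by simp
  have fin: "finite (insert c (insert d S))" using S(1) by simp
  have "\<exists>x :: 3 \<Rightarrow> 'f alg_closure. x 1 \<noteq> 0 \<and> (\<forall>\<sigma>\<in>carrier abs_gal. \<forall>i.
      \<sigma> (x i) = zpow (to_ac z) (?R \<sigma> + ?Q \<sigma> * (1 - (i + ?P \<sigma>))) * x (i + ?P \<sigma>))"
    by (rule twisted_vector_exists[OF z(1) kummer_cocycle_comp[OF z c] kummer_cocycle_comp[OF z d] R fin trivial])
  then obtain x :: "3 \<Rightarrow> 'f alg_closure" where x: "x 1 \<noteq> 0" "\<forall>\<sigma>\<in>carrier abs_gal. \<forall>i.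
      \<sigma> (x i) = zpow (to_ac z) (?R \<sigma> + ?Q \<sigma> * (1 - (i + ?P \<sigma>))) * x (i + ?P \<sigma>)"
    by blast
  define t where "t v = (case v of Xv i \<Rightarrow> x i | Alpha \<Rightarrow> c | Beta \<Rightarrow> d)" for v
  have "\<sigma> \<circ> t = pact z (heis_of (?P \<sigma>) (?Q \<sigma>) (?R \<sigma>)) t" if \<sigma>: "\<sigma> \<in> carrier abs_gal" for \<sigma>
  proof
    fix v show "(\<sigma> \<circ> t) v = pact z (heis_of (?P \<sigma>) (?Q \<sigma>) (?R \<sigma>)) t v"
    proof (cases v)
      case (Xv i)
      then show ?thesis using bspec[OF x(2) \<sigma>] by (simp add: t_def pact_simps heis_of_entries)
    next
      case Alpha
      then show ?thesis using iffD1[OF P[OF \<sigma>] refl] by (simp add: t_def pact_simps heis_of_entries)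
    next
      case Beta
      then show ?thesis using iffD1[OF Q[OF \<sigma>] refl] by (simp add: t_def pact_simps heis_of_entries)
    qed
  qed
  moreover have "good_point a b t"
    using c d x(1) by (auto simp: good_point_def t_def)
  ultimately show ?thesis using heis_of_entries(4) by blast
qed


section \<open>Lifting a rational point to a geometric point\<close>

definition mpoly_at :: "'e::field poly \<Rightarrow> 'e mpol \<Rightarrow> 'e mpol" where
  "mpoly_at q x = poly (map_poly pconst q) x"

lemma mpoly_at_pCons: "mpoly_at (pCons c q) x = pconst c + x * mpoly_at q x"
  by (simp add: mpoly_at_def map_poly_pCons)

lemma mpoly_at_0: "mpoly_at 0 x = 0"
  by (simp add: mpoly_at_def)

lemma mpoly_at_smult: "mpoly_at (smult c q) x = pconst c * mpoly_at q x"
  by (induction q) (simp_all add: mpoly_at_0 mpoly_at_pCons pconst_mult distrib_left ac_simps)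

lemma mpoly_at_add: "mpoly_at (p + q) x = mpoly_at p x + mpoly_at q x"
  by (induction p q rule: poly_induct2) (simp_all add: mpoly_at_0 mpoly_at_pCons pconst_add distrib_left ac_simps)

lemma mpoly_at_linear_factor: "mpoly_at ([:- c, 1:] * q) x = (x - pconst c) * mpoly_at q x"
proof -
  have "[:- c, 1:] * q = smult (- c) q + pCons 0 q" by simp
  then have "mpoly_at ([:- c, 1:] * q) x = pconst (- c) * mpoly_at q x + x * mpoly_at q x"
    by (simp only: mpoly_at_add mpoly_at_smult mpoly_at_pCons pconst_0 add_0)
  moreover have "pconst (- c) = - pconst c" by (simp add: pconst_def single_uminus)
  ultimately show ?thesis by (simp add: algebra_simps)
qed

definition proper_ideal :: "'a::comm_ring_1 set \<Rightarrow> bool" where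
  "proper_ideal J \<longleftrightarrow> (\<forall>f\<in>J. \<forall>g\<in>J. f + g \<in> J) \<and> (\<forall>f\<in>J. \<forall>r. r * f \<in> J) \<and> 1 \<notin> J"

lemma proper_idealD:
  assumes "proper_ideal J"
  shows "f \<in> J \<Longrightarrow> g \<in> J \<Longrightarrow> f + g \<in> J" "f \<in> J \<Longrightarrow> r * f \<in> J" "1 \<notin> J"
    "f \<in> J \<Longrightarrow> g \<in> J \<Longrightarrow> f - g \<in> J"
proof -
  show add: "f \<in> J \<Longrightarrow> g \<in> J \<Longrightarrow> f + g \<in> J" and mult: "f \<in> J \<Longrightarrow> r * f \<in> J" and "1 \<notin> J" for f g r
    using assms by (simp_all add: proper_ideal_def)
  show "f \<in> J \<Longrightarrow> g \<in> J \<Longrightarrow> f - g \<in> J"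
    using add[of f "(- 1) * g"] mult[of g "- 1"] by simp
qed

lemma pconst_not_in_proper_ideal:
  assumes "proper_ideal J" "c \<noteq> 0"
  shows "pconst c \<notin> J"
proof
  assume "pconst c \<in> J"
  then have "pconst (1 / c) * pconst c \<in> J" by (rule proper_idealD(2)[OF assms(1)])
  with assms(2) proper_idealD(3)[OF assms(1)] show False by (simp flip: pconst_mult)
qed

text \<open>
  With \<open>q\<close> of least degree among the polynomials with \<open>q(x) \<in> J\<close>, and \<open>q = (X - c) q'\<close>, the ideal
  quotient \<open>J : q'(x)\<close> is still proper and contains \<open>x - c\<close>.
\<close>

lemma proper_ideal_adjoin_root:
  fixes J :: "'e::alg_closed_field mpol set"
  assumes J: "proper_ideal J" and q: "q \<noteq> 0" "mpoly_at q x \<in> J"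
  shows "\<exists>J' c. proper_ideal J' \<and> J \<subseteq> J' \<and> x - pconst c \<in> J'"
proof -
  define C where "C = (\<lambda>q. q \<noteq> 0 \<and> mpoly_at q x \<in> J)"
  obtain q where q: "C q" and min: "\<And>p. C p \<Longrightarrow> degree q \<le> degree p"
    using ex_has_least_nat[of C q degree] q by (auto simp: C_def)
  have "degree q > 0"
  proof (rule ccontr)
    assume "\<not> degree q > 0"
    then have "degree q = 0" by simp
    then obtain c where c: "q = [:c:]" by (rule degree_eq_zeroE)
    with q have "c \<noteq> 0" "pconst c \<in> J"
      by (simp_all add: C_def mpoly_at_pCons mpoly_at_0)
    with pconst_not_in_proper_ideal[OF J] show False by blast
  qed
  then obtain c where "poly q c = 0" using alg_closed_imp_poly_has_root by blast
  then have "[:- c, 1:] dvd q" by (simp add: poly_eq_0_iff_dvd)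
  then obtain q' where q': "q = [:- c, 1:] * q'" by (rule dvdE)
  have nz: "q' \<noteq> 0" using q q' by (auto simp: C_def)
  then have "degree q = Suc (degree q')"
    unfolding q' by (subst degree_mult_eq) auto
  then have "mpoly_at q' x \<notin> J"
    using min[of q'] nz by (auto simp: C_def)
  then have "proper_ideal {f. f * mpoly_at q' x \<in> J}"
    using proper_idealD[OF J] by (simp add: proper_ideal_def distrib_right mult.assoc)
  moreover have "J \<subseteq> {f. f * mpoly_at q' x \<in> J}"
    using proper_idealD(2)[OF J] by (auto simp: mult.commute)
  moreover have "x - pconst c \<in> {f. f * mpoly_at q' x \<in> J}"
    using q unfolding C_def q' mpoly_at_linear_factor by simp
  ultimately show ?thesis by blast
qed

text \<open>An integral equation modulo \<open>J\<close> persists modulo every larger ideal, so the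
  variables can be treated one at a time.\<close>

lemma proper_ideal_adjoin_roots:
  fixes J :: "'e::alg_closed_field mpol set"
  assumes "finite V" "proper_ideal J" "\<And>v. v \<in> V \<Longrightarrow> \<exists>q. q \<noteq> 0 \<and> mpoly_at q (pvar v) \<in> J"
  shows "\<exists>J'. proper_ideal J' \<and> J \<subseteq> J' \<and> (\<forall>v\<in>V. \<exists>c. pvar v - pconst c \<in> J')"
  using assms(1,3)
proof (induction V rule: finite_induct)
  case empty
  then show ?case using assms(2) by blast
next
  case (insert v V)
  have "\<exists>J'. proper_ideal J' \<and> J \<subseteq> J' \<and> (\<forall>v\<in>V. \<exists>c. pvar v - pconst c \<in> J')"
    by (rule insert.IH, rule insert.prems, rule insertI2)
  then obtain J' where J': "proper_ideal J'" "J \<subseteq> J'" "\<forall>v\<in>V. \<exists>c. pvar v - pconst c \<in> J'"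
    by (elim exE conjE)
  obtain q where q: "q \<noteq> 0" "mpoly_at q (pvar v) \<in> J"
    using insert.prems[OF insertI1] by (elim exE conjE)
  obtain J'' c where J'': "proper_ideal J''" "J' \<subseteq> J''" "pvar v - pconst c \<in> J''"
    using proper_ideal_adjoin_root[OF J'(1) q(1) subsetD[OF J'(2) q(2)]] by (elim exE conjE)
  have "\<exists>c. pvar u - pconst c \<in> J''" if "u \<in> insert v V" for u
  proof (cases "u = v")
    case True
    with J''(3) show ?thesis by blast
  next
    case False
    with that J'(3) have "\<exists>c. pvar u - pconst c \<in> J'" by simp
    with J''(2) show ?thesis by (elim exE) (rule exI, erule subsetD)
  qed
  with J''(1) order.trans[OF J'(2) J''(2)] show ?case by (intro exI[of _ J''] conjI ballI)
qed

lemma finite_var: "finite (UNIV :: var set)"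
proof -
  have "v \<in> range Xv \<union> {Alpha, Beta}" for v by (cases v) auto
  then have "UNIV \<subseteq> range Xv \<union> {Alpha, Beta}" by blast
  then show ?thesis by (rule finite_subset) simp
qed

text \<open>Once every variable is congruent to a constant, every polynomial is congruent to its
  value at \<open>t\<close>; for a member of \<open>J\<close> that value is a constant in a proper
  ideal, hence 0.\<close>

lemma proper_ideal_zero:
  fixes J :: "'e::alg_closed_field mpol set"
  assumes J: "proper_ideal J" and int: "\<And>v. \<exists>q. q \<noteq> 0 \<and> mpoly_at q (pvar v) \<in> J"
  obtains t where "\<And>f. f \<in> J \<Longrightarrow> peval t f = 0"
proof -
  obtain J' where J': "proper_ideal J'" "J \<subseteq> J'" "\<forall>v\<in>UNIV. \<exists>c. pvar v - pconst c \<in> J'"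
    using proper_ideal_adjoin_roots[OF finite_var J int] by (elim exE conjE)
  then obtain t where "\<forall>v. pvar v - pconst (t v) \<in> J'"
    using choice[of "\<lambda>v c. pvar v - pconst c \<in> J'"] by blast
  then have t: "pvar v - pconst (t v) \<in> J'" for v ..
  note J'_closed = proper_idealD[OF J'(1)]
  have zero: "0 \<in> J'" using J'_closed(2)[OF t, of 0] by simp
  have eval: "f - pconst (peval t f) \<in> J'" for f
  proof (induction f rule: mpol_ring_induct)
    case (const c)
    show ?case using zero by (simp add: peval_simps)
  next
    case (var v)
    show ?case using t by (simp add: peval_simps)
  next
    case (add f g)
    have "(f - pconst (peval t f)) + (g - pconst (peval t g)) \<in> J'"
      by (rule J'_closed(1)[OF add])
    then show ?case by (simp add: peval_simps pconst_add algebra_simps)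
  next
    case (mult f g)
    have "g * (f - pconst (peval t f)) + pconst (peval t f) * (g - pconst (peval t g)) \<in> J'"
      by (intro J'_closed(1) J'_closed(2) mult)
    then show ?case by (simp add: peval_simps pconst_mult algebra_simps)
  qed
  have "peval t f = 0" if "f \<in> J" for f
  proof (rule ccontr)
    assume "peval t f \<noteq> 0"
    moreover have "f - (f - pconst (peval t f)) \<in> J'"
      using that J'(2) by (intro J'_closed(4) eval) blast
    ultimately show False
      using pconst_not_in_proper_ideal[OF J'(1), of "peval t f"] by simp
  qed
  then show ?thesis by (rule that)
qed

section \<open>The trace to the invariants\<close>

definition orbit_sum :: "'f::field \<Rightarrow> 'f mpol \<Rightarrow> 'f mpol" where
  "orbit_sum z f = (\<Sum>g\<in>carrier heis. heis_subst z g f)"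

lemma heis_subst_hom:
  "heis_subst z g (f + h) = heis_subst z g f + heis_subst z g h"
  "heis_subst z g (f * h) = heis_subst z g f * heis_subst z g h"
  "heis_subst z g (sum F I) = (\<Sum>i\<in>I. heis_subst z g (F i))"
  "heis_subst z g 1 = 1"
  by (simp_all add: heis_subst_def psubst_add psubst_mult psubst_sum)

lemma invariant_orbit_sum:
  assumes z: "z ^ 3 = 1"
  shows "invariant z a b (orbit_sum z f)"
proof -
  have "heis_subst z h (orbit_sum z f) = orbit_sum z f" if h: "h \<in> carrier heis" for h
  proof -
    have "heis_subst z h (orbit_sum z f) = (\<Sum>g\<in>carrier heis. heis_subst z (h ** g) f)"
      unfolding orbit_sum_def heis_subst_hom
      by (rule sum.cong[OF refl]) (simp only: heis_subst_mult[OF z h])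
    also have "\<dots> = orbit_sum z f"
      unfolding orbit_sum_def by (rule sum_heis_left[OF h])
    finally show ?thesis .
  qed
  then show ?thesis by (simp add: invariant_def)
qed

lemma orbit_sum_add: "orbit_sum z (f + g) = orbit_sum z f + orbit_sum z g"
  by (simp add: orbit_sum_def heis_subst_hom sum.distrib)

lemma cls_sum_cong:
  "(\<And>i. i \<in> I \<Longrightarrow> cls a b (F i) = cls a b (G i)) \<Longrightarrow> cls a b (sum F I) = cls a b (sum G I)"
proof (induction I rule: infinite_finite_induct)
  case (insert i I)
  show ?case
    unfolding sum.insert[OF insert.hyps]
    by (rule cls_add_cong[OF insert.prems[OF insertI1] insert.IH[OF insert.prems[OF insertI2]]])
qed simp_all

text \<open>Linearity of the trace over invariants holds only modulo the relations, since invariance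
  is a property of the class.\<close>

lemma cls_orbit_sum_mult:
  assumes "invariant z a b p"
  shows "cls a b (orbit_sum z (p * f)) = cls a b (p * orbit_sum z f)"
  unfolding orbit_sum_def heis_subst_hom sum_distrib_left
  using assms by (intro cls_sum_cong cls_mult_cong) (simp_all add: invariant_def)

lemma invariant_rel_ideal:
  assumes "z ^ 3 = 1" "p \<in> rel_ideal a b"
  shows "invariant z a b p"
proof -
  have "cls a b (heis_subst z g p) = cls a b 0" for g
    using heis_subst_rel_ideal_le[OF assms(1), of g a b] assms(2) by (auto simp: cls_eq_iff)
  moreover have "cls a b p = cls a b 0" using assms(2) by (simp add: cls_eq_iff)
  ultimately show ?thesis by (simp add: invariant_def)
qed

lemma emb_diff: "emb (f - g) = emb f - emb g"
  using emb_add[of "f - g" g] by simp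

lemma emb_power:
  fixes f :: "'f::field mpol"
  shows "emb (f ^ n) = emb f ^ n"
proof -
  have one: "emb (1 :: 'f mpol) = 1" using emb_gens(1)[of "1 :: 'f"] by simp
  show ?thesis by (induction n) (simp_all add: one emb_mult)
qed

text \<open>An \<open>F\<close>-point of the whole quotient; avoidance of the fixed loci enters only
  after a geometric lift is available.\<close>

locale affine_point =
  fixes z a b :: "'f::field" and \<phi> :: "'f mpol set \<Rightarrow> 'f"
  assumes z: "z ^ 3 = 1"
    and char0: "\<And>n. n > 0 \<Longrightarrow> of_nat n \<noteq> (0::'f)"
    and \<phi>: "\<phi> \<in> affine_points z a b"
begin

definition val :: "'f mpol \<Rightarrow> 'f" where "val p = \<phi> (cls a b p)"

lemma val_add: "invariant z a b p \<Longrightarrow> invariant z a b q \<Longrightarrow> val (p + q) = val p + val q"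
  and val_mult: "invariant z a b p \<Longrightarrow> invariant z a b q \<Longrightarrow> val (p * q) = val p * val q"
  and val_pconst: "val (pconst c) = c"
proof -
  have hom: "\<phi> \<in> ring_hom (A_ab z a b) ring_of_type_algebra"
    and scalar: "\<phi> (scalar a b c) = c" for c
    using \<phi> by (simp_all add: affine_points_def)
  have carr: "cls a b p \<in> carrier (A_ab z a b)" if "invariant z a b p" for p
    using that by (simp add: carrier_A_ab[OF z])
  show "val (p + q) = val p + val q" if "invariant z a b p" "invariant z a b q"
    using ring_hom_add[OF hom carr[OF that(1)] carr[OF that(2)]]
    by (simp add: val_def A_ab_ops R_F_ops type_ring_sel)
  show "val (p * q) = val p * val q" if "invariant z a b p" "invariant z a b q"
    using ring_hom_mult[OF hom carr[OF that(1)] carr[OF that(2)]]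
    by (simp add: val_def A_ab_ops R_F_ops type_ring_sel)
  show "val (pconst c) = c"
    using scalar[of c] by (simp add: val_def scalar_def cls_def)
qed

lemma val_cong: "cls a b p = cls a b q \<Longrightarrow> val p = val q"
  by (simp add: val_def)

text \<open>
  Extending the trace followed by \<open>\<phi>\<close> linearly to the algebraic closure gives a functional on the
  polynomials there; the largest ideal on which it vanishes contains the base change of the kernel
  of \<open>\<phi>\<close>, and it is proper since the trace of 1 is the nonzero number of elements of the group.
\<close>

definition trace_val :: "'f mpol \<Rightarrow> 'f" where "trace_val f = val (orbit_sum z f)"

lemma trace_val_add: "trace_val (f + g) = trace_val f + trace_val g"
  by (simp add: trace_val_def orbit_sum_add val_add invariant_orbit_sum[OF z])

lemma trace_val_mult: "invariant z a b p \<Longrightarrow> trace_val (p * f) = val p * trace_val f"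
  unfolding trace_val_def
  by (simp add: val_cong[OF cls_orbit_sum_mult] val_mult invariant_orbit_sum[OF z])

lemma trace_val_1: "trace_val 1 \<noteq> 0"
proof -
  have "orbit_sum z 1 = pconst (of_nat (card (carrier heis)))"
    by (simp add: orbit_sum_def heis_subst_hom pconst_def)
  moreover have "card (carrier heis) > 0"
    using finite_heis one_in_heis card_gt_0_iff by blast
  ultimately show ?thesis
    using char0 by (simp add: trace_val_def val_pconst)
qed

definition functional :: "'f alg_closure mpol \<Rightarrow> 'f alg_closure" where
  "functional f = (\<Sum>m\<in>Poly_Mapping.keys f.
     Poly_Mapping.lookup f m * to_ac (trace_val (Poly_Mapping.single m 1)))"

lemma functional_over:
  assumes "finite K" "Poly_Mapping.keys f \<subseteq> K"
  shows "functional f = (\<Sum>m\<in>K. Poly_Mapping.lookup f m * to_ac (trace_val (Poly_Mapping.single m 1)))"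
  unfolding functional_def using assms
  by (intro sum.mono_neutral_left) (auto simp: in_keys_iff)

lemma functional_add: "functional (f + g) = functional f + functional g"
proof -
  let ?K = "Poly_Mapping.keys f \<union> Poly_Mapping.keys g"
  have "Poly_Mapping.keys (f + g) \<subseteq> ?K" by (rule keys_add)
  then show ?thesis
    by (simp add: functional_over[of ?K] lookup_add distrib_right sum.distrib)
qed

lemma functional_0: "functional 0 = 0"
  by (simp add: functional_def)

lemma functional_single:
  "functional (Poly_Mapping.single m c) = c * to_ac (trace_val (Poly_Mapping.single m 1))"
  by (cases "c = 0") (simp_all add: functional_def)

text \<open>A factor defined over \<open>F\<close> can be moved inside the trace, while the scalar
  \<open>c\<close> from the closure stays outside.\<close>

lemma functional_emb_single:
  "functional (emb p * Poly_Mapping.single m c) = c * to_ac (trace_val (p * Poly_Mapping.single m 1))"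
proof (induction p rule: mpol_induct)
  case zero
  have "trace_val 0 = 0" using trace_val_mult[OF invariant_pconst, of 0 0] val_pconst[of 0] by simp
  then show ?case by (simp add: emb_zero functional_0)
next
  case (single n d)
  have "Poly_Mapping.single n d * Poly_Mapping.single m 1 = pconst d * Poly_Mapping.single (n + m) 1"
    by (simp add: pconst_def mult_single)
  then show ?case
    by (simp add: emb_single mult_single functional_single trace_val_mult invariant_pconst val_pconst)
next
  case (add p q)
  then show ?case
    by (simp add: emb_add distrib_right functional_add trace_val_add distrib_left)
qed

definition kernel_ideal :: "'f alg_closure mpol set" where
  "kernel_ideal = {f. \<forall>r. functional (f * r) = 0}"

lemma proper_kernel_ideal: "proper_ideal kernel_ideal"
proof -
  have "functional 1 \<noteq> 0"
    using functional_single[of 0 1] trace_val_1 by simp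
  then have "functional (1 * 1) \<noteq> 0" by simp
  then have "1 \<notin> kernel_ideal"
    unfolding kernel_ideal_def by blast
  moreover have "f + g \<in> kernel_ideal" if "f \<in> kernel_ideal" "g \<in> kernel_ideal" for f g
    using that by (simp add: kernel_ideal_def distrib_right functional_add)
  moreover have "r * f \<in> kernel_ideal" if "f \<in> kernel_ideal" for f r
  proof -
    have "functional (f * (r * s)) = 0" for s using that by (simp add: kernel_ideal_def)
    then show ?thesis by (simp add: kernel_ideal_def ac_simps)
  qed
  ultimately show ?thesis by (simp add: proper_ideal_def)
qed

text \<open>Linearity of the trace over invariants pulls out the factor \<open>val p\<close>, on
  monomials and hence everywhere.\<close>

lemma emb_in_kernel_ideal:
  assumes "invariant z a b p" "val p = 0"
  shows "emb p \<in> kernel_ideal"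
proof -
  have "functional (emb p * r) = 0" for r
    by (induction r rule: mpol_induct)
      (simp_all add: functional_0 functional_emb_single trace_val_mult[OF assms(1)] assms(2)
        functional_add distrib_left)
  then show ?thesis by (simp add: kernel_ideal_def)
qed

lemma emb_diff_val_in_kernel_ideal:
  assumes "invariant z a b p"
  shows "emb p - pconst (to_ac (val p)) \<in> kernel_ideal"
proof -
  have "invariant z a b (p + pconst (- val p))"
    by (intro invariant_add invariant_pconst assms)
  moreover have "val (p + pconst (- val p)) = 0"
    by (simp add: val_add assms invariant_pconst val_pconst)
  ultimately have "emb (p + pconst (- val p)) \<in> kernel_ideal" by (rule emb_in_kernel_ideal)
  moreover have "pconst (- val p) = - pconst (val p)" by (simp add: pconst_def single_uminus)
  ultimately show ?thesis by (simp add: emb_diff emb_gens)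
qed

lemma emb_rel_in_kernel_ideal:
  assumes "p \<in> rel_ideal a b"
  shows "emb p \<in> kernel_ideal"
proof (rule emb_in_kernel_ideal)
  show "invariant z a b p" by (rule invariant_rel_ideal[OF z assms])
  have "cls a b p = cls a b (pconst 0)" using assms by (simp add: cls_eq_iff)
  from val_cong[OF this] show "val p = 0" by (simp only: val_pconst)
qed

text \<open>Modulo the ideal invariants become constants, so the cubic for the cube of x_i turns
  into a monic equation of degree 9; \<alpha> and \<beta> satisfy their defining relations.\<close>

lemma integral_mod_kernel_ideal: "\<exists>q. q \<noteq> 0 \<and> mpoly_at q (pvar v) \<in> kernel_ideal"
proof (cases v)
  case (Xv i)
  let ?x = "pvar v :: 'f alg_closure mpol"
  let ?e1 = "esym1 cube_var :: 'f mpol" and ?e2 = "esym2 cube_var :: 'f mpol" and ?e3 = "esym3 cube_var :: 'f mpol"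
  let ?c = "\<lambda>e. to_ac (val e)"
  \<comment> \<open>Coefficients in ascending order: X^9 - e1 X^6 + e2 X^3 - e3, with each e
    replaced by its value at the \<open>F\<close>-point.\<close>
  let ?q = "[:- ?c ?e3, 0, 0, ?c ?e2, 0, 0, - ?c ?e1, 0, 0, 1:]"
  have neg: "pconst (- c) = - pconst c" for c :: "'f alg_closure"
    by (simp add: pconst_def single_uminus)
  have cube: "emb (cube_var i) = ?x ^ 3"
    by (simp add: cube_var_def emb_power emb_gens Xv)
  have "emb (cube_var i ^ 3 - ?e1 * cube_var i ^ 2 + ?e2 * cube_var i - ?e3) = 0"
    by (simp add: esym_relation emb_zero)
  then have rel: "(?x ^ 3) ^ 3 = emb ?e1 * (?x ^ 3) ^ 2 - emb ?e2 * ?x ^ 3 + emb ?e3"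
    by (simp add: emb_diff emb_add emb_mult emb_power cube algebra_simps)
  have "mpoly_at ?q ?x = (?x ^ 3) ^ 3 - pconst (?c ?e1) * (?x ^ 3) ^ 2 + pconst (?c ?e2) * ?x ^ 3 - pconst (?c ?e3)"
    by (simp add: mpoly_at_pCons mpoly_at_0 neg eval_nat_numeral algebra_simps)
  \<comment> \<open>The exact identity \<open>rel\<close> eliminates the ninth power, leaving
    multiples of differences between an invariant and its value.\<close>
  also have "\<dots> = (?x ^ 3) ^ 2 * (emb ?e1 - pconst (?c ?e1)) - ?x ^ 3 * (emb ?e2 - pconst (?c ?e2))
      + 1 * (emb ?e3 - pconst (?c ?e3))"
    unfolding rel by (simp add: algebra_simps)
  also have "\<dots> \<in> kernel_ideal"
    by (intro proper_idealD(1)[OF proper_kernel_ideal] proper_idealD(4)[OF proper_kernel_ideal]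
        proper_idealD(2)[OF proper_kernel_ideal] emb_diff_val_in_kernel_ideal invariant_esym z)
  finally have "mpoly_at ?q ?x \<in> kernel_ideal" .
  moreover have "?q \<noteq> 0" by simp
  ultimately show ?thesis by blast
next
  case Alpha
  have neg: "pconst (- c) = - pconst c" for c :: "'f alg_closure"
    by (simp add: pconst_def single_uminus)
  have "mpoly_at [:- to_ac a, 0, 0, 1:] (pvar Alpha) = emb (pvar Alpha ^ 3 - pconst a)"
    by (simp add: mpoly_at_pCons mpoly_at_0 emb_diff emb_mult emb_gens power3_eq_cube mult.assoc neg)
  with emb_rel_in_kernel_ideal[OF rel_ideal_gens(1)]
  have "mpoly_at [:- to_ac a, 0, 0, 1:] (pvar Alpha) \<in> kernel_ideal" by simp
  then show ?thesis unfolding Alpha by (intro exI[of _ "[:- to_ac a, 0, 0, 1:]"]) simp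
next
  case Beta
  have neg: "pconst (- c) = - pconst c" for c :: "'f alg_closure"
    by (simp add: pconst_def single_uminus)
  have "mpoly_at [:- to_ac b, 0, 0, 1:] (pvar Beta) = emb (pvar Beta ^ 3 - pconst b)"
    by (simp add: mpoly_at_pCons mpoly_at_0 emb_diff emb_mult emb_gens power3_eq_cube mult.assoc neg)
  with emb_rel_in_kernel_ideal[OF rel_ideal_gens(2)]
  have "mpoly_at [:- to_ac b, 0, 0, 1:] (pvar Beta) \<in> kernel_ideal" by simp
  then show ?thesis unfolding Beta by (intro exI[of _ "[:- to_ac b, 0, 0, 1:]"]) simp
qed

text \<open>A zero of \<open>kernel_ideal\<close> satisfies the relations of Y and gives every
  invariant its value under \<open>\<phi>\<close>.\<close>

lemma geometric_lift_exists:
  obtains t where "t Alpha ^ 3 = to_ac a" "t Beta ^ 3 = to_ac b"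
    "\<And>p. invariant z a b p \<Longrightarrow> ev t p = to_ac (val p)"
proof -
  obtain t where t: "\<And>f. f \<in> kernel_ideal \<Longrightarrow> peval t f = 0"
    using proper_ideal_zero[OF proper_kernel_ideal integral_mod_kernel_ideal] by blast
  show ?thesis
  proof (rule that)
    show "t Alpha ^ 3 = to_ac a" "t Beta ^ 3 = to_ac b"
      using t[OF emb_rel_in_kernel_ideal[OF rel_ideal_gens(1)]]
        t[OF emb_rel_in_kernel_ideal[OF rel_ideal_gens(2)]]
      by (simp_all add: ev_hom ev_simps flip: ev_def)
    fix p assume "invariant z a b p"
    from t[OF emb_diff_val_in_kernel_ideal[OF this]] show "ev t p = to_ac (val p)"
      by (simp add: peval_hom peval_simps ev_def)
  qed
qed

text \<open>
  For all polynomials \<open>f\<close> over the algebraic closure, the sums of \<open>f\<close> over the orbits of \<open>t\<close> and \<open>t'\<close>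
  agree. If \<open>t'\<close> were not in the orbit of \<open>t\<close>, then an \<open>f\<close> that vanishes on both orbits except
  at \<open>t'\<close> would contradict this.
\<close>

lemma geometric_lift_transitive:
  assumes t: "\<And>p. invariant z a b p \<Longrightarrow> ev t p = to_ac (val p)"
    and t': "\<And>p. invariant z a b p \<Longrightarrow> ev t' p = to_ac (val p)"
  shows "\<exists>g\<in>carrier heis. t' = pact z g t"
proof (rule ccontr)
  assume not_orbit: "\<not> (\<exists>g\<in>carrier heis. t' = pact z g t)"
  have trace: "(\<Sum>g\<in>carrier heis. ev (pact z g s) f) = ev s (orbit_sum z f)" for s f
    by (simp add: orbit_sum_def ev_hom ev_heis_subst)
  \<comment> \<open>For monomials over \<open>F\<close> both sides are values of the invariant
    \<open>orbit_sum\<close>; scalars from the closure are pulled out.\<close>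
  have sums: "(\<Sum>g\<in>carrier heis. peval (pact z g t) f) = (\<Sum>g\<in>carrier heis. peval (pact z g t') f)" for f
  proof (induction f rule: mpol_induct)
    case (single m c)
    have "Poly_Mapping.single m c = pconst c * emb (Poly_Mapping.single m 1)"
      by (simp add: emb_single pconst_def mult_single)
    then have "peval s (Poly_Mapping.single m c) = c * ev s (Poly_Mapping.single m 1)" for s
      by (simp add: peval_simps ev_def)
    then show ?case
      by (simp add: sum_distrib_left[symmetric] trace t t' invariant_orbit_sum[OF z])
  qed (simp_all add: peval_hom peval_simps sum.distrib)
  define orb where "orb s = (\<lambda>g. pact z g s) ` carrier heis" for s
  define U where "U = orb t \<union> orb t' - {t'}"
  have "finite U" by (simp add: U_def orb_def finite_heis)
  have "\<exists>v. t' v \<noteq> s v" if "s \<in> U" for s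
  proof -
    have "t' \<noteq> s" using that by (auto simp: U_def)
    then show ?thesis by (simp add: fun_eq_iff)
  qed
  then obtain v where v: "\<And>s. s \<in> U \<Longrightarrow> t' (v s) \<noteq> s (v s)" by metis
  \<comment> \<open>One linear factor per point s of \<open>U\<close>, in a coordinate
    \<open>v s\<close> that separates s from \<open>t'\<close>.\<close>
  define f where "f = (\<Prod>s\<in>U. pvar (v s) - pconst (s (v s)))"
  have f_eval: "peval r f = (\<Prod>s\<in>U. r (v s) - s (v s))" for r
    by (simp add: f_def peval_hom peval_simps)
  have f0: "peval s f = 0" if "s \<in> U" for s
    unfolding f_eval using that \<open>finite U\<close> by (intro prod_zero) auto
  have f1: "peval t' f \<noteq> 0"
    unfolding f_eval using v \<open>finite U\<close> by (auto simp: prod_zero_iff)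
  have "peval (pact z g t) f = 0" if "g \<in> carrier heis" for g
    using that not_orbit by (intro f0) (auto simp: U_def orb_def)
  then have "(\<Sum>g\<in>carrier heis. peval (pact z g t') f) = 0"
    using sums[of f] by simp
  moreover have "(\<Sum>g\<in>carrier heis. peval (pact z g t') f) =
      (\<Sum>g\<in>{g \<in> carrier heis. pact z g t' = t'}. peval t' f)"
  proof (rule sum.mono_neutral_cong_right[OF finite_heis])
    show "\<forall>g\<in>carrier heis - {g \<in> carrier heis. pact z g t' = t'}. peval (pact z g t') f = 0"
      by (auto intro!: f0 simp: U_def orb_def)
  qed auto
  \<comment> \<open>A nontrivial stabilizer makes \<open>t'\<close> occur several times in its orbit
    sum, but the multiplicity is a positive integer, nonzero in characteristic 0.\<close>
  ultimately have "of_nat (card {g \<in> carrier heis. pact z g t' = t'}) * peval t' f = 0"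
    by simp
  moreover have "of_nat (card {g \<in> carrier heis. pact z g t' = t'}) \<noteq> (0 :: 'f alg_closure)"
  proof -
    have "mat 1 \<in> {g \<in> carrier heis. pact z g t' = t'}"
      by (simp add: one_in_heis pact_one)
    then have "card {g \<in> carrier heis. pact z g t' = t'} > 0"
      using finite_heis by (auto simp: card_gt_0_iff)
    from char0[OF this] show ?thesis
      unfolding to_ac_of_nat[symmetric] to_ac_eq_0_iff .
  qed
  ultimately show False using f1 by simp
qed

text \<open>The conjugate point lies over the same \<open>F\<close>-point, since the values of
  invariants at \<open>t\<close> are already in \<open>F\<close>.\<close>

lemma geometric_lift_galois_orbit:
  assumes t: "\<And>p. invariant z a b p \<Longrightarrow> ev t p = to_ac (val p)"
    and \<sigma>: "\<sigma> \<in> carrier abs_gal"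
  shows "\<exists>g\<in>carrier heis. \<sigma> \<circ> t = pact z g t"
proof (rule geometric_lift_transitive[OF t])
  fix p assume "invariant z a b p"
  then show "ev (\<sigma> \<circ> t) p = to_ac (val p)"
    by (simp add: gal_ev[OF \<sigma>, symmetric] t galD[OF \<sigma>])
qed

text \<open>The kernel of evaluation at \<open>t\<close> is a prime of \<open>R_F a b\<close> that
  contains every h f - f, and it contracts to the kernel of \<open>\<phi>\<close>.\<close>

lemma point_fixed_imp_in_S_locus:
  assumes t: "t Alpha ^ 3 = to_ac a" "t Beta ^ 3 = to_ac b"
    and val: "\<And>p. invariant z a b p \<Longrightarrow> ev t p = to_ac (val p)"
    and h: "h \<in> carrier heis" "h \<noteq> mat 1" "pact z h t = t"
  shows "a_kernel (A_ab z a b) ring_of_type_algebra \<phi> \<in> S_locus z a b"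
proof -
  let ?K = "ring_of_type_algebra :: 'f alg_closure ring"
  define \<psi> where "\<psi> C = ev t (SOME f. cls a b f = C)" for C
  have \<psi>: "\<psi> (cls a b f) = ev t f" for f
  proof -
    have "cls a b (SOME g. cls a b g = cls a b f) = cls a b f"
      by (rule someI) (rule refl)
    then show ?thesis unfolding \<psi>_def by (rule ev_cls_cong[OF t])
  qed
  have R: "cring (R_F a b)" by (rule R_F_cring)
  have "\<psi> \<in> ring_hom (R_F a b) ?K"
    by (rule ring_hom_memI) (auto simp: carrier_R_F R_F_ops \<psi> type_ring_sel ev_simps ev_hom)
  then have "ring_hom_ring (R_F a b) ?K \<psi>"
    by (intro ring_hom_ringI2 ring_from_type_algebra cring.axioms(1)[OF R])
  moreover have "primeideal {0} ?K"
    using domain.zeroprimeideal[of ?K] field_from_type_algebra[where 'a = "'f alg_closure"]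
    unfolding type_ring_sel by (simp add: field.axioms(1))
  ultimately have prime: "primeideal {C \<in> carrier (R_F a b). \<psi> C \<in> {0}} (R_F a b)"
    using ring_hom_ring.primeideal_vimage R by blast
  let ?Q = "{C \<in> carrier (R_F a b). \<psi> C \<in> {0}}"
  have gen: "act z h C \<ominus>\<^bsub>R_F a b\<^esub> C \<in> ?Q" if C: "C \<in> carrier (R_F a b)" for C
  proof -
    obtain f where f: "C = cls a b f" using C by (auto simp: carrier_R_F)
    have "act z h C \<ominus>\<^bsub>R_F a b\<^esub> C = cls a b (heis_subst z h f - f)"
      unfolding f act_cls[OF z h(1)] by (rule R_F_ops)
    then show ?thesis
      by (simp add: \<psi> ev_hom ev_heis_subst h(3) carrier_R_F)
  qed
  have "fixed_ideal z a b h \<subseteq> ?Q"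
    unfolding fixed_ideal_def
    by (rule ring.genideal_minimal[OF cring.axioms(1)[OF R] primeideal.axioms(1)[OF prime]])
      (use gen in blast)
  with prime have "?Q \<in> fixed_locus z a b h"
    by (simp add: fixed_locus_def vanishing_def Spec_def)
  moreover have "a_kernel (A_ab z a b) ring_of_type_algebra \<phi> = quotient_map z a b ?Q"
  proof -
    have "\<phi> C = 0 \<longleftrightarrow> \<psi> C = 0" if C: "C \<in> carrier (A_ab z a b)" for C
    proof -
      obtain f where f: "C = cls a b f" "invariant z a b f"
        using C by (auto simp: carrier_A_ab[OF z])
      have "\<psi> C = to_ac (\<phi> C)" unfolding f(1) \<psi> val[OF f(2)] val_def ..
      then show ?thesis by simp
    qed
    moreover have "carrier (A_ab z a b) \<subseteq> carrier (R_F a b)"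
      by (auto simp: A_ab_def)
    ultimately show ?thesis
      unfolding quotient_map_def a_kernel_def' type_ring_sel by blast
  qed
  ultimately show ?thesis
    using h(1,2) unfolding S_locus_def by (auto simp: heis_def)
qed

end

lemma X_point_imp_good_point:
  fixes a b z :: "'f::field"
  assumes z: "z ^ 3 = 1"
    and char0: "\<And>n. n > 0 \<Longrightarrow> of_nat n \<noteq> (0::'f)"
    and X: "\<phi> \<in> X_points z a b"
  shows "\<exists>t. good_point a b t \<and>
    (\<forall>\<sigma>\<in>carrier abs_gal. \<exists>g\<in>carrier heis. \<sigma> \<circ> t = pact z g t)"
proof -
  interpret affine_point z a b \<phi>
    using z char0 X by unfold_locales (simp_all add: X_points_def)
  obtain t where t: "t Alpha ^ 3 = to_ac a" "t Beta ^ 3 = to_ac b"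
    and val: "\<And>p. invariant z a b p \<Longrightarrow> ev t p = to_ac (val p)"
    using geometric_lift_exists by blast
  have "\<exists>i. t (Xv i) \<noteq> 0"
  proof (rule ccontr)
    assume "\<not> (\<exists>i. t (Xv i) \<noteq> 0)"
    \<comment> \<open>The central generator scales the x_i and fixes \<alpha> and \<beta>, so it
      fixes every point whose x_i all vanish.\<close>
    then have "pact z (heis_of 0 0 1) t v = t v" for v
      by (cases v) (simp_all add: pact_simps heis_of_entries zpow_def)
    then have fixed: "pact z (heis_of 0 0 1) t = t" by (rule ext)
    have "heis_of 0 0 1 \<noteq> mat 1"
    proof
      assume "heis_of 0 0 1 = mat 1"
      then have "heis_of 0 0 1 $ 1 $ 3 = (mat 1 :: 3^3^3) $ 1 $ 3" by simp
      then show False by (simp add: heis_of_entries mat_def)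
    qed
    then have "a_kernel (A_ab z a b) ring_of_type_algebra \<phi> \<in> S_locus z a b"
      using point_fixed_imp_in_S_locus[OF t val heis_of_entries(4) _ fixed] by blast
    with X show False by (simp add: X_points_def X_space_def)
  qed
  with t geometric_lift_galois_orbit[OF val] show ?thesis
    by (auto simp: good_point_def)
qed

text \<open>Freeness of the action on good points makes \<rho> multiplicative; comparing (1,3)
  entries in the product rule then gives the coboundary equation.\<close>

lemma good_point_imp_coboundary:
  fixes a b z :: "'f::field"
  assumes z: "z ^ 3 = 1" "z \<noteq> 1" and ab: "a \<noteq> 0" "b \<noteq> 0"
    and t: "good_point a b t"
    and orbit: "\<And>\<sigma>. \<sigma> \<in> carrier abs_gal \<Longrightarrow> \<exists>g\<in>carrier heis. \<sigma> \<circ> t = pact z g t"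
  shows "\<exists>w\<in>cochains1. \<forall>\<sigma>\<in>carrier abs_gal. \<forall>\<tau>\<in>carrier abs_gal.
    w \<tau> - w (\<sigma> \<circ> \<tau>) + w \<sigma> = kummer_cocycle z (t Alpha) \<sigma> * kummer_cocycle z (t Beta) \<tau>"
proof -
  define \<rho> where "\<rho> \<sigma> = (SOME g. g \<in> carrier heis \<and> \<sigma> \<circ> t = pact z g t)" for \<sigma>
  have \<rho>: "\<rho> \<sigma> \<in> carrier heis" "\<sigma> \<circ> t = pact z (\<rho> \<sigma>) t" if "\<sigma> \<in> carrier abs_gal" for \<sigma>
  proof -
    have "\<exists>g. g \<in> carrier heis \<and> \<sigma> \<circ> t = pact z g t" using orbit[OF that] by blast
    from someI_ex[OF this] show "\<rho> \<sigma> \<in> carrier heis" "\<sigma> \<circ> t = pact z (\<rho> \<sigma>) t"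
      unfolding \<rho>_def by blast+
  qed
  have t': "t Alpha ^ 3 = to_ac a" "t Beta ^ 3 = to_ac b"
    using t by (simp_all add: good_point_def)
  have P: "kummer_cocycle z (t Alpha) \<sigma> = \<rho> \<sigma> $ 1 $ 2"
    and Q: "kummer_cocycle z (t Beta) \<sigma> = \<rho> \<sigma> $ 2 $ 3" if \<sigma>: "\<sigma> \<in> carrier abs_gal" for \<sigma>
    using fun_cong[OF \<rho>(2)[OF \<sigma>], of Alpha] fun_cong[OF \<rho>(2)[OF \<sigma>], of Beta]
    by (simp_all add: kummer_cocycle_eq_iff[OF z t'(1) ab(1) \<sigma>] kummer_cocycle_eq_iff[OF z t'(2) ab(2) \<sigma>]
        pact_simps)
  have mult: "\<rho> (\<sigma> \<circ> \<tau>) = \<rho> \<sigma> ** \<rho> \<tau>" if \<sigma>: "\<sigma> \<in> carrier abs_gal" and \<tau>: "\<tau> \<in> carrier abs_gal" for \<sigma> \<tau>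
  proof (rule pact_inj[OF z t ab \<rho>(1)[OF gal_comp[OF \<sigma> \<tau>]] heis_mult_closed[OF \<rho>(1)[OF \<sigma>] \<rho>(1)[OF \<tau>]]])
    \<comment> \<open>Galois commutes with the group action, so \<rho>(\<tau>) is applied after
      \<rho>(\<sigma>); for a right action that is the product
      \<rho>(\<sigma>)\<rho>(\<tau>).\<close>
    have "pact z (\<rho> (\<sigma> \<circ> \<tau>)) t = \<sigma> \<circ> (\<tau> \<circ> t)"
      unfolding \<rho>(2)[OF gal_comp[OF \<sigma> \<tau>], symmetric] by (rule comp_assoc)
    also have "\<dots> = pact z (\<rho> \<tau>) (pact z (\<rho> \<sigma>) t)"
      unfolding \<rho>(2)[OF \<tau>] gal_pact[OF \<sigma>] \<rho>(2)[OF \<sigma>] ..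
    also have "\<dots> = pact z (\<rho> \<sigma> ** \<rho> \<tau>) t"
      by (rule pact_mult[OF z(1) \<rho>(1)[OF \<sigma>] \<rho>(1)[OF \<tau>], symmetric])
    finally show "pact z (\<rho> (\<sigma> \<circ> \<tau>)) t = pact z (\<rho> \<sigma> ** \<rho> \<tau>) t" .
  qed
  define w where "w = (\<lambda>\<sigma>\<in>carrier abs_gal. - (\<rho> \<sigma> $ 1 $ 3))"
  have "w \<in> cochains1"
  proof (rule cochains1I)
    show "w \<in> extensional (carrier abs_gal)" by (simp add: w_def)
    \<comment> \<open>\<rho>(\<sigma>) depends only on the images of the five coordinates of
      \<open>t\<close>, so these witness continuity.\<close>
    show "finite (range t)" using finite_var by (rule finite_imageI)
    fix \<sigma> \<tau> :: "'f gal" assume st: "\<sigma> \<in> carrier abs_gal" "\<tau> \<in> carrier abs_gal" "\<And>s. s \<in> range t \<Longrightarrow> \<tau> s = \<sigma> s"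
    then have "\<tau> \<circ> t = \<sigma> \<circ> t" by (auto simp: fun_eq_iff)
    then have "\<rho> \<tau> = \<rho> \<sigma>" by (simp add: \<rho>_def)
    then show "w \<tau> = w \<sigma>" using st(1,2) by (simp add: w_def)
  qed
  moreover have "w \<tau> - w (\<sigma> \<circ> \<tau>) + w \<sigma> = kummer_cocycle z (t Alpha) \<sigma> * kummer_cocycle z (t Beta) \<tau>"
    if \<sigma>: "\<sigma> \<in> carrier abs_gal" and \<tau>: "\<tau> \<in> carrier abs_gal" for \<sigma> \<tau>
    using \<sigma> \<tau> gal_comp[OF \<sigma> \<tau>]
    by (simp add: w_def P[OF \<sigma>] Q[OF \<tau>] mult[OF \<sigma> \<tau>] heis_mult_entries(3)[OF \<rho>(1)[OF \<sigma>] \<rho>(1)[OF \<tau>]])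
  ultimately show ?thesis by blast
qed

theorem mainTheorem1:
  fixes \<iota> :: "'k::field_char_0 \<Rightarrow> 'f::field" and \<zeta> :: 'k and a b :: 'f
  assumes "number_field TYPE('k)"
    and "primitive_cube_root \<zeta>"
    and "\<iota> \<in> ring_hom ring_of_type_algebra ring_of_type_algebra"
    and "a \<noteq> 0" and "b \<noteq> 0"
  shows "X_points (\<iota> \<zeta>) a b \<noteq> {} \<longleftrightarrow>
         cup (kummer (\<iota> \<zeta>) a) (kummer (\<iota> \<zeta>) b) = \<one>\<^bsub>H2\<^esub>"
proof -
  have hom: "\<iota> (x + y) = \<iota> x + \<iota> y" "\<iota> (x * y) = \<iota> x * \<iota> y" "\<iota> 1 = 1" for x y
    using assms(3) by (simp_all add: ring_hom_def type_ring_sel)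
  have "\<iota> 0 + 0 = \<iota> 0 + \<iota> 0" using hom(1)[of 0 0] by (simp only: add_0 add_0_right)
  then have \<iota>0: "\<iota> 0 = 0" unfolding add_left_cancel by (rule sym)
  \<comment> \<open>A ring homomorphism between fields is injective; this carries characteristic 0
    and \<zeta> \<noteq> 1 over to \<open>F\<close>.\<close>
  have nz: "\<iota> x \<noteq> 0" if "x \<noteq> 0" for x
    using hom(2)[of x "inverse x"] hom(3) that by auto
  have of_nat: "\<iota> (of_nat n) = of_nat n" for n
    by (induction n) (simp_all add: \<iota>0 hom)
  have char0: "of_nat n \<noteq> (0::'f)" if "n > 0" for n
    using nz[of "of_nat n"] that by (simp add: of_nat)
  have z: "\<iota> \<zeta> ^ 3 = 1"
    using assms(2) hom(2,3) by (metis primitive_cube_root_def power3_eq_cube)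
  have "\<iota> (\<zeta> - 1) + 1 = \<iota> \<zeta>" using hom(1)[of "\<zeta> - 1" 1] hom(3) by simp
  moreover have "\<iota> (\<zeta> - 1) \<noteq> 0" using assms(2) by (intro nz) (simp add: primitive_cube_root_def)
  ultimately have z1: "\<iota> \<zeta> \<noteq> 1" by auto
  obtain c d where c: "c ^ 3 = to_ac a" and d: "d ^ 3 = to_ac b"
    using nth_root_exists[of 3 "to_ac a"] nth_root_exists[of 3 "to_ac b"] by auto
  show ?thesis
  proof
    assume "X_points (\<iota> \<zeta>) a b \<noteq> {}"
    then obtain \<phi> where \<phi>: "\<phi> \<in> X_points (\<iota> \<zeta>) a b" by blast
    obtain t where t: "good_point a b t"
      "\<forall>\<sigma>\<in>carrier abs_gal. \<exists>g\<in>carrier heis. \<sigma> \<circ> t = pact (\<iota> \<zeta>) g t"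
      using X_point_imp_good_point[OF z char0 \<phi>] by blast
    then have "t Alpha ^ 3 = to_ac a" "t Beta ^ 3 = to_ac b" by (simp_all add: good_point_def)
    \<comment> \<open>The cube roots are now the coordinates of \<open>t\<close> rather than
      \<open>c\<close> and \<open>d\<close>; the Kummer class does not depend on that
      choice.\<close>
    from cup_kummer_eq_one_iff[OF z z1 this(1) assms(4) this(2) assms(5)]
      good_point_imp_coboundary[OF z z1 assms(4,5) t(1) bspec[OF t(2)]]
    show "cup (kummer (\<iota> \<zeta>) a) (kummer (\<iota> \<zeta>) b) = \<one>\<^bsub>H2\<^esub>" by blast
  next
    assume "cup (kummer (\<iota> \<zeta>) a) (kummer (\<iota> \<zeta>) b) = \<one>\<^bsub>H2\<^esub>"
    then obtain w where w: "w \<in> cochains1" "\<forall>\<sigma>\<in>carrier abs_gal. \<forall>\<tau>\<in>carrier abs_gal.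
        w \<tau> - w (\<sigma> \<circ> \<tau>) + w \<sigma> = kummer_cocycle (\<iota> \<zeta>) c \<sigma> * kummer_cocycle (\<iota> \<zeta>) d \<tau>"
      unfolding cup_kummer_eq_one_iff[OF z z1 c assms(4) d assms(5)] by blast
    obtain t where t: "good_point a b t"
      "\<forall>\<sigma>\<in>carrier abs_gal. \<exists>g\<in>carrier heis. \<sigma> \<circ> t = pact (\<iota> \<zeta>) g t"
      using coboundary_imp_good_point[OF z z1 c assms(4) d assms(5) w(1) bspec[OF bspec[OF w(2)]]] by blast
    show "X_points (\<iota> \<zeta>) a b \<noteq> {}"
      by (rule good_point_imp_X_point[OF z z1 assms(4,5) char0 t(1) bspec[OF t(2)]])
  qed
qed

end
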